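(* Let $(G,+)$ be a finite abelian group with identity $0$, $n$ a positive integer, $W=G\wr S_n$, let $\underline\sigma\in\Sigma_n(G)$ and let $Y$ be a nonempty subset of $W$ with dual distribution $(a'_{\underline\lambda})_{\underline\lambda\in\Lambda_n(G)}$. Then $Y$ is $\underline\sigma$-transitive if and only if $a'_{\underline\lambda}=0$ for all $\underline\lambda\in\Lambda_n(G)$ satisfying $\underline\sigma\to\underline\lambda$ and $\underline\lambda(0)\neq(n)$.
   Context: $[n]=\{1,\dots,n\}$. $W=G\wr S_n$ consists of pairs $(g,\pi)$, $g\in G^n$, $\pi\in S_n$, with $(f,\pi)(g,\sigma)=(f+g^\pi,\pi\sigma)$, $g^\pi=(g_{\pi^{-1}(1)},\dots,g_{\pi^{-1}(n)})$. A nonempty subset $Y$ of a group acting on a finite set $\Omega$ is transitive on $\Omega$ if there is $c>0$ such that for all $a,b\in\Omega$ exactly $c$ elements $y\in Y$ satisfy $ya=b$. Partitions: weakly decreasing sequences of nonnegative integers with finite sum; $\mathrm{Par}$ the set of all partitions; $\emptyset$ the partition of 0; $\lambda\trianglelefteq\mu$ means $\sum_{i\le m}\lambda_i\le\sum_{i\le m}\mu_i$ for all $m$. $\Lambda_n(G)$: maps $\underline\lambda:G\to\mathrm{Par}$ with $\sum_g|\underline\lambda(g)|=n$; $\Sigma_n(G)$: maps $\underline\sigma$ from subgroups of $G$ to $\mathrm{Par}$ with $\sum_{U\le G}|\underline\sigma(U)|=n$. Tabloids: a $\underline\sigma$-tableau consists of, for each $U\le G$, the Young diagram of $\underline\sigma(U)$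 with boxes filled by pairs $(c,i)$, $c\in G/U$, $i\in[n]$, all $i$ pairwise distinct; row-equivalence classes are $\underline\sigma$-tabloids; $W$ acts entrywise by $(g,\pi)\cdot(c,i)=(c+g_{\pi(i)},\pi(i))$; $Y$ is $\underline\sigma$-transitive if it is transitive on the $\underline\sigma$-tabloids. Irreducible characters: fix an isomorphism $g\mapsto\theta^g$ of $G$ onto its linear characters; $\psi^\mu$ is the irreducible character of $S_k$ indexed by the partition $\mu$ of $k$. For $\underline\lambda\in\Lambda_n(G)$ choose a partition of $[n]$ into sets $P_g$ with $|P_g|=|\underline\lambda(g)|$, $S=\prod_g S_{P_g}$, and let $\chi^{\underline\lambda}$ be the induction from $G^n\rtimes S$ to $W$ of $((x_i),\pi)\mapsto\prod_{g}\big(\prod_{i\in P_g}\theta^g(x_i)\big)\psi^{\underline\lambda(g)}(\pi|_{P_g})$; these are all the irreducible characters of $W$. Dual distribution: $a'_{\underline\lambda}=\frac{\chi^{\underline\lambda}(1)}{|Y|}\sum_{x,y\in Y}\chi^{\underline\lambda}(x^{-1}y)$. Relation $\to$: for $U\le G$ let $U^\circ=\{g:\theta^g(u)=1\ \forall u\in U\}$. $\underline\sigma\to\underline\lambda$ if there is $\underline\mu\in\Lambda_n(G)$ with $\underline\mu(g)\trianglelefteq\underline\lambda(g)$ for all $g$ obtained by colouring every box of each diagram $\underline\sigma(U)$ with an element of $U^\circ$ and letting $\underline\mu(g)$ have one part $k$ for each row containing exactly $k\ge1$ boxes coloured $g$. *)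

theory Defs
  imports
    Complex_Main
    "HOL-Library.Function_Algebras"
    "HOL-Combinatorics.Orbits"
    "HOL-Algebra.Coset"
    "HOL-Algebra.Sym_Groups"
begin

section \<open>Partitions\<close>

text \<open>Parts are indexed from 0: \<open>p i\<close> is the \<open>(i+1)\<close>-st part.\<close>

definition Par :: "(nat \<Rightarrow> nat) set" where
  "Par = {p. antimono p \<and> finite {i. p i \<noteq> 0}}"

definition psize :: "(nat \<Rightarrow> nat) \<Rightarrow> nat" where
  "psize p = (\<Sum>i | p i \<noteq> 0. p i)"

definition dominated :: "(nat \<Rightarrow> nat) \<Rightarrow> (nat \<Rightarrow> nat) \<Rightarrow> bool" where
  "dominated p q \<longleftrightarrow> (\<forall>m. (\<Sum>i<m. p i) \<le> (\<Sum>i<m. q i))"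

text \<open>The partition \<open>(n)\<close>.\<close>

definition one_part :: "nat \<Rightarrow> nat \<Rightarrow> nat" where
  "one_part n = (\<lambda>i. if i = 0 then n else 0)"

definition Lambda :: "('g, 'm) monoid_scheme \<Rightarrow> nat \<Rightarrow> ('g \<Rightarrow> nat \<Rightarrow> nat) set" where
  "Lambda G n = {l \<in> carrier G \<rightarrow>\<^sub>E Par. (\<Sum>g\<in>carrier G. psize (l g)) = n}"

definition Sigma_par :: "('g, 'm) monoid_scheme \<Rightarrow> nat \<Rightarrow> ('g set \<Rightarrow> nat \<Rightarrow> nat) set" where
  "Sigma_par G n = {s \<in> {U. subgroup U G} \<rightarrow>\<^sub>E Par. (\<Sum>U | subgroup U G. psize (s U)) = n}"


section \<open>The wreath product and transitivity\<close>

text \<open>The group \<open>G\<close> is written multiplicatively, so \<open>f + g\<^sup>\<pi>\<close> is the first component below.\<close>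

definition wreath ::
  "('g, 'm) monoid_scheme \<Rightarrow> nat \<Rightarrow> ((nat \<Rightarrow> 'g) \<times> (nat \<Rightarrow> nat)) monoid" where
  "wreath G n =
    \<lparr>carrier = ({1..n} \<rightarrow>\<^sub>E carrier G) \<times> carrier (sym_group n),
     mult = (\<lambda>(f, p) (g, q). (\<lambda>i\<in>{1..n}. f i \<otimes>\<^bsub>G\<^esub> g (inv_into UNIV p i), p \<circ> q)),
     one = (\<lambda>i\<in>{1..n}. \<one>\<^bsub>G\<^esub>, id)\<rparr>"

definition transitive_on :: "('w \<Rightarrow> 'a \<Rightarrow> 'a) \<Rightarrow> 'w set \<Rightarrow> 'a set \<Rightarrow> bool" where
  "transitive_on act Y \<Omega> \<longleftrightarrow>
     (\<exists>c::nat. c > 0 \<and> (\<forall>a\<in>\<Omega>. \<forall>b\<in>\<Omega>. card {y \<in> Y. act y a = b} = c))"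


section \<open>Tableaux and tabloids\<close>

text \<open>A tableau is a function on boxes that is extensional on a set of boxes. Two
  tableaux are row-equivalent if they differ by a permutation of the boxes preserving every row.\<close>

definition row_equiv :: "'b set \<Rightarrow> ('b \<Rightarrow> 'r) \<Rightarrow> ('b \<Rightarrow> 'e) set \<Rightarrow> (('b \<Rightarrow> 'e) \<times> ('b \<Rightarrow> 'e)) set" where
  "row_equiv B row \<T> = {(T, T'). T \<in> \<T> \<and> T' \<in> \<T> \<and>
     (\<exists>p. p permutes B \<and> (\<forall>b\<in>B. row (p b) = row b) \<and> T' = T \<circ> p)}"

definition diagram :: "(nat \<Rightarrow> nat) \<Rightarrow> (nat \<times> nat) set" where
  "diagram p = {(r, j). j < p r}"

text \<open>The boxes of all the diagrams of \<open>s\<close>: \<open>(U, r, j)\<close> is the box in row \<open>r\<close> and column \<open>j\<close>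
  of the diagram of \<open>s U\<close>.\<close>

definition boxes :: "('g, 'm) monoid_scheme \<Rightarrow> ('g set \<Rightarrow> nat \<Rightarrow> nat) \<Rightarrow> ('g set \<times> nat \<times> nat) set" where
  "boxes G s = {(U, r, j). subgroup U G \<and> (r, j) \<in> diagram (s U)}"

definition coset_tableaux ::
  "('g, 'm) monoid_scheme \<Rightarrow> nat \<Rightarrow> ('g set \<Rightarrow> nat \<Rightarrow> nat)
    \<Rightarrow> ('g set \<times> nat \<times> nat \<Rightarrow> 'g set \<times> nat) set" where
  "coset_tableaux G n s =
    {T \<in> (\<Pi>\<^sub>E (U, r, j) \<in> boxes G s. (rcosets\<^bsub>G\<^esub> U) \<times> {1..n}). inj_on (\<lambda>b. snd (T b)) (boxes G s)}"

definition coset_tabloids ::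
  "('g, 'm) monoid_scheme \<Rightarrow> nat \<Rightarrow> ('g set \<Rightarrow> nat \<Rightarrow> nat)
    \<Rightarrow> ('g set \<times> nat \<times> nat \<Rightarrow> 'g set \<times> nat) set set" where
  "coset_tabloids G n s =
    coset_tableaux G n s // row_equiv (boxes G s) (\<lambda>(U, r, j). (U, r)) (coset_tableaux G n s)"

definition entry_act ::
  "('g, 'm) monoid_scheme \<Rightarrow> (nat \<Rightarrow> 'g) \<times> (nat \<Rightarrow> nat) \<Rightarrow> 'g set \<times> nat \<Rightarrow> 'g set \<times> nat" where
  "entry_act G = (\<lambda>(g, p) (c, i). (c #>\<^bsub>G\<^esub> g (p i), p i))"

definition coset_tabloid_act where
  "coset_tabloid_act G s w X = compose (boxes G s) (entry_act G w) ` X"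

definition sigma_transitive where
  "sigma_transitive G n s Y \<longleftrightarrow> transitive_on (coset_tabloid_act G s) Y (coset_tabloids G n s)"


section \<open>Irreducible characters of symmetric groups\<close>

text \<open>The irreducible character indexed by \<open>p\<close> is the character of the Specht module of \<open>p\<close>.
  The modules are formed for the symmetric group on an arbitrary finite set \<open>A\<close> with
  \<open>psize p\<close> elements, without choosing a numbering of \<open>A\<close>. Elements of the permutation module
  spanned by the tabloids are represented by their coefficient functions.\<close>

definition tableaux :: "'a set \<Rightarrow> (nat \<Rightarrow> nat) \<Rightarrow> (nat \<times> nat \<Rightarrow> 'a) set" where
  "tableaux A p = {t \<in> extensional (diagram p). bij_betw t (diagram p) A}"

definition tabloid_of :: "'a set \<Rightarrow> (nat \<Rightarrow> nat) \<Rightarrow> (nat \<times> nat \<Rightarrow> 'a) \<Rightarrow> (nat \<times> nat \<Rightarrow> 'a) set" where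
  "tabloid_of A p t = row_equiv (diagram p) fst (tableaux A p) `` {t}"

definition tabloids :: "'a set \<Rightarrow> (nat \<Rightarrow> nat) \<Rightarrow> (nat \<times> nat \<Rightarrow> 'a) set set" where
  "tabloids A p = tableaux A p // row_equiv (diagram p) fst (tableaux A p)"

definition fscale :: "complex \<Rightarrow> ('x \<Rightarrow> complex) \<Rightarrow> 'x \<Rightarrow> complex" where
  "fscale c f = (\<lambda>x. c * f x)"

global_interpretation cfun: vector_space "fscale :: complex \<Rightarrow> ('x \<Rightarrow> complex) \<Rightarrow> 'x \<Rightarrow> complex"
  by unfold_locales (auto simp: fscale_def fun_eq_iff algebra_simps)

text \<open>The permutation \<open>t q t\<^sup>-\<^sup>1\<close> of entries, for \<open>q\<close> ranging over the column-preserving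
  permutations of the boxes, ranges over the column stabilizer of \<open>t\<close>, and has the same sign
  as \<open>q\<close>.\<close>

definition polytabloid ::
  "'a set \<Rightarrow> (nat \<Rightarrow> nat) \<Rightarrow> (nat \<times> nat \<Rightarrow> 'a) \<Rightarrow> (nat \<times> nat \<Rightarrow> 'a) set \<Rightarrow> complex" where
  "polytabloid A p t = (\<lambda>X.
     \<Sum>q | q permutes diagram p \<and> (\<forall>b\<in>diagram p. snd (q b) = snd b).
       if tabloid_of A p (t \<circ> q) = X then of_int (sign q) else 0)"

definition specht :: "'a set \<Rightarrow> (nat \<Rightarrow> nat) \<Rightarrow> ((nat \<times> nat \<Rightarrow> 'a) set \<Rightarrow> complex) set" where
  "specht A p = cfun.span (polytabloid A p ` tableaux A p)"

text \<open>The linear extension of the action of a permutation \<open>\<pi>\<close> of \<open>A\<close> on tabloids.\<close>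

definition tabloid_vec_act ::
  "'a set \<Rightarrow> (nat \<Rightarrow> nat) \<Rightarrow> ('a \<Rightarrow> 'a) \<Rightarrow> ((nat \<times> nat \<Rightarrow> 'a) set \<Rightarrow> complex)
    \<Rightarrow> (nat \<times> nat \<Rightarrow> 'a) set \<Rightarrow> complex" where
  "tabloid_vec_act A p \<pi> f = (\<lambda>X.
     \<Sum>Z \<in> tabloids A p. if compose (diagram p) \<pi> ` Z = X then f Z else 0)"

text \<open>The trace of a linear endomorphism of a finite-dimensional space \<open>V\<close> of functions,
  computed in any basis.\<close>

definition trace_on :: "('x \<Rightarrow> complex) set \<Rightarrow> (('x \<Rightarrow> complex) \<Rightarrow> 'x \<Rightarrow> complex) \<Rightarrow> complex" where
  "trace_on V F =
    (let B = (SOME B. cfun.independent B \<and> cfun.span B = V)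
     in \<Sum>b\<in>B. cfun.representation B (F b) b)"

definition sym_char :: "'a set \<Rightarrow> (nat \<Rightarrow> nat) \<Rightarrow> ('a \<Rightarrow> 'a) \<Rightarrow> complex" where
  "sym_char A p \<pi> = trace_on (specht A p) (tabloid_vec_act A p \<pi>)"


section \<open>Characters of the wreath product and the dual distribution\<close>

text \<open>The group of linear characters of \<open>G\<close>, as functions extensional on the carrier.\<close>

definition character_group :: "('g, 'm) monoid_scheme \<Rightarrow> ('g \<Rightarrow> complex) monoid" where
  "character_group G =
    \<lparr>carrier = hom G \<lparr>carrier = UNIV - {0}, mult = (*), one = 1\<rparr> \<inter> extensional (carrier G),
     mult = (\<lambda>\<phi> \<psi>. \<lambda>x\<in>carrier G. \<phi> x * \<psi> x),
     one = (\<lambda>x\<in>carrier G. 1)\<rparr>"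

definition induced_char ::
  "('w, 'm) monoid_scheme \<Rightarrow> 'w set \<Rightarrow> ('w \<Rightarrow> complex) \<Rightarrow> 'w \<Rightarrow> complex" where
  "induced_char W H \<phi> x =
    (\<Sum>w | w \<in> carrier W \<and> inv\<^bsub>W\<^esub> w \<otimes>\<^bsub>W\<^esub> x \<otimes>\<^bsub>W\<^esub> w \<in> H.
       \<phi> (inv\<^bsub>W\<^esub> w \<otimes>\<^bsub>W\<^esub> x \<otimes>\<^bsub>W\<^esub> w)) / of_nat (card H)"

text \<open>\<open>P\<close> partitions \<open>[n]\<close> into sets \<open>P g\<close> of size \<open>psize (l g)\<close>.\<close>

definition blocks_for ::
  "('g, 'm) monoid_scheme \<Rightarrow> nat \<Rightarrow> ('g \<Rightarrow> nat \<Rightarrow> nat) \<Rightarrow> ('g \<Rightarrow> nat set) \<Rightarrow> bool" where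
  "blocks_for G n l P \<longleftrightarrow>
     disjoint_family_on P (carrier G) \<and> (\<Union>g\<in>carrier G. P g) = {1..n} \<and>
     (\<forall>g\<in>carrier G. card (P g) = psize (l g))"

text \<open>The inertia group \<open>G\<^sup>n \<rtimes> S\<close>, where \<open>S\<close> consists of the permutations stabilizing every
  \<open>P g\<close>.\<close>

definition inertia ::
  "('g, 'm) monoid_scheme \<Rightarrow> nat \<Rightarrow> ('g \<Rightarrow> nat set) \<Rightarrow> ((nat \<Rightarrow> 'g) \<times> (nat \<Rightarrow> nat)) set" where
  "inertia G n P = {(x, \<pi>) \<in> carrier (wreath G n). \<forall>g\<in>carrier G. \<pi> ` P g = P g}"

definition inertia_char ::
  "('g, 'm) monoid_scheme \<Rightarrow> ('g \<Rightarrow> 'g \<Rightarrow> complex) \<Rightarrow> ('g \<Rightarrow> nat set) \<Rightarrow> ('g \<Rightarrow> nat \<Rightarrow> nat)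
    \<Rightarrow> (nat \<Rightarrow> 'g) \<times> (nat \<Rightarrow> nat) \<Rightarrow> complex" where
  "inertia_char G \<theta> P l = (\<lambda>(x, \<pi>).
     \<Prod>g\<in>carrier G. (\<Prod>i\<in>P g. \<theta> g (x i)) * sym_char (P g) (l g) (perm_restrict \<pi> (P g)))"

definition wreath_char where
  "wreath_char G n \<theta> P l = induced_char (wreath G n) (inertia G n P) (inertia_char G \<theta> P l)"

definition dual_dist ::
  "('g, 'm) monoid_scheme \<Rightarrow> nat \<Rightarrow> ('g \<Rightarrow> 'g \<Rightarrow> complex) \<Rightarrow> ('g \<Rightarrow> nat set)
    \<Rightarrow> ((nat \<Rightarrow> 'g) \<times> (nat \<Rightarrow> nat)) set \<Rightarrow> ('g \<Rightarrow> nat \<Rightarrow> nat) \<Rightarrow> complex" where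
  "dual_dist G n \<theta> P Y l =
    wreath_char G n \<theta> P l \<one>\<^bsub>wreath G n\<^esub> / of_nat (card Y) *
    (\<Sum>x\<in>Y. \<Sum>y\<in>Y. wreath_char G n \<theta> P l (inv\<^bsub>wreath G n\<^esub> x \<otimes>\<^bsub>wreath G n\<^esub> y))"


section \<open>The relation between \<open>\<sigma>\<close> and \<open>\<lambda>\<close>\<close>

definition annihilator :: "('g, 'm) monoid_scheme \<Rightarrow> ('g \<Rightarrow> 'g \<Rightarrow> complex) \<Rightarrow> 'g set \<Rightarrow> 'g set" where
  "annihilator G \<theta> U = {g \<in> carrier G. \<forall>u\<in>U. \<theta> g u = 1}"

text \<open>\<open>m g\<close> arises from the colouring \<open>col\<close> if, for every \<open>k \<ge> 1\<close>, it has as many parts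
  equal to \<open>k\<close> as there are rows with exactly \<open>k\<close> boxes coloured \<open>g\<close>.\<close>

definition arrow ::
  "('g, 'm) monoid_scheme \<Rightarrow> nat \<Rightarrow> ('g \<Rightarrow> 'g \<Rightarrow> complex)
    \<Rightarrow> ('g set \<Rightarrow> nat \<Rightarrow> nat) \<Rightarrow> ('g \<Rightarrow> nat \<Rightarrow> nat) \<Rightarrow> bool" where
  "arrow G n \<theta> s l \<longleftrightarrow>
    (\<exists>m \<in> Lambda G n. (\<forall>g\<in>carrier G. dominated (m g) (l g)) \<and>
      (\<exists>col. (\<forall>(U, r, j) \<in> boxes G s. col (U, r, j) \<in> annihilator G \<theta> U) \<and>
        (\<forall>g\<in>carrier G. \<forall>k\<ge>1.
          card {i. m g i = k} =
          card {(U, r). subgroup U G \<and>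
            card {j. (U, r, j) \<in> boxes G s \<and> col (U, r, j) = g} = k})))"

end

theory Submission
  imports Defs "HOL-Algebra.Multiplicative_Group"
begin

text \<open>
  Functions on words \<open>w\<close> whose letters are pairs (colour in \<open>G\<close>, row) carry an action of the
  wreath product: permutations move positions and \<open>G\<^sup>n\<close> acts through the characters given by the
  colours. Functions on tabloids decompose, by Fourier analysis on the cosets, into the weight spaces
  of the words obtained by colouring the diagrams \<open>\<sigma>(U)\<close> with elements of the annihilator of \<open>U\<close>. So,
  with \<open>c\<close> the indicator of \<open>Y\<close> minus the uniform average, \<open>Y\<close> is transitive iff \<open>c\<close> kills all these
  weight spaces.

  Replacing a letter \<open>(g, j)\<close> by \<open>(g, i)\<close> commutes with the action, and the operators for \<open>i, j\<close> and
  \<open>j, i\<close> are adjoint with a scalar commutator on each weight space. This gives injections between weight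
  spaces along the dominance order, and shows that \<open>c\<close> kills a weight space as soon as it kills the
  highest weight vectors of all dominating partitions. Highest weight vectors are combinations of
  (products of) polytabloids, that is, they lie in the irreducible modules.

  Finally the dual distribution at \<open>\<lambda>\<close> is a positive combination of squared norms of the images of an
  orthonormal basis of the irreducible module under the sum of \<open>Y\<close>, hence vanishes iff this sum kills
  the module.
\<close>

text \<open>Statements about constituents of modules appear here only as statements about which
  vectors \<open>c\<close> annihilates. Killing passes up the dominance order along injective
  equivariant operators. The way back uses the adjoint of \<open>c\<close>: the action is unitary,
  so \<open>c\<close> and its adjoint kill the same weight spaces, and the image of the adjoint can
  be tested instead of the whole space.

  The exception \<open>\<lambda>(0) = (n)\<close> comes from the uniform average. The coefficients
  of \<open>c\<close> sum to 0, so \<open>c\<close> annihilates the trivial module whatever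
  \<open>Y\<close> is; on the other modules the sum over the whole group acts as 0, so there
  \<open>c\<close> acts as the sum over \<open>Y\<close>.

  Rows are kept abstract: for tabloids a row is a pair of a subgroup and an index, for partitions it
  is a number. Renaming letters without changing colours is equivariant, so up to isomorphism a
  weight space depends only on the row counts within each colour. For this reason the combinatorial
  relation sees only how many rows have \<open>k\<close> boxes of colour \<open>g\<close>.\<close>

lemma fibre_bij:
  assumes "finite A" "finite B"
    and eq: "\<And>c. card {a\<in>A. f a = c} = card {b\<in>B. g b = c}"
  obtains h where "bij_betw h A B" "\<And>a. a \<in> A \<Longrightarrow> g (h a) = f a"
proof -
  have "\<forall>c. \<exists>h. bij_betw h {a\<in>A. f a = c} {b\<in>B. g b = c}"
    using eq assms(1,2) by (intro allI finite_same_card_bij) auto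
  then obtain H where H: "\<And>c. bij_betw (H c) {a\<in>A. f a = c} {b\<in>B. g b = c}"
    by metis
  have img: "H (f a) a \<in> B \<and> g (H (f a) a) = f a" if "a \<in> A" for a
    using bij_betwE[OF H[of "f a"]] that by auto
  have "bij_betw (\<lambda>a. H (f a) a) A B"
  proof (rule bij_betwI')
    show "(H (f x) x = H (f y) y) = (x = y)" if "x \<in> A" "y \<in> A" for x y
    proof
      assume e: "H (f x) x = H (f y) y"
      then have "f x = f y"
        using img that by metis
      then show "x = y"
        using e that bij_betw_imp_inj_on[OF H[of "f x"]] by (auto dest: inj_onD)
    qed auto
    show "H (f x) x \<in> B" if "x \<in> A" for x
      using img that by auto
    show "\<exists>x\<in>A. y = H (f x) x" if "y \<in> B" for y
    proof -
      have "y \<in> H (g y) ` {a\<in>A. f a = g y}"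
        using bij_betw_imp_surj_on[OF H[of "g y"]] that by simp
      then show ?thesis by (auto intro!: bexI)
    qed
  qed
  then show ?thesis
    using that img by blast
qed


section \<open>Words and their weight spaces\<close>

definition wcount :: "'a set \<Rightarrow> ('a \<Rightarrow> 'l) \<Rightarrow> 'l \<Rightarrow> nat" where
  "wcount A w l = card {a\<in>A. w a = l}"

definition words :: "'a set \<Rightarrow> ('l \<Rightarrow> nat) \<Rightarrow> ('a \<Rightarrow> 'l) set" where
  "words A \<tau> = {w \<in> extensional A. wcount A w = \<tau>}"

definition wt_space :: "'a set \<Rightarrow> ('l \<Rightarrow> nat) \<Rightarrow> (('a \<Rightarrow> 'l) \<Rightarrow> complex) set" where
  "wt_space A \<tau> = {v. \<forall>w. w \<notin> words A \<tau> \<longrightarrow> v w = 0}"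

text \<open>Transposed replacement: the indicator of a word \<open>u\<close> goes to the sum of the
  indicators of the words obtained from \<open>u\<close> by turning one letter \<open>l'\<close>
  into \<open>l\<close>. On functions of words, seen as a tensor power, this is the matrix unit of
  the general linear Lie algebra taking \<open>l'\<close> to \<open>l\<close>.\<close>

definition shift :: "'a set \<Rightarrow> 'l \<Rightarrow> 'l \<Rightarrow> (('a \<Rightarrow> 'l) \<Rightarrow> complex) \<Rightarrow> ('a \<Rightarrow> 'l) \<Rightarrow> complex" where
  "shift A l l' v = (\<lambda>w. \<Sum>a | a \<in> A \<and> w a = l. v (w(a := l')))"

definition ip :: "'x set \<Rightarrow> ('x \<Rightarrow> complex) \<Rightarrow> ('x \<Rightarrow> complex) \<Rightarrow> complex" where
  "ip S u v = (\<Sum>x\<in>S. u x * cnj (v x))"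

lemma ip_self: "ip S v v = of_real (\<Sum>x\<in>S. (cmod (v x))\<^sup>2)"
  by (simp add: ip_def complex_mult_cnj cmod_power2)

lemma ip_self_eq_0_iff:
  assumes "finite S"
  shows "ip S v v = 0 \<longleftrightarrow> (\<forall>x\<in>S. v x = 0)"
  unfolding ip_self of_real_eq_0_iff using assms by (subst sum_nonneg_eq_0_iff) auto

lemma wcount_upd:
  assumes "finite A" "a \<in> A" "w a \<noteq> l"
  shows "wcount A (w(a := l)) = (wcount A w)(l := Suc (wcount A w l), w a := wcount A w (w a) - 1)"
proof
  fix k
  consider "k = l" | "k = w a" | "k \<noteq> l" "k \<noteq> w a" by blast
  then show "wcount A (w(a := l)) k =
      ((wcount A w)(l := Suc (wcount A w l), w a := wcount A w (w a) - 1)) k"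
  proof cases
    case 1
    have "{x\<in>A. (w(a := l)) x = l} = insert a {x\<in>A. w x = l}" using assms by auto
    then show ?thesis using 1 assms by (auto simp: wcount_def)
  next
    case 2
    have "{x\<in>A. (w(a := l)) x = w a} = {x\<in>A. w x = w a} - {a}" using assms by auto
    then show ?thesis using 2 assms by (auto simp: wcount_def)
  next
    case 3
    have "{x\<in>A. (w(a := l)) x = k} = {x\<in>A. w x = k}" using 3 by auto
    then show ?thesis using 3 by (simp add: wcount_def)
  qed
qed

lemma wcount_pos: "finite A \<Longrightarrow> a \<in> A \<Longrightarrow> wcount A w (w a) > 0"
  unfolding wcount_def by (subst card_gt_0_iff) auto

lemma upd_words:
  assumes "finite A" "w \<in> extensional A" "a \<in> A" "l \<noteq> l'" "w a = l" "w(a := l') \<in> words A \<tau>"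
  shows "w \<in> words A (\<tau>(l := Suc (\<tau> l), l' := \<tau> l' - 1))"
proof -
  have "wcount A ((w(a := l'))(a := l)) =
      (\<tau>(l := Suc (\<tau> l), l' := \<tau> l' - 1))"
    using wcount_upd[of A a "w(a := l')" l] assms by (simp add: words_def)
  moreover have "(w(a := l'))(a := l) = w" using assms by auto
  ultimately show ?thesis using assms by (simp add: words_def)
qed

text \<open>The truncated subtraction is harmless: if \<open>\<tau> l' = 0\<close>, no word of
  content \<open>\<tau>\<close> contains \<open>l'\<close>, and \<open>shift A l l' v\<close> is
  0.\<close>

lemma shift_wt_space:
  assumes "finite A" "l \<noteq> l'" "v \<in> wt_space A \<tau>"
  shows "shift A l l' v \<in> wt_space A (\<tau>(l := Suc (\<tau> l), l' := \<tau> l' - 1))"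
proof -
  have "v (w(a := l')) = 0"
    if "w \<notin> words A (\<tau>(l := Suc (\<tau> l), l' := \<tau> l' - 1))" "a \<in> A" "w a = l" for w a
  proof (rule ccontr)
    assume "v (w(a := l')) \<noteq> 0"
    then have w: "w(a := l') \<in> words A \<tau>" using assms(3) unfolding wt_space_def by blast
    then have "w \<in> extensional A"
      using that(2) by (auto simp: words_def extensional_def split: if_splits)
    from upd_words[OF assms(1) this that(2) assms(2) that(3) w] that(1) show False by blast
  qed
  then show ?thesis by (auto simp: wt_space_def shift_def)
qed

lemma shift_zero: "shift A l l' (\<lambda>w. 0) = (\<lambda>w. 0)"
  by (simp add: shift_def)

text \<open>The second replacement either undoes the first one, once for each occurrence of
  \<open>l'\<close>, or takes place at another position. The first kind gives the diagonal
  term.\<close>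

lemma shift_shift:
  assumes "finite A" "l \<noteq> l'"
  shows "shift A l' l (shift A l l' v) w = of_nat (wcount A w l') * v w +
    (\<Sum>a | a \<in> A \<and> w a = l'. \<Sum>b | b \<in> A \<and> w b = l. v (w(a := l, b := l')))"
proof -
  have "(\<Sum>b | b \<in> A \<and> (w(a := l)) b = l. v (w(a := l, b := l'))) =
     v w + (\<Sum>b | b \<in> A \<and> w b = l. v (w(a := l, b := l')))" if "a \<in> A" "w a = l'" for a
  proof -
    have "{b \<in> A. (w(a := l)) b = l} = insert a {b \<in> A. w b = l}" using that by auto
    moreover have "w(a := l') = w" using that by auto
    ultimately show ?thesis using assms that by (simp add: sum.insert)
  qed
  then show ?thesis
    by (simp add: shift_def sum.distrib wcount_def)
qed

text \<open>The double sums of \<open>shift_shift\<close> over two different positions agree for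
  both orders, because such replacements commute; only the diagonal counts remain. This is the
  relation between raising operator, lowering operator and weight in the Lie algebra sl2.\<close>

lemma shift_commutator:
  assumes "finite A" "l \<noteq> l'"
  shows "shift A l' l (shift A l l' v) w - shift A l l' (shift A l' l v) w =
    (of_nat (wcount A w l') - of_nat (wcount A w l)) * v w"
proof -
  have "(\<Sum>a | a \<in> A \<and> w a = l'. \<Sum>b | b \<in> A \<and> w b = l. v (w(a := l, b := l'))) =
      (\<Sum>b | b \<in> A \<and> w b = l. \<Sum>a | a \<in> A \<and> w a = l'. v (w(b := l', a := l)))"
    using assms by (subst sum.swap) (intro sum.cong refl arg_cong[where f = v], auto)
  then show ?thesis
    using assms by (simp add: shift_shift algebra_simps)
qed

text \<open>Both sides sum over pairs of words over \<open>L\<close> that differ by exchanging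
  \<open>l\<close> for \<open>l'\<close> at one position. The alphabet must contain both letters so
  that replacements stay inside \<open>A \<rightarrow>\<^sub>E L\<close>.\<close>

lemma shift_adjoint:
  assumes "finite A" "finite L" "l \<in> L" "l' \<in> L"
  shows "ip (A \<rightarrow>\<^sub>E L) (shift A l l' v) u = ip (A \<rightarrow>\<^sub>E L) v (shift A l' l u)"
proof -
  have fin: "finite (A \<rightarrow>\<^sub>E L)" using assms by (simp add: finite_PiE)
  have "ip (A \<rightarrow>\<^sub>E L) (shift A l l' v) u =
      (\<Sum>(w, a) \<in> Sigma (A \<rightarrow>\<^sub>E L) (\<lambda>w. {a\<in>A. w a = l}). v (w(a := l')) * cnj (u w))"
    using assms fin by (simp add: ip_def shift_def sum_distrib_right sum.Sigma)
  also have "\<dots> = (\<Sum>(w, a) \<in> Sigma (A \<rightarrow>\<^sub>E L) (\<lambda>w. {a\<in>A. w a = l'}). v w * cnj (u (w(a := l))))"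
    by (rule sum.reindex_bij_witness
        [where i = "\<lambda>(w, a). (w(a := l), a)" and j = "\<lambda>(w, a). (w(a := l'), a)"])
      (use assms in \<open>auto simp: PiE_iff extensional_def\<close>)
  also have "\<dots> = ip (A \<rightarrow>\<^sub>E L) v (shift A l' l u)"
    using assms fin by (simp add: ip_def shift_def sum_distrib_left sum.Sigma)
  finally show ?thesis .
qed

lemma ip_diff_left: "ip S (\<lambda>x. f x - g x) v = ip S f v - ip S g v"
  by (simp add: ip_def sum_subtractf algebra_simps)

lemma words_subset: "finite A \<Longrightarrow> words A \<tau> \<subseteq> A \<rightarrow>\<^sub>E {l. \<tau> l \<noteq> 0}"
  by (auto simp: words_def PiE_iff extensional_def dest: wcount_pos)

text \<open>The existence of one word already makes the support of \<open>\<tau>\<close> finite;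
  finiteness of weights is always obtained in this way below.\<close>

lemma words_support:
  assumes "finite A" "w \<in> words A \<tau>"
  shows "{l. \<tau> l \<noteq> 0} = w ` A"
proof -
  have "\<tau> l \<noteq> 0 \<longleftrightarrow> (\<exists>a\<in>A. w a = l)" for l
  proof -
    have "\<tau> l = card {a \<in> A. w a = l}" using assms(2) by (auto simp: words_def wcount_def)
    then show ?thesis using assms(1) by (simp only: card_eq_0_iff) auto
  qed
  then show ?thesis by auto
qed

lemma finite_words:
  assumes "finite A" shows "finite (words A \<tau>)"
proof (cases "words A \<tau> = {}")
  case False
  then obtain w where "w \<in> words A \<tau>" by blast
  then have "finite {l. \<tau> l \<noteq> 0}" using assms words_support by fastforce
  then show ?thesis using assms by (intro finite_subset[OF words_subset[OF assms]] finite_PiE) auto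
qed simp

text \<open>The operators \<open>shift A l l'\<close> and \<open>shift A l' l\<close> are adjoint, and their commutator is the scalar
  \<open>\<tau> l' - \<tau> l\<close> on the weight space of \<open>\<tau>\<close>; compare norms.\<close>

lemma shift_inj:
  assumes "finite A" "l \<noteq> l'" "v \<in> wt_space A \<tau>" "\<tau> l' < \<tau> l"
    and "shift A l' l v = (\<lambda>w. 0)"
  shows "v = (\<lambda>w. 0)"
proof (cases "words A \<tau> = {}")
  case True
  then show ?thesis using assms(3) by (auto simp: wt_space_def)
next
  case False
  then obtain w0 where "w0 \<in> words A \<tau>" by blast
  then have fin: "finite {l. \<tau> l \<noteq> 0}" using assms(1) words_support by fastforce
  \<comment> \<open>\<open>l'\<close> is added because its count may be 0, while adjointness
    requires it in the alphabet.\<close>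
  define L where "L = insert l (insert l' {l. \<tau> l \<noteq> 0})"
  define S where "S = A \<rightarrow>\<^sub>E L"
  have L: "finite L" "l \<in> L" "l' \<in> L" using fin by (auto simp: L_def)
  have finS: "finite S" using assms L by (simp add: S_def finite_PiE)
  have sub: "words A \<tau> \<subseteq> S"
    using words_subset[OF assms(1), of \<tau>] unfolding S_def L_def by (auto simp: PiE_iff)
  have c: "(of_nat (wcount A w l') - of_nat (wcount A w l)) * v w =
       (of_nat (\<tau> l') - of_nat (\<tau> l)) * v w" for w
    using assms(3) by (cases "w \<in> words A \<tau>") (auto simp: words_def wt_space_def)
  have "ip S (shift A l' l (shift A l l' v)) v - ip S (shift A l l' (shift A l' l v)) v =
      ip S (\<lambda>w. (of_nat (\<tau> l') - of_nat (\<tau> l)) * v w) v"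
    by (simp only: ip_diff_left[symmetric] shift_commutator[OF assms(1,2)] c)
  also have "\<dots> = (of_nat (\<tau> l') - of_nat (\<tau> l)) * ip S v v"
    by (simp add: ip_def sum_distrib_left mult.assoc)
  \<comment> \<open>The hypothesis removes one term of the commutator, and adjointness turns the
    other into a squared norm. Two nonnegative terms add up to 0, and the coefficient
    \<open>\<tau> l - \<tau> l'\<close> is positive.\<close>
  finally have "ip S (shift A l l' v) (shift A l l' v) + (of_nat (\<tau> l) - of_nat (\<tau> l')) * ip S v v = 0"
    unfolding S_def using shift_adjoint[OF assms(1) L(1) L(3) L(2)] assms(5)
    by (simp add: shift_zero) (simp add: ip_def algebra_simps)
  then have "complex_of_real ((\<Sum>x\<in>S. (cmod (shift A l l' v x))\<^sup>2) +
      (real (\<tau> l) - real (\<tau> l')) * (\<Sum>x\<in>S. (cmod (v x))\<^sup>2)) = 0"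
    unfolding ip_self by simp
  then have "(\<Sum>x\<in>S. (cmod (shift A l l' v x))\<^sup>2) +
      (real (\<tau> l) - real (\<tau> l')) * (\<Sum>x\<in>S. (cmod (v x))\<^sup>2) = 0"
    by (simp only: of_real_eq_0_iff)
  moreover have "(\<Sum>x\<in>S. (cmod (shift A l l' v x))\<^sup>2) \<ge> 0" "(\<Sum>x\<in>S. (cmod (v x))\<^sup>2) \<ge> 0"
    by (auto intro: sum_nonneg)
  ultimately have "(\<Sum>x\<in>S. (cmod (v x))\<^sup>2) = 0"
    using assms(4) by (smt (verit) of_nat_less_iff mult_pos_pos)
  then have "\<forall>x\<in>S. v x = 0" using finS by (simp add: sum_nonneg_eq_0_iff)
  then show ?thesis using sub assms(3) by (fastforce simp: wt_space_def)
qed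

section \<open>Polytabloids as functions on words\<close>

definition colperms :: "(nat \<Rightarrow> nat) \<Rightarrow> (nat \<times> nat \<Rightarrow> nat \<times> nat) set" where
  "colperms p = {q. q permutes diagram p \<and> (\<forall>b\<in>diagram p. snd (q b) = snd b)}"

text \<open>The coefficient of the polytabloid of \<open>t\<close> at the tabloid in which the entry
  \<open>a\<close> lies in row \<open>u a\<close>; see \<open>polytabloid_tab\<close>. A tabloid is
  thereby coded by a word of row indices, on which \<open>shift\<close> operates.\<close>

definition pt :: "(nat \<Rightarrow> nat) \<Rightarrow> (nat \<times> nat \<Rightarrow> 'a) \<Rightarrow> ('a \<Rightarrow> nat) \<Rightarrow> complex" where
  "pt p t u = (\<Sum>q\<in>colperms p.
     if \<forall>b\<in>diagram p. u (t (q b)) = fst b then of_int (sign q) else 0)"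

lemma diagram_Sigma: "diagram p = Sigma {r. p r \<noteq> 0} (\<lambda>r. {..<p r})"
  by (auto simp: diagram_def)

lemma finite_diagram: "p \<in> Par \<Longrightarrow> finite (diagram p)"
  by (simp add: diagram_Sigma Par_def)

lemma card_diagram: "p \<in> Par \<Longrightarrow> card (diagram p) = psize p"
  by (simp add: diagram_Sigma Par_def psize_def)

lemma card_diagram_row: "card {b \<in> diagram p. fst b = i} = p i"
proof -
  have "{b \<in> diagram p. fst b = i} = Pair i ` {..<p i}" by (auto simp: diagram_def)
  then show ?thesis by (simp add: card_image inj_on_def)
qed

lemma finite_colperms: "p \<in> Par \<Longrightarrow> finite (colperms p)"
  using finite_permutations[OF finite_diagram] by (auto simp: colperms_def)

lemma permutes_mem: "q permutes D \<Longrightarrow> b \<in> D \<Longrightarrow> q b \<in> D"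
  by (simp add: permutes_in_image)

lemma colperms_swap:
  assumes "b0 \<in> diagram p" "b1 \<in> diagram p" "snd b0 = snd b1" "q \<in> colperms p"
  shows "q \<circ> transpose b0 b1 \<in> colperms p" "transpose b0 b1 \<circ> q \<in> colperms p"
proof -
  have s: "transpose b0 b1 permutes diagram p" using assms by (simp add: permutes_swap_id)
  have sn: "snd (transpose b0 b1 b) = snd b" for b using assms by (auto simp: transpose_def)
  have "snd (q (transpose b0 b1 b)) = snd b" if "b \<in> diagram p" for b
    using assms(4) permutes_mem[OF s that] sn by (simp add: colperms_def)
  then show "q \<circ> transpose b0 b1 \<in> colperms p" "transpose b0 b1 \<circ> q \<in> colperms p"
    using assms(4) s sn by (auto simp: colperms_def permutes_compose)
qed

lemma sign_swap:
  assumes "p \<in> Par" "q \<in> colperms p" "b0 \<noteq> b1"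
  shows "sign (q \<circ> transpose b0 b1) = - sign q" "sign (transpose b0 b1 \<circ> q) = - sign q"
proof -
  have "permutation q"
    using assms finite_diagram by (auto simp: colperms_def permutation_permutes)
  then show "sign (q \<circ> transpose b0 b1) = - sign q" "sign (transpose b0 b1 \<circ> q) = - sign q"
    using assms(3) by (simp_all add: sign_compose permutation_swap_id sign_swap_id)
qed

text \<open>Right multiplication by the transposition of two boxes of one column is an involution of
  \<open>colperms p\<close> that reverses the sign and respects \<open>Q\<close>, so the sum equals
  its negative.\<close>

lemma alternating_sum_eq_0:
  assumes "p \<in> Par" "b0 \<in> diagram p" "b1 \<in> diagram p" "snd b0 = snd b1" "b0 \<noteq> b1"
    and inv: "\<And>q. q \<in> colperms p \<Longrightarrow> Q (q \<circ> transpose b0 b1) \<longleftrightarrow> Q q"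
  shows "(\<Sum>q\<in>colperms p. if Q q then complex_of_int (sign q) else 0) = 0"
    (is "?S = 0")
proof -
  have inv2: "(f \<circ> transpose b0 b1) \<circ> transpose b0 b1 = f" for f :: "nat \<times> nat \<Rightarrow> nat \<times> nat"
    by (simp add: comp_assoc)
  have "?S = (\<Sum>q\<in>colperms p. if Q (q \<circ> transpose b0 b1)
      then complex_of_int (sign (q \<circ> transpose b0 b1)) else 0)"
    by (rule sum.reindex_bij_witness
        [where i = "\<lambda>q. q \<circ> transpose b0 b1" and j = "\<lambda>q. q \<circ> transpose b0 b1"])
      (use assms colperms_swap(1)[OF assms(2-4)] inv2 in \<open>auto\<close>)
  also have "\<dots> = (\<Sum>q\<in>colperms p. - (if Q q then complex_of_int (sign q) else 0))"
    using assms by (intro sum.cong refl) (auto simp: sign_swap)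
  also have "\<dots> = - ?S" by (simp add: sum_negf)
  finally show ?thesis by simp
qed

lemma pt_cong:
  assumes "\<And>b. b \<in> diagram p \<Longrightarrow> u (t b) = u' (t' b)"
  shows "pt p t u = pt p t' u'"
  unfolding pt_def
proof (rule sum.cong[OF refl])
  fix q assume "q \<in> colperms p"
  then have "q b \<in> diagram p" if "b \<in> diagram p" for b
    using that by (auto simp: colperms_def permutes_mem)
  then have "(\<forall>b\<in>diagram p. u (t (q b)) = fst b) \<longleftrightarrow> (\<forall>b\<in>diagram p. u' (t' (q b)) = fst b)"
    using assms by auto
  then show "(if \<forall>b\<in>diagram p. u (t (q b)) = fst b then complex_of_int (sign q) else 0) =
         (if \<forall>b\<in>diagram p. u' (t' (q b)) = fst b then complex_of_int (sign q) else 0)" by simp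
qed

text \<open>The terms are indexed by a column permutation and a box \<open>b0\<close> of row \<open>Suc i\<close>; swapping \<open>b0\<close> with
  the box above it is a sign-reversing involution.\<close>

lemma pt_raise:
  assumes p: "p \<in> Par" and t: "bij_betw t (diagram p) Q"
  shows "(\<Sum>a | a \<in> Q \<and> u a = i. pt p t (u(a := Suc i))) = 0"
proof -
  define D where "D = diagram p"
  have finD: "finite D" using p finite_diagram by (simp add: D_def)
  have finQ: "finite Q" using t finD bij_betw_finite D_def by blast
  \<comment> \<open>\<open>R q b0\<close>: the entry of box \<open>b0\<close> lies in row
    \<open>i\<close>, and every other box receives an entry of its own row. These are the terms that
    become nonzero when that entry is moved to row \<open>Suc i\<close>, provided that
    \<open>b0\<close> lies in row \<open>Suc i\<close>.\<close>
  define R where "R = (\<lambda>q b0. u (t (q b0)) = i \<and> (\<forall>b\<in>D - {b0}. u (t (q b)) = fst b))"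
  define s where "s = (\<lambda>q :: nat \<times> nat \<Rightarrow> nat \<times> nat. complex_of_int (sign q))"
  have inner: "(\<Sum>a | a \<in> Q \<and> u a = i. if \<forall>b\<in>D. (u(a := Suc i)) (t (q b)) = fst b then s q else 0) =
      (\<Sum>b0\<in>D. if fst b0 = Suc i \<and> R q b0 then s q else 0)" if q: "q \<in> colperms p" for q
  proof -
    have qp: "q permutes D" using q by (simp add: colperms_def D_def)
    have tq: "bij_betw (\<lambda>b. t (q b)) D Q"
      using bij_betw_trans[OF permutes_imp_bij[OF qp] t[folded D_def]] by (simp add: o_def)
    have "(\<Sum>a | a \<in> Q \<and> u a = i. if \<forall>b\<in>D. (u(a := Suc i)) (t (q b)) = fst b then s q else 0) =
      (\<Sum>a\<in>Q. if u a = i \<and> (\<forall>b\<in>D. (u(a := Suc i)) (t (q b)) = fst b) then s q else 0)"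
      using finQ by (intro sum.mono_neutral_cong_left) auto
    also have "\<dots> = (\<Sum>b0\<in>D. if u (t (q b0)) = i \<and>
        (\<forall>b\<in>D. (u(t (q b0) := Suc i)) (t (q b)) = fst b) then s q else 0)"
      by (rule sum.reindex_bij_betw[OF tq, symmetric])
    also have "\<dots> = (\<Sum>b0\<in>D. if fst b0 = Suc i \<and> R q b0 then s q else 0)"
    proof (rule sum.cong[OF refl])
      fix b0 assume b0: "b0 \<in> D"
      have "t (q b) = t (q b0) \<longleftrightarrow> b = b0" if "b \<in> D" for b
        using tq b0 that by (auto simp: bij_betw_def inj_on_def)
      then have "(\<forall>b\<in>D. (u(t (q b0) := Suc i)) (t (q b)) = fst b) \<longleftrightarrow>
          fst b0 = Suc i \<and> (\<forall>b\<in>D - {b0}. u (t (q b)) = fst b)"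
        using b0 by auto
      then show "(if u (t (q b0)) = i \<and> (\<forall>b\<in>D. (u(t (q b0) := Suc i)) (t (q b)) = fst b)
          then s q else 0) = (if fst b0 = Suc i \<and> R q b0 then s q else 0)"
        unfolding R_def by auto
    qed
    finally show ?thesis .
  qed
  have zero: "(\<Sum>q\<in>colperms p. if R q b0 then s q else 0) = 0" if "b0 \<in> D" "fst b0 = Suc i" for b0
  proof -
    \<comment> \<open>The box directly above \<open>b0\<close>; it belongs to the diagram because
      the parts weakly decrease.\<close>
    define b1 where "b1 = (i, snd b0)"
    have "p (Suc i) \<le> p i" using p by (auto simp: Par_def antimono_def)
    then have b1: "b1 \<in> D" "snd b0 = snd b1" "b0 \<noteq> b1"
      using that by (auto simp: D_def diagram_def b1_def)
    \<comment> \<open>With \<open>b1\<close> separated, the condition is symmetric in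
      \<open>b0\<close> and \<open>b1\<close>: both boxes hold entries of row \<open>i\<close>. The
      swap relies on this symmetry.\<close>
    have split: "R q b0 \<longleftrightarrow> u (t (q b0)) = i \<and> u (t (q b1)) = i \<and> (\<forall>b\<in>D - {b0, b1}. u (t (q b)) = fst b)"
      for q
    proof -
      have "D - {b0} = insert b1 (D - {b0, b1})" using b1 by blast
      moreover have "fst b1 = i" by (simp add: b1_def)
      ultimately show ?thesis unfolding R_def by (simp only: ball_simps)
    qed
    have "R (q \<circ> transpose b0 b1) b0 \<longleftrightarrow> R q b0" for q
    proof -
      have "transpose b0 b1 b = b" if "b \<in> D - {b0, b1}" for b
        using that by (auto simp: transpose_def)
      then show ?thesis unfolding split by auto
    qed
    then show ?thesis
      unfolding s_def using p that b1 by (intro alternating_sum_eq_0[of p b0 b1]) (auto simp: D_def)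
  qed
  have "(\<Sum>a | a \<in> Q \<and> u a = i. pt p t (u(a := Suc i))) =
      (\<Sum>q\<in>colperms p. \<Sum>a | a \<in> Q \<and> u a = i. if \<forall>b\<in>D. (u(a := Suc i)) (t (q b)) = fst b then s q else 0)"
    unfolding pt_def D_def s_def by (rule sum.swap)
  also have "\<dots> = (\<Sum>q\<in>colperms p. \<Sum>b0\<in>D. if fst b0 = Suc i \<and> R q b0 then s q else 0)"
    by (intro sum.cong refl inner)
  also have "\<dots> = (\<Sum>b0\<in>D. \<Sum>q\<in>colperms p. if fst b0 = Suc i \<and> R q b0 then s q else 0)"
    by (rule sum.swap)
  also have "\<dots> = 0"
  proof (rule sum.neutral, rule ballI)
    fix b0 assume "b0 \<in> D"
    then show "(\<Sum>q\<in>colperms p. if fst b0 = Suc i \<and> R q b0 then s q else 0) = 0"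
      using zero by (cases "fst b0 = Suc i") auto
  qed
  finally show ?thesis .
qed

lemma diagram_corner:
  assumes "p m \<noteq> 0"
  shows "diagram p = insert (m, p m - 1) (diagram (p(m := p m - 1)))"
    and "(m, p m - 1) \<notin> diagram (p(m := p m - 1))"
  using assms by (auto simp: diagram_def split: if_splits)

text \<open>The entry \<open>a\<close> sits in the removable corner \<open>(m, p m - 1)\<close>. In
  a nonzero term, the box that \<open>q\<close> sends to the corner lies in the column of the corner
  and in row \<open>j \<ge> m\<close>. That column ends in row \<open>m\<close>, so the box is the
  corner itself and \<open>j = m\<close>. The column permutations fixing the corner are those of the
  smaller diagram.\<close>

lemma pt_corner:
  assumes p: "p \<in> Par" and p': "p(m := p m - 1) \<in> Par" and m: "p m \<noteq> 0"
    and t: "t ` diagram (p(m := p m - 1)) \<subseteq> Q" and a: "a \<notin> Q"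
  shows "pt p (t((m, p m - 1) := a)) (u(a := m)) = pt (p(m := p m - 1)) t u"
    and "m < j \<Longrightarrow> pt p (t((m, p m - 1) := a)) (u(a := j)) = 0"
proof -
  define c where "c = (m, p m - 1)"
  define p' where "p' = p(m := p m - 1)"
  have D: "diagram p = insert c (diagram p')" "c \<notin> diagram p'"
    using diagram_corner[of p m] m by (simp_all add: c_def p'_def)
  have at: "t b \<noteq> a" if "b \<in> diagram p'" for b using that t a by (auto simp: p'_def)
  have sub: "colperms p' = {q \<in> colperms p. q c = c}"
  proof (intro equalityI subsetI)
    fix q assume q: "q \<in> colperms p'"
    then have "q permutes diagram p"
      using permutes_subset[of q "diagram p'" "diagram p"] D(1) by (simp add: colperms_def subset_insertI)
    moreover have "q c = c" using q D(2) permutes_not_in by (fastforce simp: colperms_def)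
    ultimately show "q \<in> {q \<in> colperms p. q c = c}" using q D by (auto simp: colperms_def)
  next
    fix q assume q: "q \<in> {q \<in> colperms p. q c = c}"
    then have "q permutes diagram p'"
      by (intro permutes_superset[of q "diagram p" "diagram p'"]) (auto simp: colperms_def D(1))
    then show "q \<in> colperms p'" using q D by (auto simp: colperms_def)
  qed
  have key: "q c = c \<and> j = m" if q: "q \<in> colperms p" "j \<ge> m"
    and e: "\<forall>b\<in>diagram p. (u(a := j)) ((t(c := a)) (q b)) = fst b" for q j
  proof -
    have qp: "q permutes diagram p" using q by (simp add: colperms_def)
    then obtain b where b: "b \<in> diagram p" "q b = c"
      using D(1) permutes_image[OF qp] by (metis imageE insertI1)
    then have fb: "fst b = j" using e by auto
    have sb: "snd b = p m - 1" using b q by (auto simp: colperms_def c_def)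
    show ?thesis
    proof (cases "j = m")
      case True
      then have "b = c" using fb sb by (simp add: c_def prod_eq_iff)
      then show ?thesis using b True by simp
    next
      case False
      have "p' j \<le> p' m" using p'[folded p'_def] q(2) by (auto simp: Par_def antimono_def)
      then have "p j \<le> p m - 1" using False by (simp add: p'_def)
      then show ?thesis using b(1) fb sb by (auto simp: diagram_def)
    qed
  qed
  have eq: "(\<forall>b\<in>diagram p. (u(a := m)) ((t(c := a)) (q b)) = fst b) \<longleftrightarrow>
      (\<forall>b\<in>diagram p'. u (t (q b)) = fst b)" if "q \<in> colperms p'" for q
  proof -
    have qc: "q c = c" using that sub by auto
    have "q b \<in> diagram p'" if "b \<in> diagram p'" for b
      using \<open>q \<in> colperms p'\<close> that by (auto simp: colperms_def permutes_mem)
    then have "(u(a := m)) ((t(c := a)) (q b)) = u (t (q b))" if "b \<in> diagram p'" for b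
      using that D(2) at by (metis fun_upd_apply)
    moreover have "(u(a := m)) ((t(c := a)) (q c)) = fst c" using qc by (simp add: c_def)
    ultimately show ?thesis unfolding D(1) by auto
  qed
  have "pt p (t(c := a)) (u(a := m)) = (\<Sum>q\<in>colperms p'.
     if \<forall>b\<in>diagram p. (u(a := m)) ((t(c := a)) (q b)) = fst b then of_int (sign q) else 0)"
    unfolding pt_def
  proof (rule sum.mono_neutral_right[OF finite_colperms[OF p]])
    show "colperms p' \<subseteq> colperms p" using sub by blast
    have "\<not> (\<forall>b\<in>diagram p. (u(a := m)) ((t(c := a)) (q b)) = fst b)"
      if "q \<in> colperms p - colperms p'" for q
      using key[of q m] that sub by blast
    then show "\<forall>q\<in>colperms p - colperms p'. (if \<forall>b\<in>diagram p. (u(a := m)) ((t(c := a)) (q b)) = fst b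
        then of_int (sign q) else 0) = (0::complex)"
      by (intro ballI) (simp only: if_False)
  qed
  also have "\<dots> = pt p' t u"
    unfolding pt_def using eq by (intro sum.cong refl) auto
  finally show "pt p (t((m, p m - 1) := a)) (u(a := m)) = pt (p(m := p m - 1)) t u"
    by (simp add: c_def p'_def)
  show "pt p (t((m, p m - 1) := a)) (u(a := j)) = 0" if "m < j"
  proof -
    have "\<not> (\<forall>b\<in>diagram p. (u(a := j)) ((t(c := a)) (q b)) = fst b)" if "q \<in> colperms p" for q
      using key[OF that less_imp_le[OF \<open>m < j\<close>]] \<open>m < j\<close> by blast
    then show ?thesis
      unfolding pt_def c_def[symmetric] by (intro sum.neutral ballI) (simp only: if_False)
  qed
qed

section \<open>Highest weight vectors are combinations of polytabloids\<close>

text \<open>Highest weight vectors for a product of general linear Lie algebras, one for each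
  colour: they are annihilated by the operators that turn a row index \<open>Suc i\<close> into
  \<open>i\<close> within a colour.\<close>

definition HW :: "'g set \<Rightarrow> 'a set \<Rightarrow> ('g \<times> nat \<Rightarrow> nat) \<Rightarrow> (('a \<Rightarrow> 'g \<times> nat) \<Rightarrow> complex) set" where
  "HW C A \<tau> = {v \<in> wt_space A \<tau>. \<forall>g\<in>C. \<forall>i. shift A (g, i) (g, Suc i) v = (\<lambda>w. 0)}"

text \<open>A product of polytabloids, one on each colour class of \<open>\<kappa>\<close>, extended
  by 0 to words with other colours. Such vectors generate the induced modules that afford the
  irreducible characters of the wreath product.\<close>

definition mpt :: "'g set \<Rightarrow> 'a set \<Rightarrow> ('a \<Rightarrow> 'g) \<Rightarrow> ('g \<Rightarrow> nat \<Rightarrow> nat) \<Rightarrow> ('g \<Rightarrow> nat \<times> nat \<Rightarrow> 'a)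
    \<Rightarrow> ('a \<Rightarrow> 'g \<times> nat) \<Rightarrow> complex" where
  "mpt C A \<kappa> l t w = (if w \<in> extensional A \<and> (\<forall>a\<in>A. fst (w a) = \<kappa> a)
     then \<Prod>g\<in>C. pt (l g) (t g) (\<lambda>a. snd (w a)) else 0)"

definition mpts :: "'g set \<Rightarrow> 'a set \<Rightarrow> ('g \<Rightarrow> nat \<Rightarrow> nat) \<Rightarrow> (('a \<Rightarrow> 'g \<times> nat) \<Rightarrow> complex) set" where
  "mpts C A l = {mpt C A \<kappa> l t | \<kappa> t. \<kappa> \<in> A \<rightarrow> C \<and> (\<forall>g\<in>C. t g \<in> tableaux {a\<in>A. \<kappa> a = g} (l g))}"

lemma wt_space_subspace: "cfun.subspace (wt_space A \<tau>)"
  by (auto simp: cfun.subspace_def wt_space_def fscale_def)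

lemma shift_add: "shift A l l' (u + v) = shift A l l' u + shift A l l' v"
  by (auto simp: shift_def sum.distrib)

lemma shift_fscale: "shift A l l' (fscale c v) = fscale c (shift A l l' v)"
  by (auto simp: shift_def fscale_def sum_distrib_left)

lemma shift_0: "shift A l l' 0 = 0"
  by (rule ext) (simp add: shift_def)

lemma HW_subspace: "cfun.subspace (HW C A \<tau>)"
proof -
  have "HW C A \<tau> = wt_space A \<tau> \<inter> {v. \<forall>g\<in>C. \<forall>i. shift A (g, i) (g, Suc i) v = 0}"
    by (auto simp: HW_def zero_fun_def)
  moreover have "cfun.subspace {v. \<forall>g\<in>C. \<forall>i. shift A (g, i) (g, Suc i) v = 0}"
  proof -
    show ?thesis
      by (intro cfun.subspaceI CollectI ballI allI)
        (simp_all only: shift_0 shift_add shift_fscale cfun.scale_zero_right add_0_left mem_Collect_eq)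
  qed
  ultimately show ?thesis using cfun.subspace_inter[OF wt_space_subspace] by (simp only:)
qed

text \<open>If row \<open>Suc i\<close> of some colour were longer than row \<open>i\<close>, the
  raising operator would be injective on the weight space by \<open>shift_inj\<close>, while it
  annihilates \<open>v\<close>. The support is finite because \<open>v\<close> is nonzero at some
  word.\<close>

lemma HW_dominant:
  assumes "finite A" "v \<in> HW C A \<tau>" "v \<noteq> 0" "g \<in> C"
  shows "(\<lambda>i. \<tau> (g, i)) \<in> Par"
proof -
  have "\<tau> (g, Suc i) \<le> \<tau> (g, i)" for i
  proof (rule ccontr)
    assume "\<not> \<tau> (g, Suc i) \<le> \<tau> (g, i)"
    then have "v = (\<lambda>w. 0)"
      using assms by (intro shift_inj[of A "(g, Suc i)" "(g, i)" v \<tau>]) (auto simp: HW_def)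
    then show False using assms(3) by (simp add: zero_fun_def)
  qed
  then have "antimono (\<lambda>i. \<tau> (g, i))" by (auto intro: decseq_SucI)
  moreover have "finite {i. \<tau> (g, i) \<noteq> 0}"
  proof -
    obtain w where "v w \<noteq> 0" using assms(3) by (auto simp: fun_eq_iff)
    then have "w \<in> words A \<tau>" using assms(2) by (auto simp: HW_def wt_space_def)
    then have "finite {l. \<tau> l \<noteq> 0}" using words_support[OF assms(1)] assms(1) by (metis finite_imageI)
    then have "finite (snd ` {l. \<tau> l \<noteq> 0})" by simp
    then show ?thesis by (rule finite_subset[rotated]) force
  qed
  ultimately show ?thesis by (simp add: Par_def)
qed

lemma pt_nonzero:
  assumes "pt p t u \<noteq> 0"
  shows "\<exists>q\<in>colperms p. \<forall>b\<in>diagram p. u (t (q b)) = fst b"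
proof (rule ccontr)
  assume "\<not> ?thesis"
  then have *: "\<not> (\<forall>b\<in>diagram p. u (t (q b)) = fst b)" if "q \<in> colperms p" for q
    using that by blast
  have "pt p t u = 0"
    unfolding pt_def by (intro sum.neutral ballI) (simp only: * if_False)
  then show False using assms by simp
qed

text \<open>In a nonzero term of the factor of colour \<open>g\<close>, the tableau composed with
  \<open>q\<close> maps row \<open>i\<close> of the diagram onto the positions with letter
  \<open>(g, i)\<close>, so there are \<open>\<tau> (g, i)\<close> of them.\<close>

lemma mpt_in_wt_space:
  assumes A: "finite A" and \<tau>: "\<And>l. \<tau> l \<noteq> 0 \<Longrightarrow> fst l \<in> C" and C: "finite C"
    and par: "\<And>g. g \<in> C \<Longrightarrow> curry \<tau> g \<in> Par"
    and \<kappa>: "\<kappa> \<in> A \<rightarrow> C" and t: "\<And>g. g \<in> C \<Longrightarrow> t g \<in> tableaux {a\<in>A. \<kappa> a = g} (curry \<tau> g)"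
  shows "mpt C A \<kappa> (curry \<tau>) t \<in> wt_space A \<tau>"
proof -
  have "w \<in> words A \<tau>" if nz: "mpt C A \<kappa> (curry \<tau>) t w \<noteq> 0" for w
  proof -
    have ext: "w \<in> extensional A" and col: "\<And>a. a \<in> A \<Longrightarrow> fst (w a) = \<kappa> a"
      using nz by (auto simp: mpt_def split: if_splits)
    have prod: "pt (curry \<tau> g) (t g) (\<lambda>a. snd (w a)) \<noteq> 0" if "g \<in> C" for g
      using nz that C by (auto simp: mpt_def split: if_splits)
    have "wcount A w (g, i) = \<tau> (g, i)" for g i
    proof (cases "g \<in> C")
      case False
      then have "{a\<in>A. w a = (g, i)} = {}" using col \<kappa> by fastforce
      moreover have "\<tau> (g, i) = 0" using \<tau>[of "(g, i)"] False by auto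
      ultimately show ?thesis by (simp only: wcount_def card.empty)
    next
      case True
      let ?D = "diagram (curry \<tau> g)"
      obtain q where q: "q \<in> colperms (curry \<tau> g)" "\<forall>b\<in>?D. snd (w (t g (q b))) = fst b"
        using pt_nonzero[OF prod[OF True]] by blast
      have "bij_betw (\<lambda>b. t g (q b)) ?D {a\<in>A. \<kappa> a = g}"
        using t[OF True] q(1) bij_betw_trans[OF permutes_imp_bij, of q ?D "t g"]
        by (auto simp: tableaux_def colperms_def o_def)
      then have inj: "inj_on (\<lambda>b. t g (q b)) ?D" and im: "(\<lambda>b. t g (q b)) ` ?D = {a\<in>A. \<kappa> a = g}"
        by (auto simp: bij_betw_def)
      have "(\<lambda>b. t g (q b)) ` {b\<in>?D. fst b = i} = {a\<in>A. w a = (g, i)}"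
      proof (intro equalityI subsetI)
        fix a assume "a \<in> (\<lambda>b. t g (q b)) ` {b\<in>?D. fst b = i}"
        then obtain b where b: "b \<in> ?D" "fst b = i" "a = t g (q b)" by blast
        then have "a \<in> A" "\<kappa> a = g" using im by blast+
        then show "a \<in> {a\<in>A. w a = (g, i)}" using b q(2) col by (simp add: prod_eq_iff)
      next
        fix a assume a: "a \<in> {a\<in>A. w a = (g, i)}"
        then have "\<kappa> a = g" using col by fastforce
        then obtain b where b: "b \<in> ?D" "a = t g (q b)" using im a by blast
        then have "fst b = i" using q(2) a by (metis (mono_tags) mem_Collect_eq snd_conv)
        then show "a \<in> (\<lambda>b. t g (q b)) ` {b\<in>?D. fst b = i}" using b by blast
      qed
      moreover have "inj_on (\<lambda>b. t g (q b)) {b\<in>?D. fst b = i}"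
        using inj by (rule inj_on_subset) auto
      ultimately show ?thesis
        using card_image card_diagram_row[of "curry \<tau> g" i] unfolding wcount_def
        by (metis (no_types, lifting) curry_conv)
    qed
    then show ?thesis using ext by (auto simp: words_def)
  qed
  then show ?thesis by (auto simp: wt_space_def)
qed

text \<open>The operator changes row indices of colour \<open>g\<close> only, so the other factors
  can be taken out of the sum, and what remains vanishes by \<open>pt_raise\<close>.\<close>

lemma mpt_raise:
  assumes A: "finite A" and C: "finite C" and g: "g \<in> C"
    and par: "\<And>g. g \<in> C \<Longrightarrow> l g \<in> Par"
    and t: "\<And>g. g \<in> C \<Longrightarrow> t g \<in> tableaux {a\<in>A. \<kappa> a = g} (l g)"
  shows "shift A (g, i) (g, Suc i) (mpt C A \<kappa> l t) = (\<lambda>w. 0)"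
proof
  fix w
  show "shift A (g, i) (g, Suc i) (mpt C A \<kappa> l t) w = 0"
  proof (cases "w \<in> extensional A \<and> (\<forall>a\<in>A. fst (w a) = \<kappa> a)")
    case False
    have "mpt C A \<kappa> l t (w(a := (g, Suc i))) = 0" if "a \<in> {a. a \<in> A \<and> w a = (g, i)}" for a
    proof -
      have a: "a \<in> A" "w a = (g, i)" using that by auto
      have "fst ((w(a := (g, Suc i))) b) = fst (w b)" for b using a by auto
      moreover have "w \<in> extensional A" if "w(a := (g, Suc i)) \<in> extensional A"
        using that a(1) by (fastforce simp: extensional_def split: if_splits)
      ultimately show ?thesis using False by (auto simp: mpt_def)
    qed
    then show ?thesis unfolding shift_def by (rule sum.neutral[OF ballI])
  next
    case True
    let ?u = "\<lambda>a. snd (w a)"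
    have "mpt C A \<kappa> l t (w(a := (g, Suc i))) =
        (\<Prod>h\<in>C - {g}. pt (l h) (t h) ?u) * pt (l g) (t g) (?u(a := Suc i))"
      if a: "a \<in> A" "w a = (g, i)" for a
    proof -
      have \<kappa>: "\<kappa> a = g" using True a by auto
      have "w(a := (g, Suc i)) \<in> extensional A \<and> (\<forall>b\<in>A. fst ((w(a := (g, Suc i))) b) = \<kappa> b)"
        using True a \<kappa> by (auto simp: extensional_def)
      moreover have "pt (l h) (t h) (\<lambda>b. snd ((w(a := (g, Suc i))) b)) = pt (l h) (t h) ?u"
        if "h \<in> C - {g}" for h
      proof (rule pt_cong)
        fix b assume "b \<in> diagram (l h)"
        then have "\<kappa> (t h b) = h" using t[of h] that by (auto simp: tableaux_def bij_betw_def)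
        then show "snd ((w(a := (g, Suc i))) (t h b)) = snd (w (t h b))" using \<kappa> that by auto
      qed
      moreover have "(\<lambda>b. snd ((w(a := (g, Suc i))) b)) = ?u(a := Suc i)" by auto
      ultimately have "mpt C A \<kappa> l t (w(a := (g, Suc i))) =
          (\<Prod>h\<in>C. if h = g then pt (l g) (t g) (?u(a := Suc i)) else pt (l h) (t h) ?u)"
        unfolding mpt_def by (auto intro!: prod.cong)
      also have "\<dots> = pt (l g) (t g) (?u(a := Suc i)) *
          (\<Prod>h\<in>C - {g}. if h = g then pt (l g) (t g) (?u(a := Suc i)) else pt (l h) (t h) ?u)"
        by (subst prod.remove[OF C g]) simp
      also have "(\<Prod>h\<in>C - {g}. if h = g then pt (l g) (t g) (?u(a := Suc i)) else pt (l h) (t h) ?u) =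
          (\<Prod>h\<in>C - {g}. pt (l h) (t h) ?u)"
        by (intro prod.cong) auto
      finally show ?thesis by (simp only: mult.commute)
    qed
    then have "shift A (g, i) (g, Suc i) (mpt C A \<kappa> l t) w = (\<Prod>h\<in>C - {g}. pt (l h) (t h) ?u) *
        (\<Sum>a | a \<in> A \<and> w a = (g, i). pt (l g) (t g) (?u(a := Suc i)))"
      by (simp add: shift_def sum_distrib_left)
    also have "{a. a \<in> A \<and> w a = (g, i)} = {a. a \<in> {a\<in>A. \<kappa> a = g} \<and> ?u a = i}"
      using True by (auto simp: prod_eq_iff)
    also have "(\<Sum>a\<in>\<dots>. pt (l g) (t g) (?u(a := Suc i))) = 0"
      using pt_raise[OF par[OF g], of "t g" "{a\<in>A. \<kappa> a = g}" ?u i] t[OF g]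
      by (simp add: tableaux_def)
    finally show ?thesis by simp
  qed
qed

text \<open>The component of \<open>v\<close> with tensor factor \<open>l\<close> at position
  \<open>a\<close>. The guard fixes the value of \<open>w\<close> at \<open>a\<close>: for
  \<open>a \<notin> A\<close> each word on \<open>A\<close> occurs once.\<close>

definition comp_at :: "'a set \<Rightarrow> 'a \<Rightarrow> 'l \<Rightarrow> (('a \<Rightarrow> 'l) \<Rightarrow> complex) \<Rightarrow> ('a \<Rightarrow> 'l) \<Rightarrow> complex" where
  "comp_at A a l v = (\<lambda>w. if w \<in> extensional A then v (w(a := l)) else 0)"

lemma comp_at_add: "comp_at A a l (u + v) = comp_at A a l u + comp_at A a l v"
  by (auto simp: comp_at_def)

lemma comp_at_diff: "comp_at A a l (u - v) = comp_at A a l u - comp_at A a l v"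
  by (auto simp: comp_at_def)

lemma comp_at_fscale: "comp_at A a l (fscale c v) = fscale c (comp_at A a l v)"
  by (auto simp: comp_at_def fscale_def)

lemma comp_at_0: "comp_at A a l 0 = 0"
  by (auto simp: comp_at_def)

lemma comp_at_sum: "comp_at A a l (\<Sum>i\<in>I. f i) = (\<Sum>i\<in>I. comp_at A a l (f i))"
  by (induction I rule: infinite_finite_induct)
    (simp_all only: comp_at_0 comp_at_add sum.infinite sum.empty sum.insert not_False_eq_True)

lemma wcount_insert:
  assumes "finite A" "a \<notin> A"
  shows "wcount (insert a A) (w(a := l)) = (wcount A w)(l := Suc (wcount A w l))"
proof
  fix k
  show "wcount (insert a A) (w(a := l)) k = ((wcount A w)(l := Suc (wcount A w l))) k"
  proof (cases "k = l")
    case True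
    have "{x \<in> insert a A. (w(a := l)) x = l} = insert a {x\<in>A. w x = l}"
      using assms(2) by auto
    then show ?thesis using True assms by (simp add: wcount_def)
  next
    case False
    have "{x \<in> insert a A. (w(a := l)) x = k} = {x\<in>A. w x = k}"
      using assms(2) False by auto
    then show ?thesis using False by (simp add: wcount_def)
  qed
qed

lemma comp_at_wt_space:
  assumes "finite A" "a \<notin> A" "v \<in> wt_space (insert a A) \<tau>"
  shows "comp_at A a l v \<in> wt_space A (\<tau>(l := \<tau> l - 1))"
    and "comp_at A a l v \<noteq> 0 \<Longrightarrow> \<tau> l \<noteq> 0"
proof -
  have *: "w \<in> words A (\<tau>(l := \<tau> l - 1)) \<and> \<tau> l \<noteq> 0" if "comp_at A a l v w \<noteq> 0" for w
  proof -
    have w: "w \<in> extensional A" "v (w(a := l)) \<noteq> 0"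
      using that by (auto simp: comp_at_def split: if_splits)
    then have "wcount (insert a A) (w(a := l)) = \<tau>"
      using assms(3) by (auto simp: wt_space_def words_def)
    then have "\<tau> = (wcount A w)(l := Suc (wcount A w l))"
      using wcount_insert[OF assms(1,2)] by metis
    then show ?thesis using w by (auto simp: words_def)
  qed
  then show "comp_at A a l v \<in> wt_space A (\<tau>(l := \<tau> l - 1))" by (auto simp: wt_space_def)
  show "\<tau> l \<noteq> 0" if nz: "comp_at A a l v \<noteq> 0"
  proof -
    obtain w where "comp_at A a l v w \<noteq> 0" using nz by (auto simp: fun_eq_iff)
    then show ?thesis using * by blast
  qed
qed

text \<open>Raising the letter at the extra position \<open>a\<close> produces the component at \<open>(g, Suc k)\<close>.\<close>

lemma comp_at_HW:
  assumes A: "finite A" "a \<notin> A" and v: "v \<in> HW C (insert a A) \<tau>"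
    and top: "comp_at A a (g, Suc k) v = 0"
  shows "comp_at A a (g, k) v \<in> HW C A (\<tau>((g, k) := \<tau> (g, k) - 1))"
proof -
  have "shift A (h, i) (h, Suc i) (comp_at A a (g, k) v) w = 0" if h: "h \<in> C" for h i w
  proof (cases "w \<in> extensional A")
    case False
    have "comp_at A a (g, k) v (w(b := (h, Suc i))) = 0" if "b \<in> A" for b
      using False that by (auto simp: comp_at_def extensional_def split: if_splits)
    then show ?thesis by (simp add: shift_def)
  next
    case True
    let ?w = "w(a := (g, k))"
    have "0 = shift (insert a A) (h, i) (h, Suc i) v ?w"
      using v h by (simp add: HW_def)
    also have "\<dots> = (\<Sum>b\<in>insert a A. if ?w b = (h, i) then v (?w(b := (h, Suc i))) else 0)"
      unfolding shift_def using A by (intro sum.mono_neutral_cong_left) auto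
    \<comment> \<open>The position \<open>a\<close> contributes only if
      \<open>(h, i) = (g, k)\<close>, and then its contribution is the component at
      \<open>(g, Suc k)\<close>, which is 0 by \<open>top\<close>.\<close>
    also have "\<dots> = (\<Sum>b\<in>A. if w b = (h, i) then v (?w(b := (h, Suc i))) else 0)"
    proof -
      have "v (w(a := (g, Suc k))) = 0"
        using top True by (auto simp: comp_at_def fun_eq_iff split: if_splits)
      moreover have "(\<Sum>b\<in>A. if ?w b = (h, i) then v (?w(b := (h, Suc i))) else 0) =
          (\<Sum>b\<in>A. if w b = (h, i) then v (?w(b := (h, Suc i))) else 0)"
        using A by (intro sum.cong) auto
      ultimately show ?thesis using A by (auto simp: sum.insert)
    qed
    also have "\<dots> = (\<Sum>b\<in>A. if w b = (h, i) then comp_at A a (g, k) v (w(b := (h, Suc i))) else 0)"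
    proof (rule sum.cong[OF refl])
      fix b assume "b \<in> A"
      then have "a \<noteq> b" using A by blast
      then have e: "?w(b := (h, Suc i)) = w(b := (h, Suc i), a := (g, k))"
        by (rule fun_upd_twist)
      have "w(b := (h, Suc i)) \<in> extensional A"
        using True \<open>b \<in> A\<close> by (auto simp: extensional_def)
      then have "comp_at A a (g, k) v (w(b := (h, Suc i))) = v (?w(b := (h, Suc i)))"
        unfolding e by (simp only: comp_at_def if_True)
      then show "(if w b = (h, i) then v (?w(b := (h, Suc i))) else 0) =
          (if w b = (h, i) then comp_at A a (g, k) v (w(b := (h, Suc i))) else 0)"
        by (simp only:)
    qed
    also have "\<dots> = shift A (h, i) (h, Suc i) (comp_at A a (g, k) v) w"
      unfolding shift_def using A by (intro sum.mono_neutral_cong_right) auto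
    finally show ?thesis by simp
  qed
  then show ?thesis
    using comp_at_wt_space[OF A, of v \<tau> "(g, k)"] v by (auto simp: HW_def)
qed

text \<open>The easy inclusion in the description of highest weight vectors. It ensures in the
  induction below that subtracting products of polytabloids does not leave the space.\<close>

lemma mpts_subset_HW:
  assumes "finite A" "finite C" "\<And>l. \<tau> l \<noteq> 0 \<Longrightarrow> fst l \<in> C" "\<And>g. g \<in> C \<Longrightarrow> curry \<tau> g \<in> Par"
  shows "cfun.span (mpts C A (curry \<tau>)) \<subseteq> HW C A \<tau>"
proof (rule cfun.span_minimal[OF _ HW_subspace], rule subsetI)
  fix f assume "f \<in> mpts C A (curry \<tau>)"
  then obtain \<kappa> t where f: "f = mpt C A \<kappa> (curry \<tau>) t" and \<kappa>: "\<kappa> \<in> A \<rightarrow> C"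
    and t: "\<And>g. g \<in> C \<Longrightarrow> t g \<in> tableaux {a\<in>A. \<kappa> a = g} (curry \<tau> g)"
    by (auto simp: mpts_def)
  have "f \<in> wt_space A \<tau>"
    unfolding f by (rule mpt_in_wt_space[OF assms(1,3,2,4) \<kappa> t])
  moreover have "shift A (g, i) (g, Suc i) f = (\<lambda>w. 0)" if "g \<in> C" for g i
    unfolding f by (rule mpt_raise[OF assms(1,2) that assms(4) t])
  ultimately show "f \<in> HW C A \<tau>"
    by (auto simp: HW_def)
qed

text \<open>The lift puts \<open>a\<close> into the corner box in row \<open>k\<close>.\<close>

lemma mpts_lift:
  fixes C :: "'g set" and A :: "'a set"
  assumes A: "finite A" "a \<notin> A" and C: "finite C" and g: "g \<in> C" and pos: "\<tau> (g, k) \<noteq> 0"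
    and par: "\<And>h. h \<in> C \<Longrightarrow> curry \<tau> h \<in> Par"
    and \<tau>': "\<tau>' = \<tau>((g, k) := \<tau> (g, k) - 1)"
    and par': "\<And>h. h \<in> C \<Longrightarrow> curry \<tau>' h \<in> Par"
    and f: "f \<in> cfun.span (mpts C A (curry \<tau>'))"
  shows "\<exists>F\<in>cfun.span (mpts C (insert a A) (curry \<tau>)). comp_at A a (g, k) F = f \<and>
    (\<forall>h j. h \<noteq> g \<or> k < j \<longrightarrow> comp_at A a (h, j) F = 0)"
proof -
  define S where "S = cfun.span (mpts C (insert a A) (curry \<tau>))"
  define L where "L = (\<lambda>f F. F \<in> S \<and> comp_at A a (g, k) F = f \<and>
    (\<forall>h j. h \<noteq> g \<or> k < j \<longrightarrow> comp_at A a (h, j) F = 0))"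
  have cg: "(curry \<tau> g)(k := curry \<tau> g k - 1) = curry \<tau>' g" by (auto simp: \<tau>')
  have "cfun.subspace {f. \<exists>F. L f F}"
  proof (rule cfun.subspaceI)
    show "0 \<in> {f. \<exists>F. L f F}"
      by (auto simp: L_def S_def comp_at_0 cfun.span_zero intro!: exI[of _ 0])
  next
    fix x y assume "x \<in> {f. \<exists>F. L f F}" "y \<in> {f. \<exists>F. L f F}"
    then obtain X Y where "L x X" "L y Y" by blast
    then have "L (x + y) (X + Y)"
      unfolding L_def S_def by (simp only: comp_at_add cfun.span_add) simp
    then show "x + y \<in> {f. \<exists>F. L f F}" by blast
  next
    fix c x assume "x \<in> {f. \<exists>F. L f F}"
    then obtain X where "L x X" by blast
    then have "L (fscale c x) (fscale c X)"
      unfolding L_def S_def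
      by (simp only: comp_at_fscale cfun.span_scale) (simp add: cfun.scale_zero_right)
    then show "fscale c x \<in> {f. \<exists>F. L f F}" by blast
  qed
  moreover have "mpts C A (curry \<tau>') \<subseteq> {f. \<exists>F. L f F}"
  proof
    fix f assume "f \<in> mpts C A (curry \<tau>')"
    then obtain \<kappa> t where f: "f = mpt C A \<kappa> (curry \<tau>') t" and \<kappa>: "\<kappa> \<in> A \<rightarrow> C"
      and t: "\<And>h. h \<in> C \<Longrightarrow> t h \<in> tableaux {b\<in>A. \<kappa> b = h} (curry \<tau>' h)"
      by (auto simp: mpts_def)
    define c where "c = (k, curry \<tau> g k - 1)"
    define \<kappa>' where "\<kappa>' = \<kappa>(a := g)"
    define t' where "t' = t(g := (t g)(c := a))"
    have pos': "curry \<tau> g k \<noteq> 0" using pos by simp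
    have \<kappa>'C: "\<kappa>' \<in> insert a A \<rightarrow> C" using \<kappa> g by (auto simp: \<kappa>'_def)
    have Qg: "{b\<in>insert a A. \<kappa>' b = g} = insert a {b\<in>A. \<kappa> b = g}" using A by (auto simp: \<kappa>'_def)
    have Qh: "{b\<in>insert a A. \<kappa>' b = h} = {b\<in>A. \<kappa> b = h}" if "h \<noteq> g" for h
      using A that by (auto simp: \<kappa>'_def)
    have lh: "curry \<tau> h = curry \<tau>' h" if "h \<noteq> g" for h using that by (auto simp: \<tau>' curry_def)
    have t': "t' h \<in> tableaux {b\<in>insert a A. \<kappa>' b = h} (curry \<tau> h)" if h: "h \<in> C" for h
    proof (cases "h = g")
      case True
      have D: "diagram (curry \<tau> g) = insert c (diagram (curry \<tau>' g))" "c \<notin> diagram (curry \<tau>' g)"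
        using diagram_corner[of "curry \<tau> g" k, OF pos'] cg by (simp_all add: c_def)
      have tg: "bij_betw (t g) (diagram (curry \<tau>' g)) {b\<in>A. \<kappa> b = g}"
        "t g \<in> extensional (diagram (curry \<tau>' g))"
        using t[OF g] by (auto simp: tableaux_def)
      have "bij_betw ((t g)(c := a)) (diagram (curry \<tau>' g)) {b\<in>A. \<kappa> b = g}"
        using tg(1) D(2) by (subst bij_betw_cong[of _ _ "t g"]) auto
      moreover have "((t g)(c := a)) c \<notin> {b\<in>A. \<kappa> b = g}" using A by simp
      ultimately have "bij_betw ((t g)(c := a)) (diagram (curry \<tau> g)) (insert a {b\<in>A. \<kappa> b = g})"
        using D notIn_Un_bij_betw[of c "diagram (curry \<tau>' g)" "(t g)(c := a)"] by simp
      moreover have "(t g)(c := a) \<in> extensional (diagram (curry \<tau> g))"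
        using tg(2) D by (auto simp: extensional_def)
      ultimately show ?thesis using True Qg by (simp add: tableaux_def t'_def)
    next
      case False
      then show ?thesis using t[OF h] Qh lh by (simp add: t'_def)
    qed
    define F where "F = mpt C (insert a A) \<kappa>' (curry \<tau>) t'"
    have "F \<in> mpts C (insert a A) (curry \<tau>)"
      unfolding F_def mpts_def using \<kappa>'C t' by blast
    then have FS: "F \<in> S" by (simp add: S_def cfun.span_base)
    \<comment> \<open>All components of the lift at \<open>a\<close> at once. A letter of another
      colour gives 0, as \<open>\<kappa>'\<close> assigns the colour \<open>g\<close> to
      \<open>a\<close>; the row index enters only the factor of colour \<open>g\<close>, where
      \<open>a\<close> occupies the corner.\<close>
    have comp: "comp_at A a (h, j) F w = (if h = g \<and> w \<in> extensional A \<and> (\<forall>b\<in>A. fst (w b) = \<kappa> b)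
        then (\<Prod>i\<in>C - {g}. pt (curry \<tau>' i) (t i) (\<lambda>b. snd (w b))) *
          pt (curry \<tau> g) ((t g)(c := a)) ((\<lambda>b. snd (w b))(a := j)) else 0)" for h j w
    proof (cases "w \<in> extensional A")
      case w: True
      have *: "w(a := (h, j)) \<in> extensional (insert a A) \<and> (\<forall>b\<in>insert a A. fst ((w(a := (h, j))) b) = \<kappa>' b)
        \<longleftrightarrow> h = g \<and> (\<forall>b\<in>A. fst (w b) = \<kappa> b)"
        using w A by (auto simp: extensional_def \<kappa>'_def)
      have **: "(\<lambda>b. snd ((w(a := (h, j))) b)) = (\<lambda>b. snd (w b))(a := j)" by auto
      have "pt (curry \<tau> i) (t' i) ((\<lambda>b. snd (w b))(a := j)) = pt (curry \<tau>' i) (t i) (\<lambda>b. snd (w b))"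
        if i: "i \<in> C - {g}" for i
      proof -
        have "t i b \<noteq> a" if "b \<in> diagram (curry \<tau>' i)" for b
          using t[of i] i A that by (auto simp: tableaux_def bij_betw_def)
        then show ?thesis using i lh[of i] by (auto simp: t'_def intro!: pt_cong)
      qed
      then have "(\<Prod>i\<in>C. pt (curry \<tau> i) (t' i) ((\<lambda>b. snd (w b))(a := j))) =
         (\<Prod>i\<in>C - {g}. pt (curry \<tau>' i) (t i) (\<lambda>b. snd (w b))) *
          pt (curry \<tau> g) ((t g)(c := a)) ((\<lambda>b. snd (w b))(a := j))"
        by (subst prod.remove[OF C g]) (simp add: t'_def)
      then show ?thesis
        unfolding comp_at_def F_def mpt_def * ** using w by (simp only: if_True simp_thms) 
    next
      case False
      then show ?thesis by (simp add: comp_at_def)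
    qed
    have tsub: "t g ` diagram ((curry \<tau> g)(k := curry \<tau> g k - 1)) \<subseteq> {b\<in>A. \<kappa> b = g}"
      using t[OF g] unfolding cg by (simp add: tableaux_def bij_betw_def)
    have par'': "(curry \<tau> g)(k := curry \<tau> g k - 1) \<in> Par" using par'[OF g] unfolding cg .
    \<comment> \<open>Row \<open>k\<close> gives back the factor of the smaller shape, and row
      indices above \<open>k\<close> give 0. Those less than \<open>k\<close> are not controlled,
      which dictates the order of elimination in the next theorem.\<close>
    note corner = pt_corner[of "curry \<tau> g" k, OF par[OF g] par'' pos' tsub, of a, folded c_def, unfolded cg]
    have "comp_at A a (g, k) F = f"
    proof
      fix w :: "'a \<Rightarrow> 'g \<times> nat"
      have "pt (curry \<tau> g) ((t g)(c := a)) ((\<lambda>b. snd (w b))(a := k)) =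
          pt (curry \<tau>' g) (t g) (\<lambda>b. snd (w b))"
        using corner(1) A by blast
      then show "comp_at A a (g, k) F w = f w"
        unfolding comp f mpt_def using prod.remove[OF C g, of "\<lambda>i. pt (curry \<tau>' i) (t i) (\<lambda>b. snd (w b))"]
        by (simp add: mult.commute)
    qed
    moreover have "comp_at A a (h, j) F = 0" if "h \<noteq> g \<or> k < j" for h j
    proof
      fix w :: "'a \<Rightarrow> 'g \<times> nat"
      have "pt (curry \<tau> g) ((t g)(c := a)) ((\<lambda>b. snd (w b))(a := j)) = 0" if "k < j"
        using corner(2) A that by blast
      then show "comp_at A a (h, j) F w = 0 w"
        unfolding comp using that by auto
    qed
    ultimately show "f \<in> {f. \<exists>F. L f F}" using FS by (auto simp: L_def)
  qed
  ultimately have "cfun.span (mpts C A (curry \<tau>')) \<subseteq> {f. \<exists>F. L f F}"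
    by (intro cfun.span_minimal)
  then show ?thesis using f by (auto simp: L_def S_def)
qed

text \<open>Induction on the positions. For a new position \<open>a\<close>, the components at
  \<open>a\<close> are cleared from the largest row index downwards: if all components beyond row
  \<open>k\<close> vanish, those in row \<open>k\<close> are highest weight on the smaller set of
  positions, hence combinations of products of polytabloids, and subtracting their lifts clears row
  \<open>k\<close> and leaves the larger row indices at 0. The argument has the shape of a branching
  rule.\<close>

theorem HW_subset_span_mpts:
  fixes C :: "'g set" and A :: "'a set"
  assumes "finite A" "finite C" "\<And>l. \<tau> l \<noteq> 0 \<Longrightarrow> fst l \<in> C" "v \<in> HW C A \<tau>"
  shows "v \<in> cfun.span (mpts C A (curry \<tau>))"
  using assms(1,3,4)
proof (induction A arbitrary: \<tau> v rule: finite_induct)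
  case empty
  \<comment> \<open>Without positions there is just one word, and its indicator is the product of
    empty polytabloids.\<close>
  define w0 where "w0 = (\<lambda>_ :: 'a. undefined :: 'g \<times> nat)"
  have v0: "v w = 0" if "w \<noteq> w0" for w
    using empty that by (auto simp: HW_def wt_space_def words_def w0_def)
  show ?case
  proof (cases "v w0 = 0")
    case True
    then have "v w = 0" for w using v0[of w] by (cases "w = w0") auto
    then have "v = 0" by (simp add: fun_eq_iff)
    then show ?thesis by (simp only: cfun.span_zero)
  next
    case False
    then have "w0 \<in> words {} \<tau>" using empty by (auto simp: HW_def wt_space_def)
    then have "\<tau> = (\<lambda>_. 0)" by (auto simp: words_def wcount_def fun_eq_iff)
    then have D: "diagram (curry \<tau> g) = {}" for g by (simp add: diagram_def)
    have cp: "colperms (curry \<tau> g) = {id}" for g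
      unfolding colperms_def D by auto
    have pt1: "pt (curry \<tau> g) t u = 1" for g t u
      unfolding pt_def cp D by simp
    define m where "m = mpt C {} (\<lambda>_ :: 'a. undefined) (curry \<tau>) (\<lambda>_ _. undefined)"
    have m: "m w = (if w = w0 then 1 else 0)" for w
      unfolding m_def mpt_def pt1 by (auto simp: w0_def)
    have "m \<in> mpts C {} (curry \<tau>)"
      unfolding m_def mpts_def mem_Collect_eq
      by (intro exI[of _ "\<lambda>_ :: 'a. undefined"] exI[of _ "\<lambda>_ _. undefined"])
        (auto simp: tableaux_def D bij_betw_def)
    then have "fscale (v w0) m \<in> cfun.span (mpts C {} (curry \<tau>))"
      by (intro cfun.span_scale cfun.span_base)
    moreover have "fscale (v w0) m = v" using v0 by (auto simp: fscale_def m)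
    ultimately show ?thesis by (simp only:)
  qed
next
  case (insert a A)
  let ?S = "cfun.span (mpts C (insert a A) (curry \<tau>))"
  show ?case
  proof (cases "v = 0")
    case True
    then show ?thesis by (simp only: cfun.span_zero)
  next
    case False
    have fin: "finite (insert a A)" using insert by simp
    have par: "curry \<tau> g \<in> Par" if "g \<in> C" for g
      using HW_dominant[OF fin insert.prems(2) False that] by (simp add: curry_def)
    note S_HW = mpts_subset_HW[OF fin assms(2) insert.prems(1) par]
    have step: "u \<in> ?S" if "u \<in> HW C (insert a A) \<tau>" "\<And>g j. g \<in> C \<Longrightarrow> k \<le> j \<Longrightarrow> comp_at A a (g, j) u = 0" for k u
      using that
    proof (induction k arbitrary: u)
      case 0
      have "u w = 0" for w
      proof (rule ccontr)
        assume nz: "u w \<noteq> 0"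
        then have w: "w \<in> words (insert a A) \<tau>" using 0 by (auto simp: HW_def wt_space_def)
        then have "\<tau> (w a) \<noteq> 0" using wcount_pos[OF fin, of a w] by (auto simp: words_def)
        then have "fst (w a) \<in> C" using insert.prems(1) by blast
        then have "comp_at A a (w a) u = 0"
          using 0(2)[of "fst (w a)" "snd (w a)"] by (simp only: prod.collapse le0)
        then have "comp_at A a (w a) u (w(a := undefined)) = 0" by (simp only: zero_fun_apply)
        moreover have "w(a := undefined) \<in> extensional A"
          using w by (auto simp: words_def extensional_def)
        ultimately show False using nz by (simp add: comp_at_def)
      qed
      then have "u = 0" by (simp add: fun_eq_iff)
      then show ?case by (simp only: cfun.span_zero)
    next
      case (Suc k)
      have "\<exists>F\<in>?S. comp_at A a (g, k) F = comp_at A a (g, k) u \<and>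
          (\<forall>h j. h \<noteq> g \<or> k < j \<longrightarrow> comp_at A a (h, j) F = 0)" if g: "g \<in> C" for g
      proof (cases "comp_at A a (g, k) u = 0")
        case True
        then show ?thesis by (intro bexI[of _ 0]) (simp_all add: comp_at_0 cfun.span_zero)
      next
        case nz: False
        let ?\<tau>' = "\<tau>((g, k) := \<tau> (g, k) - 1)"
        have hw: "comp_at A a (g, k) u \<in> HW C A ?\<tau>'"
          by (rule comp_at_HW[OF insert(1,2) Suc.prems(1) Suc.prems(2)[OF g]]) simp
        have pos: "\<tau> (g, k) \<noteq> 0"
          using comp_at_wt_space(2)[OF insert(1,2) _ nz] Suc.prems(1) by (auto simp: HW_def)
        have C': "fst l \<in> C" if "?\<tau>' l \<noteq> 0" for l
          using that insert.prems(1)[of l] by (auto split: if_splits)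
        have par': "curry ?\<tau>' h \<in> Par" if "h \<in> C" for h
          using HW_dominant[OF insert(1) hw nz that] by (simp add: curry_def)
        have sp: "comp_at A a (g, k) u \<in> cfun.span (mpts C A (curry ?\<tau>'))"
          by (rule insert.IH[OF C' hw])
        show ?thesis
          by (rule mpts_lift[OF insert(1,2) assms(2) g pos _ refl _ sp]) (erule par, erule par')
      qed
      then obtain F where F: "\<And>g. g \<in> C \<Longrightarrow> F g \<in> ?S"
        "\<And>g. g \<in> C \<Longrightarrow> comp_at A a (g, k) (F g) = comp_at A a (g, k) u"
        "\<And>g h j. g \<in> C \<Longrightarrow> h \<noteq> g \<or> k < j \<Longrightarrow> comp_at A a (h, j) (F g) = 0"
        by metis
      \<comment> \<open>One lift for each colour. They do not disturb each other, because the lift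
        for \<open>g\<close> has no component at letters of another colour.\<close>
      define T where "T = (\<Sum>g\<in>C. F g)"
      have TS: "T \<in> ?S" unfolding T_def by (intro cfun.span_sum F)
      have "u - T \<in> HW C (insert a A) \<tau>"
        using TS S_HW Suc.prems(1) by (intro cfun.subspace_diff[OF HW_subspace]) auto
      moreover have "comp_at A a (g, j) (u - T) = 0" if "g \<in> C" "k \<le> j" for g j
      proof (cases "j = k")
        case True
        have "comp_at A a (g, k) T = (\<Sum>h\<in>C. if h = g then comp_at A a (g, k) u else 0)"
          unfolding T_def comp_at_sum using F(2)[OF that(1)] F(3) by (intro sum.cong) auto
        also have "\<dots> = comp_at A a (g, k) u"
          using assms(2) that(1) by (subst sum.delta) auto
        finally show ?thesis using True by (simp only: comp_at_diff diff_self)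
      next
        case False
        then have "comp_at A a (g, j) T = 0"
          unfolding T_def comp_at_sum using F(3) that by (intro sum.neutral) auto
        moreover have "comp_at A a (g, j) u = 0"
          by (rule Suc.prems(2)[OF that(1)]) (use that False in simp)
        ultimately show ?thesis by (simp only: comp_at_diff diff_self)
      qed
      ultimately have "u - T \<in> ?S" by (rule Suc.IH)
      then have "(u - T) + T \<in> ?S" using TS by (rule cfun.span_add)
      then show ?case by (simp only: diff_add_cancel)
    qed
    obtain w where "v w \<noteq> 0" using False by (auto simp: fun_eq_iff)
    then have "w \<in> words (insert a A) \<tau>" using insert.prems(2) by (auto simp: HW_def wt_space_def)
    then have "finite {l. \<tau> l \<noteq> 0}" using words_support[OF fin] fin by (metis finite_imageI)
    then have "finite (snd ` {l. \<tau> l \<noteq> 0})" by (rule finite_imageI)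
    then obtain k where "\<forall>j\<in>snd ` {l. \<tau> l \<noteq> 0}. j < k"
      by (auto simp only: finite_nat_set_iff_bounded)
    then have k: "\<And>l. \<tau> l \<noteq> 0 \<Longrightarrow> snd l < k" by blast
    have "comp_at A a (g, j) v = 0" if "k \<le> j" for g j
      using comp_at_wt_space(2)[OF insert(1,2), of v \<tau> "(g, j)"] insert.prems(2) k[of "(g, j)"] that
      by (auto simp: HW_def)
    then show ?thesis using step[OF insert.prems(2), of k] by blast
  qed
qed

section \<open>The wreath product acting on functions of words\<close>

lemma wcount_perm:
  assumes "p permutes A" shows "wcount A (w \<circ> p) = wcount A w"
proof
  fix l
  have "p ` {i\<in>A. w (p i) = l} = {i\<in>A. w i = l}"
    using permutes_image[OF assms] permutes_in_image[OF assms] by (auto simp: image_iff)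
  moreover have "inj_on p {i\<in>A. w (p i) = l}"
    using permutes_inj[OF assms] by (rule inj_on_subset) auto
  ultimately have "card {i\<in>A. w i = l} = card {i\<in>A. w (p i) = l}"
    using card_image[of p "{i\<in>A. w (p i) = l}"] by simp
  then show "wcount A (w \<circ> p) l = wcount A w l" by (simp add: wcount_def)
qed

lemma extensional_perm:
  assumes "p permutes A" shows "w \<circ> p \<in> extensional A \<longleftrightarrow> w \<in> extensional A"
  using assms permutes_not_in[OF assms] permutes_in_image[OF assms]
  by (auto simp: extensional_def)

lemma words_perm: "p permutes A \<Longrightarrow> w \<circ> p \<in> words A \<tau> \<longleftrightarrow> w \<in> words A \<tau>"
  by (simp add: words_def wcount_perm extensional_perm)

locale wreath_characters = comm_group G for G :: "('g, 'm) monoid_scheme" (structure) +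
  fixes n :: nat and \<theta> :: "'g \<Rightarrow> 'g \<Rightarrow> complex"
  assumes finG: "finite (carrier G)"
    and iso: "\<theta> \<in> iso G (character_group G)"
begin

definition I :: "nat set" where "I = {1..n}"

lemma finite_I [simp]: "finite I"
  by (simp add: I_def)

abbreviation W :: "((nat \<Rightarrow> 'g) \<times> (nat \<Rightarrow> nat)) monoid" where "W \<equiv> wreath G n"

text \<open>Letters of a word may have any first component, so the characters are completed by the
  constant 1 off the carrier; multiplicativity and absolute value 1 on group elements then hold for
  every \<open>g\<close>.\<close>

definition chr :: "'g \<Rightarrow> 'g \<Rightarrow> complex" where
  "chr g x = (if g \<in> carrier G then \<theta> g x else 1)"

lemma theta_char:
  assumes "g \<in> carrier G"
  shows "\<theta> g \<in> hom G \<lparr>carrier = UNIV - {0}, mult = (*), one = 1\<rparr>" "\<theta> g \<in> extensional (carrier G)"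
proof -
  have "\<theta> g \<in> carrier (character_group G)"
    using iso assms by (auto simp: iso_def hom_def)
  then show "\<theta> g \<in> hom G \<lparr>carrier = UNIV - {0}, mult = (*), one = 1\<rparr>" "\<theta> g \<in> extensional (carrier G)"
    by (simp_all add: character_group_def)
qed

lemma chr_mult: "x \<in> carrier G \<Longrightarrow> y \<in> carrier G \<Longrightarrow> chr g (x \<otimes> y) = chr g x * chr g y"
  using theta_char(1)[of g] by (auto simp: chr_def hom_def)

lemma chr_nonzero: "x \<in> carrier G \<Longrightarrow> chr g x \<noteq> 0"
  using theta_char(1)[of g] by (auto simp: chr_def hom_def)

lemma chr_one: "chr g \<one> = 1"
  using chr_mult[of \<one> \<one> g] chr_nonzero[of \<one> g] by simp

lemma chr_pow: "x \<in> carrier G \<Longrightarrow> chr g (x [^] (k::nat)) = chr g x ^ k"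
  by (induction k) (simp_all add: chr_one chr_mult)

lemma norm_chr:
  assumes "x \<in> carrier G" shows "cmod (chr g x) = 1"
proof -
  have "chr g x ^ order G = chr g (x [^] order G)" using assms by (rule chr_pow[symmetric])
  also have "\<dots> = 1" using pow_order_eq_1[OF assms] by (simp only: chr_one)
  finally have "chr g x ^ order G = 1" .
  from arg_cong[OF this, of cmod] have 1: "cmod (chr g x) ^ order G = 1 ^ order G"
    unfolding norm_power norm_one power_one .
  have "0 < order G" using finG by (simp add: order_gt_0_iff_finite)
  with norm_ge_zero zero_le_one show ?thesis by (rule power_eq_imp_eq_base[OF 1])
qed

lemma chr_cnj: "x \<in> carrier G \<Longrightarrow> chr g x * cnj (chr g x) = 1"
  using norm_chr by (simp add: complex_norm_square[symmetric])

lemma chr_trivial: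
  assumes "x \<in> carrier G" shows "chr \<one> x = 1"
proof -
  have "\<theta> \<in> hom G (character_group G)" using iso by (simp add: iso_def)
  then have "\<theta> (\<one> \<otimes> \<one>) = \<theta> \<one> \<otimes>\<^bsub>character_group G\<^esub> \<theta> \<one>" by (rule hom_mult) auto
  from fun_cong[OF this, of x] have "\<theta> \<one> x = \<theta> \<one> x * \<theta> \<one> x"
    using assms by (simp add: character_group_def)
  then show ?thesis using chr_nonzero[OF assms, of \<one>] by (simp add: chr_def)
qed

lemma chr_inj:
  assumes "g \<in> carrier G" "h \<in> carrier G" "\<And>x. x \<in> carrier G \<Longrightarrow> chr g x = chr h x"
  shows "g = h"
proof -
  have "\<theta> g = \<theta> h"
    using assms theta_char(2) by (intro extensionalityI[of _ "carrier G"]) (auto simp: chr_def)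
  moreover have "inj_on \<theta> (carrier G)" using iso by (simp add: iso_def bij_betw_def)
  ultimately show ?thesis using assms by (simp add: inj_on_def)
qed

section \<open>The group structure of the wreath product\<close>

lemma wreath_carrier:
  "y \<in> carrier W \<longleftrightarrow> fst y \<in> I \<rightarrow>\<^sub>E carrier G \<and> snd y permutes I"
  by (cases y) (simp add: wreath_def sym_group_def I_def)

lemma wreath_mult: "y \<otimes>\<^bsub>W\<^esub> z =
    (\<lambda>i\<in>I. fst y i \<otimes> fst z (inv_into UNIV (snd y) i), snd y \<circ> snd z)"
  by (cases y; cases z) (simp add: wreath_def I_def)

lemma wreath_one: "\<one>\<^bsub>W\<^esub> = (\<lambda>i\<in>I. \<one>, id)"
  by (simp add: wreath_def I_def)

lemma perm_inv_mem: "p permutes I \<Longrightarrow> i \<in> I \<Longrightarrow> inv_into UNIV p i \<in> I"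
  by (rule permutes_mem[OF permutes_inv])

lemma perm_mem: "p permutes I \<Longrightarrow> i \<in> I \<Longrightarrow> p i \<in> I"
  by (rule permutes_mem)

lemma wreath_coord: "y \<in> carrier W \<Longrightarrow> i \<in> I \<Longrightarrow> fst y i \<in> carrier G"
  by (auto simp: wreath_carrier)

lemma wreath_perm: "y \<in> carrier W \<Longrightarrow> snd y permutes I"
  by (simp add: wreath_carrier)

lemma wreath_group: "group W"
proof (rule groupI)
  fix y z assume y: "y \<in> carrier W" and z: "z \<in> carrier W"
  then show "y \<otimes>\<^bsub>W\<^esub> z \<in> carrier W"
    using wreath_coord[OF y] wreath_coord[OF z] perm_inv_mem[OF wreath_perm[OF y]]
    by (auto simp: wreath_mult wreath_carrier intro!: permutes_compose)
next
  show "\<one>\<^bsub>W\<^esub> \<in> carrier W" by (simp add: wreath_one wreath_carrier permutes_id)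
next
  fix x y z assume xyz: "x \<in> carrier W" "y \<in> carrier W" "z \<in> carrier W"
  have b: "bij (snd x)" "bij (snd y)" using xyz by (auto simp: wreath_carrier permutes_bij)
  have "fst x i \<otimes> fst y (inv_into UNIV (snd x) i) \<otimes> fst z (inv_into UNIV (snd x \<circ> snd y) i) =
    fst x i \<otimes> (fst y (inv_into UNIV (snd x) i) \<otimes>
      fst z (inv_into UNIV (snd y) (inv_into UNIV (snd x) i)))" if i: "i \<in> I" for i
  proof -
    have "inv_into UNIV (snd x) i \<in> I"
      by (rule perm_inv_mem[OF wreath_perm[OF xyz(1)] i])
    moreover from this have "inv_into UNIV (snd y) (inv_into UNIV (snd x) i) \<in> I"
      by (rule perm_inv_mem[OF wreath_perm[OF xyz(2)]])
    moreover have "inv_into UNIV (snd x \<circ> snd y) i = inv_into UNIV (snd y) (inv_into UNIV (snd x) i)"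
      using o_inv_distrib[OF b] by (simp add: fun_eq_iff)
    ultimately show ?thesis using i xyz wreath_coord by (simp add: m_assoc)
  qed
  then show "x \<otimes>\<^bsub>W\<^esub> y \<otimes>\<^bsub>W\<^esub> z = x \<otimes>\<^bsub>W\<^esub> (y \<otimes>\<^bsub>W\<^esub> z)"
    using perm_inv_mem[OF wreath_perm[OF xyz(1)]]
    by (auto simp: wreath_mult o_assoc restrict_def fun_eq_iff)
next
  fix x assume x: "x \<in> carrier W"
  show "\<one>\<^bsub>W\<^esub> \<otimes>\<^bsub>W\<^esub> x = x"
    using wreath_coord[OF x] x
    by (auto simp: wreath_mult wreath_one wreath_carrier restrict_def PiE_def extensional_def fun_eq_iff
        intro!: prod_eqI)
next
  fix x assume x: "x \<in> carrier W"
  define p where "p = snd x"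
  have p: "p permutes I" using x by (simp add: p_def wreath_carrier)
  define y where "y = (\<lambda>i\<in>I. inv (fst x (p i)), inv_into UNIV p)"
  have "y \<in> carrier W"
    using wreath_coord[OF x] perm_mem[OF p] permutes_inv[OF p]
    by (auto simp: y_def wreath_carrier)
  moreover have "y \<otimes>\<^bsub>W\<^esub> x = \<one>\<^bsub>W\<^esub>"
    using wreath_coord[OF x] perm_mem[OF p] permutes_inv_o(2)[OF p] permutes_inv_inv[OF p]
    by (auto simp: y_def wreath_mult wreath_one restrict_def fun_eq_iff p_def)
  ultimately show "\<exists>y\<in>carrier W. y \<otimes>\<^bsub>W\<^esub> x = \<one>\<^bsub>W\<^esub>" by blast
qed

lemma finite_wreath: "finite (carrier W)"
proof -
  have "carrier W = (I \<rightarrow>\<^sub>E carrier G) \<times> {p. p permutes I}"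
    by (rule Set.set_eqI) (simp only: wreath_carrier mem_Times_iff mem_Collect_eq)
  then show ?thesis using finG by (simp add: finite_PiE finite_permutations)
qed

section \<open>The monomial representation on functions of words\<close>

definition phase :: "(nat \<Rightarrow> 'g) \<Rightarrow> (nat \<Rightarrow> 'g \<times> 'r) \<Rightarrow> complex" where
  "phase x w = (\<Prod>i\<in>I. chr (fst (w i)) (x i))"

text \<open>Precomposition with \<open>snd y\<close> and not with its inverse: permutations act on
  words from the right, so they act on functions of words from the left.\<close>

definition act :: "(nat \<Rightarrow> 'g) \<times> (nat \<Rightarrow> nat) \<Rightarrow> ((nat \<Rightarrow> 'g \<times> 'r) \<Rightarrow> complex)
    \<Rightarrow> (nat \<Rightarrow> 'g \<times> 'r) \<Rightarrow> complex" where
  "act y v = (\<lambda>w. phase (fst y) w * v (w \<circ> snd y))"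

definition opr :: "((nat \<Rightarrow> 'g) \<times> (nat \<Rightarrow> nat) \<Rightarrow> complex) \<Rightarrow> ((nat \<Rightarrow> 'g \<times> 'r) \<Rightarrow> complex)
    \<Rightarrow> (nat \<Rightarrow> 'g \<times> 'r) \<Rightarrow> complex" where
  "opr c v = (\<lambda>w. \<Sum>y\<in>carrier W. c y * act y v w)"

definition kills :: "((nat \<Rightarrow> 'g) \<times> (nat \<Rightarrow> nat) \<Rightarrow> complex) \<Rightarrow> ('g \<times> 'r \<Rightarrow> nat) \<Rightarrow> bool" where
  "kills c \<tau> \<longleftrightarrow> (\<forall>v\<in>wt_space I \<tau>. opr c v = 0)"

lemma phase_perm:
  assumes "p permutes I"
  shows "phase x (w \<circ> p) = (\<Prod>i\<in>I. chr (fst (w i)) (x (inv_into UNIV p i)))"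
  unfolding phase_def
  by (subst prod.permute[OF permutes_inv[OF assms]])
    (simp add: permutes_inverses(1)[OF assms])

text \<open>The cocycle identity of \<open>phase\<close>: permuting the word by \<open>snd y\<close>
  before the phase of \<open>z\<close> is taken accounts exactly for the twist in the product of
  \<open>W\<close>.\<close>

lemma act_mult:
  fixes v :: "(nat \<Rightarrow> 'g \<times> 'r) \<Rightarrow> complex"
  assumes "y \<in> carrier W" "z \<in> carrier W"
  shows "act (y \<otimes>\<^bsub>W\<^esub> z) v = act y (act z v)"
proof
  fix w :: "nat \<Rightarrow> 'g \<times> 'r"
  have p: "snd y permutes I" using assms by (simp add: wreath_carrier)
  have "phase (fst (y \<otimes>\<^bsub>W\<^esub> z)) w = phase (fst y) w * phase (fst z) (w \<circ> snd y)"
    unfolding phase_perm[OF p] unfolding phase_def prod.distrib[symmetric]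
    using wreath_coord[OF assms(1)] wreath_coord[OF assms(2) perm_inv_mem[OF p]]
    by (intro prod.cong refl) (simp add: wreath_mult chr_mult)
  then show "act (y \<otimes>\<^bsub>W\<^esub> z) v w = act y (act z v) w"
    by (simp add: act_def wreath_mult o_assoc)
qed

lemma act_one: "act \<one>\<^bsub>W\<^esub> v = v"
  by (simp add: act_def wreath_one phase_def chr_one fun_eq_iff)

lemma act_add: "act y (u + v) = act y u + act y v"
  by (auto simp: act_def algebra_simps)

lemma act_fscale: "act y (fscale a v) = fscale a (act y v)"
  by (auto simp: act_def fscale_def)

lemma opr_add: "opr c (u + v) = opr c u + opr c v"
  by (auto simp: opr_def act_add algebra_simps sum.distrib)

lemma opr_fscale: "opr c (fscale a v) = fscale a (opr c v)"
  by (rule ext, simp only: opr_def act_fscale, simp add: fscale_def sum_distrib_left mult_ac)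

lemma opr_0: "opr c 0 = 0"
  by (auto simp: opr_def act_def)

lemma opr_span_eq_0:
  assumes "\<And>v. v \<in> S \<Longrightarrow> opr c v = 0" "v \<in> cfun.span S"
  shows "opr c v = 0"
proof -
  have "cfun.subspace {v. opr c v = 0}"
    by (intro cfun.subspaceI CollectI)
      (simp_all only: opr_0 opr_add opr_fscale cfun.scale_zero_right add_0_left mem_Collect_eq)
  then show ?thesis
    using cfun.span_minimal[of S "{v. opr c v = 0}"] assms by blast
qed

lemma act_wt_space: "y \<in> carrier W \<Longrightarrow> v \<in> wt_space I \<tau> \<Longrightarrow> act y v \<in> wt_space I \<tau>"
  by (simp add: wt_space_def act_def wreath_carrier words_perm)

lemma opr_wt_space: "v \<in> wt_space I \<tau> \<Longrightarrow> opr c v \<in> wt_space I \<tau>"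
  unfolding opr_def using act_wt_space[of _ v \<tau>] by (simp add: wt_space_def)

lemma norm_phase: "x \<in> I \<rightarrow>\<^sub>E carrier G \<Longrightarrow> phase x w * cnj (phase x w) = 1"
  using chr_cnj by (auto simp: phase_def cnj_prod prod.distrib[symmetric] intro!: prod.neutral)

lemma ip_act_act:
  assumes "y \<in> carrier W" "\<And>w p. p permutes I \<Longrightarrow> w \<circ> p \<in> S \<longleftrightarrow> w \<in> S"
  shows "ip S (act y u) (act y v) = ip S u v"
proof -
  have p: "snd y permutes I" using assms by (simp add: wreath_carrier)
  have "ip S (act y u) (act y v) = (\<Sum>w\<in>S. u (w \<circ> snd y) * cnj (v (w \<circ> snd y)))"
    unfolding ip_def
  proof (rule sum.cong[OF refl])
    fix w
    have "act y u w * cnj (act y v w) =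
        (phase (fst y) w * cnj (phase (fst y) w)) * (u (w \<circ> snd y) * cnj (v (w \<circ> snd y)))"
      by (simp add: act_def)
    then show "act y u w * cnj (act y v w) = u (w \<circ> snd y) * cnj (v (w \<circ> snd y))"
      using norm_phase[of "fst y" w] assms(1) by (simp add: wreath_carrier)
  qed
  also have "\<dots> = ip S u v"
    unfolding ip_def
    by (rule sum.reindex_bij_witness[where i = "\<lambda>w. w \<circ> inv_into UNIV (snd y)" and j = "\<lambda>w. w \<circ> snd y"])
      (use assms(2)[OF p] assms(2)[OF permutes_inv[OF p]] permutes_inv_o[OF p] in \<open>auto simp: comp_assoc\<close>)
  finally show ?thesis .
qed

text \<open>The star involution of the group algebra. As the action is unitary, it corresponds to
  the adjoint operator; see \<open>ip_opr\<close>.\<close>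

definition adj :: "((nat \<Rightarrow> 'g) \<times> (nat \<Rightarrow> nat) \<Rightarrow> complex) \<Rightarrow> (nat \<Rightarrow> 'g) \<times> (nat \<Rightarrow> nat) \<Rightarrow> complex" where
  "adj c y = cnj (c (inv\<^bsub>W\<^esub> y))"

lemma ip_opr:
  assumes "\<And>w p. p permutes I \<Longrightarrow> w \<circ> p \<in> S \<longleftrightarrow> w \<in> S"
  shows "ip S (opr c u) v = ip S u (opr (adj c) v)"
proof -
  interpret W: group W by (rule wreath_group)
  have "ip S (opr c u) v = (\<Sum>y\<in>carrier W. c y * ip S (act y u) v)"
    unfolding ip_def opr_def sum_distrib_left sum_distrib_right
    by (subst sum.swap) (simp add: mult.assoc)
  also have "\<dots> = (\<Sum>y\<in>carrier W. c y * ip S u (act (inv\<^bsub>W\<^esub> y) v))"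
  proof (rule sum.cong[OF refl])
    fix y assume y: "y \<in> carrier W"
    then have "v = act y (act (inv\<^bsub>W\<^esub> y) v)"
      using act_mult[of y "inv\<^bsub>W\<^esub> y" v] by (simp add: act_one)
    then show "c y * ip S (act y u) v = c y * ip S u (act (inv\<^bsub>W\<^esub> y) v)"
      using ip_act_act[OF y assms, of u "act (inv\<^bsub>W\<^esub> y) v"] by simp
  qed
  also have "\<dots> = (\<Sum>y\<in>carrier W. c (inv\<^bsub>W\<^esub> y) * ip S u (act y v))"
    by (rule sum.reindex_bij_witness[where i = "\<lambda>y. inv\<^bsub>W\<^esub> y" and j = "\<lambda>y. inv\<^bsub>W\<^esub> y"]) auto
  also have "\<dots> = ip S u (opr (adj c) v)"
    unfolding ip_def opr_def adj_def sum_distrib_left cnj_sum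
    by (subst sum.swap) (simp add: mult_ac)
  finally show ?thesis .
qed

lemma adj_adj: "opr (adj (adj c)) v = opr c v"
proof -
  interpret W: group W by (rule wreath_group)
  show ?thesis by (auto simp: opr_def adj_def intro!: sum.cong)
qed

text \<open>For \<open>u = opr (adj c) v\<close> the squared norm of \<open>u\<close> is the inner
  product of \<open>v\<close> with \<open>opr c u\<close>, and \<open>u\<close> lies again in the
  weight space, where \<open>c\<close> acts as 0.\<close>

lemma kills_adj:
  assumes "kills c \<tau>" shows "kills (adj c) \<tau>"
  unfolding kills_def
proof
  fix v assume v: "v \<in> wt_space I \<tau>"
  let ?u = "opr (adj c) v"
  have u: "?u \<in> wt_space I \<tau>" using v by (rule opr_wt_space)
  have "ip (words I \<tau>) ?u ?u = ip (words I \<tau>) v (opr c ?u)"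
    using ip_opr[of "words I \<tau>" "adj c" v ?u] words_perm adj_adj by metis
  also have "\<dots> = 0" using assms u by (simp add: kills_def ip_def)
  finally have "\<forall>w\<in>words I \<tau>. ?u w = 0" by (subst (asm) ip_self_eq_0_iff) (simp_all add: finite_words)
  then show "?u = 0" using u by (auto simp: wt_space_def fun_eq_iff)
qed

text \<open>Replacing a letter by one of the same colour leaves \<open>phase\<close> unchanged, and
  the permutation only renames the positions summed over. This is where the equality of colours
  enters.\<close>

lemma shift_act:
  fixes v :: "(nat \<Rightarrow> 'g \<times> 'r) \<Rightarrow> complex"
  assumes "y \<in> carrier W" "fst l = fst l'"
  shows "shift I l l' (act y v) = act y (shift I l l' v)"
proof
  fix w :: "nat \<Rightarrow> 'g \<times> 'r"
  have p: "snd y permutes I" using assms by (simp add: wreath_carrier)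
  have "shift I l l' (act y v) w = (\<Sum>b | b \<in> I \<and> w b = l. phase (fst y) w * v ((w(b := l')) \<circ> snd y))"
    unfolding shift_def
  proof (rule sum.cong[OF refl])
    fix b assume b: "b \<in> {b. b \<in> I \<and> w b = l}"
    have "fst ((w(b := l')) i) = fst (w i)" for i using b assms(2) by auto
    then show "act y v (w(b := l')) = phase (fst y) w * v ((w(b := l')) \<circ> snd y)"
      by (simp add: act_def phase_def)
  qed
  also have "\<dots> = phase (fst y) w * (\<Sum>b | b \<in> I \<and> w b = l. v ((w(b := l')) \<circ> snd y))"
    by (simp add: sum_distrib_left)
  also have "(\<Sum>b | b \<in> I \<and> w b = l. v ((w(b := l')) \<circ> snd y)) =
      (\<Sum>a | a \<in> I \<and> (w \<circ> snd y) a = l. v ((w \<circ> snd y)(a := l')))"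
  proof (rule sum.reindex_bij_witness[where i = "snd y" and j = "inv_into UNIV (snd y)"])
    fix b assume b: "b \<in> {b. b \<in> I \<and> w b = l}"
    show "snd y (inv_into UNIV (snd y) b) = b" by (rule permutes_inverses(1)[OF p])
    then show "inv_into UNIV (snd y) b \<in> {a. a \<in> I \<and> (w \<circ> snd y) a = l}"
      using b perm_inv_mem[OF p] by auto
    have "(w \<circ> snd y)(inv_into UNIV (snd y) b := l') = w(b := l') \<circ> snd y"
      using permutes_inverses[OF p] by (auto simp: fun_eq_iff)
    then show "v ((w \<circ> snd y)(inv_into UNIV (snd y) b := l')) = v (w(b := l') \<circ> snd y)" by (simp only:)
  next
    fix a assume a: "a \<in> {a. a \<in> I \<and> (w \<circ> snd y) a = l}"
    show "inv_into UNIV (snd y) (snd y a) = a" by (rule permutes_inverses(2)[OF p])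
    show "snd y a \<in> {b. b \<in> I \<and> w b = l}" using a perm_mem[OF p] by auto
  qed
  finally show "shift I l l' (act y v) w = act y (shift I l l' v) w"
    by (simp add: act_def shift_def)
qed

lemma shift_opr:
  assumes "fst l = fst l'"
  shows "shift I l l' (opr c v) = opr c (shift I l l' v)"
proof
  fix w
  have "shift I l l' (opr c v) w = (\<Sum>y\<in>carrier W. c y * shift I l l' (act y v) w)"
    unfolding shift_def opr_def sum_distrib_left by (rule sum.swap)
  then show "shift I l l' (opr c v) w = opr c (shift I l l' v) w"
    using assms by (simp add: shift_act opr_def)
qed

text \<open>\<open>shift I l' l\<close> embeds the weight space of \<open>\<tau>\<close> into one
  killed by \<open>c\<close>, and it commutes with \<open>c\<close>. The target trades one
  occurrence of the more frequent letter for the rarer one, so killing passes up the dominance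
  order.\<close>

lemma kills_up:
  assumes "l \<noteq> l'" "fst l = fst l'" "\<tau> l' < \<tau> l"
    and "kills c (\<tau>(l' := Suc (\<tau> l'), l := \<tau> l - 1))"
  shows "kills c \<tau>"
  unfolding kills_def
proof
  fix v assume v: "v \<in> wt_space I \<tau>"
  have "shift I l' l v \<in> wt_space I (\<tau>(l' := Suc (\<tau> l'), l := \<tau> l - 1))"
    using assms(1) v by (intro shift_wt_space) auto
  then have "opr c (shift I l' l v) = 0" using assms(4) by (simp add: kills_def)
  then have "shift I l' l (opr c v) = (\<lambda>w. 0)"
    using shift_opr[of l' l c v] assms(2) by (simp add: zero_fun_def)
  then show "opr c v = 0"
    using shift_inj[OF _ assms(1) opr_wt_space[OF v] assms(3)] by (simp add: zero_fun_def)
qed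

lemma shift_wt_zero:
  assumes "v \<in> wt_space I \<tau>" "\<tau> l' = 0"
  shows "shift I l l' v = 0"
proof -
  have "v (w(a := l')) = 0" if "a \<in> I" for w a
  proof -
    have "wcount I (w(a := l')) l' \<noteq> 0" using wcount_pos[of I a "w(a := l')"] that by simp
    then have "w(a := l') \<notin> words I \<tau>" using assms(2) by (auto simp: words_def)
    then show ?thesis using assms(1) by (simp add: wt_space_def)
  qed
  then show ?thesis by (auto simp: shift_def fun_eq_iff)
qed

text \<open>For \<open>u\<close> of weight \<open>\<tau>\<close>, the vector \<open>h = c\<^sup>* u\<close> is highest weight as \<open>c\<^sup>*\<close> kills its raisings;
  hence \<open>c h = 0\<close> and \<open>h = 0\<close>.\<close>

lemma kills_down:
  assumes hw: "\<And>v. v \<in> HW C I \<tau> \<Longrightarrow> opr c v = 0"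
    and up: "\<And>g i. g \<in> C \<Longrightarrow> \<tau> (g, Suc i) \<noteq> 0 \<Longrightarrow>
      kills c (\<tau>((g, i) := Suc (\<tau> (g, i)), (g, Suc i) := \<tau> (g, Suc i) - 1))"
  shows "kills c \<tau>"
proof -
  have "kills (adj c) \<tau>"
    unfolding kills_def
  proof
    fix u assume u: "u \<in> wt_space I \<tau>"
    let ?h = "opr (adj c) u"
    have h: "?h \<in> wt_space I \<tau>" using u by (rule opr_wt_space)
    have "shift I (g, i) (g, Suc i) ?h = 0" if g: "g \<in> C" for g i
    proof (cases "\<tau> (g, Suc i) = 0")
      case True
      then show ?thesis using h by (intro shift_wt_zero)
    next
      case False
      have "shift I (g, i) (g, Suc i) u \<in>
          wt_space I (\<tau>((g, i) := Suc (\<tau> (g, i)), (g, Suc i) := \<tau> (g, Suc i) - 1))"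
        using u by (intro shift_wt_space) auto
      then have "opr (adj c) (shift I (g, i) (g, Suc i) u) = 0"
        using kills_adj[OF up[OF g False]] by (simp add: kills_def)
      then show ?thesis by (simp add: shift_opr)
    qed
    then have "?h \<in> HW C I \<tau>" using h by (simp add: HW_def zero_fun_def)
    then have "opr c ?h = 0" by (rule hw)
    moreover have "ip (words I \<tau>) ?h ?h = ip (words I \<tau>) u (opr c ?h)"
      using ip_opr[of "words I \<tau>" "adj c" u ?h] words_perm adj_adj by metis
    ultimately have "ip (words I \<tau>) ?h ?h = 0" by (simp add: ip_def)
    then have "\<forall>w\<in>words I \<tau>. ?h w = 0" by (subst (asm) ip_self_eq_0_iff) (simp_all add: finite_words)
    then show "?h = 0" using h by (auto simp: wt_space_def fun_eq_iff)
  qed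
  then have "kills (adj (adj c)) \<tau>" by (rule kills_adj)
  then show ?thesis by (simp add: kills_def adj_adj)
qed

text \<open>Renaming letters along a bijection of the supports that keeps colours is an equivariant
  isomorphism of weight spaces, because \<open>phase\<close> sees only colours. The two alphabets
  may have different types of rows.\<close>

lemma kills_transport:
  assumes h: "bij_betw h {l. \<tau> l \<noteq> 0} {l. \<tau>' l \<noteq> 0}"
    and fst_h: "\<And>l. \<tau> l \<noteq> 0 \<Longrightarrow> fst (h l) = fst l"
    and \<tau>': "\<And>l. \<tau> l \<noteq> 0 \<Longrightarrow> \<tau>' (h l) = \<tau> l"
    and kills: "kills c \<tau>'"
  shows "kills c \<tau>"
  unfolding kills_def
proof
  fix v assume v: "v \<in> wt_space I \<tau>"
  define k where "k = inv_into {l. \<tau> l \<noteq> 0} h"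
  \<comment> \<open>The inverse renaming \<open>k\<close> is meaningful only on letters of the
    support, so \<open>v'\<close> is set to 0 off the words of content
    \<open>\<tau>'\<close>.\<close>
  define v' where "v' = (\<lambda>u. if u \<in> words I \<tau>' then v (compose I k u) else 0)"
  have supp: "\<tau> (w i) \<noteq> 0" if "w \<in> words I \<tau>" "i \<in> I" for w i
    using words_support[OF finite_I that(1)] that(2) by blast
  have mem: "compose I h w \<in> words I \<tau>'" and inv: "compose I k (compose I h w) = w"
    if w: "w \<in> words I \<tau>" for w
  proof -
    have "wcount I (compose I h w) l = \<tau>' l" for l
    proof (cases "\<tau>' l = 0")
      case True
      have "{i\<in>I. compose I h w i = l} = {}"
      proof -
        have "compose I h w i \<noteq> l" if "i \<in> I" for i
        proof -
          have "w i \<in> {l. \<tau> l \<noteq> 0}" using supp[OF w that] by simp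
          then have "h (w i) \<in> {l. \<tau>' l \<noteq> 0}" by (rule bspec[OF bij_betwE[OF h]])
          then show ?thesis using True that by (auto simp: compose_eq)
        qed
        then show ?thesis by blast
      qed
      then show ?thesis using True by (simp only: wcount_def card.empty)
    next
      case False
      then have "l \<in> h ` {l. \<tau> l \<noteq> 0}" unfolding bij_betw_imp_surj_on[OF h] by simp
      then obtain l0 where l0: "\<tau> l0 \<noteq> 0" "h l0 = l" by auto
      have "compose I h w i = l \<longleftrightarrow> w i = l0" if "i \<in> I" for i
        using inj_on_eq_iff[OF bij_betw_imp_inj_on[OF h], of "w i" l0] supp[OF w that] l0 that
        by (simp add: compose_eq)
      then have "{i\<in>I. compose I h w i = l} = {i\<in>I. w i = l0}" by (simp only: cong: conj_cong)
      then have "wcount I (compose I h w) l = wcount I w l0" by (simp only: wcount_def)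
      then show ?thesis using w \<tau>'[OF l0(1)] l0(2) by (simp add: words_def)
    qed
    then show "compose I h w \<in> words I \<tau>'" by (auto simp: words_def)
    have "k (h (w i)) = w i" if "i \<in> I" for i
      using bij_betw_inv_into_left[OF h] supp[OF w that] by (simp add: k_def)
    then show "compose I k (compose I h w) = w"
      using w by (intro extensionalityI[of _ I]) (auto simp: compose_def words_def)
  qed
  have "v' \<in> wt_space I \<tau>'" by (simp add: v'_def wt_space_def)
  then have zero: "opr c v' = 0" using kills by (simp add: kills_def)
  have "opr c v w = 0" if w: "w \<in> words I \<tau>" for w
  proof -
    have "act y v w = act y v' (compose I h w)" if y: "y \<in> carrier W" for y
    proof -
      have p: "snd y permutes I" using y by (simp add: wreath_carrier)
      have "compose I h w \<circ> snd y = compose I h (w \<circ> snd y)"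
        using permutes_in_image[OF p] by (auto simp: compose_def)
      moreover have "w \<circ> snd y \<in> words I \<tau>" using w words_perm[OF p] by blast
      moreover have "phase (fst y) (compose I h w) = phase (fst y) w"
        unfolding phase_def using supp[OF w] fst_h
        by (intro prod.cong refl) (simp add: compose_eq)
      ultimately show ?thesis
        using mem[of "w \<circ> snd y"] inv[of "w \<circ> snd y"] by (simp add: act_def v'_def)
    qed
    then have "opr c v w = opr c v' (compose I h w)" by (simp add: opr_def)
    then show ?thesis using zero by simp
  qed
  then show "opr c v = 0" using opr_wt_space[OF v, of c] by (auto simp: wt_space_def fun_eq_iff)
qed

end

section \<open>Orthonormal bases and traces\<close>

lemma ip_add_left: "ip X (f + g) h = ip X f h + ip X g h"
  by (simp add: ip_def algebra_simps sum.distrib)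

lemma ip_minus_left: "ip X (f - g) h = ip X f h - ip X g h"
  by (simp add: ip_def algebra_simps sum_subtractf)

lemma ip_fscale_left: "ip X (fscale c f) h = c * ip X f h"
  by (simp add: ip_def fscale_def sum_distrib_left mult.assoc)

lemma ip_fscale_right: "ip X f (fscale c h) = cnj c * ip X f h"
  by (simp add: ip_def fscale_def sum_distrib_left mult_ac)

lemma ip_0_left: "ip X 0 h = 0"
  by (simp add: ip_def)

lemma ip_sum_left: "ip X (\<Sum>i\<in>J. f i) h = (\<Sum>i\<in>J. ip X (f i) h)"
  by (induction J rule: infinite_finite_induct)
    (simp_all only: ip_0_left ip_add_left sum.infinite sum.empty sum.insert not_False_eq_True)

lemma ip_cnj: "cnj (ip X f g) = ip X g f"
  by (simp add: ip_def mult.commute)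

definition orthonormal :: "'x set \<Rightarrow> ('x \<Rightarrow> complex) set \<Rightarrow> bool" where
  "orthonormal X B \<longleftrightarrow> finite B \<and> (\<forall>b\<in>B. \<forall>b'\<in>B. ip X b b' = (if b = b' then 1 else 0))"

lemma ip_orthonormal_combination:
  assumes "orthonormal X B" "b \<in> B"
  shows "ip X (\<Sum>b'\<in>B. fscale (u b') b') b = u b"
proof -
  have "ip X (\<Sum>b'\<in>B. fscale (u b') b') b = (\<Sum>b'\<in>B. if b' = b then u b' else 0)"
    unfolding ip_sum_left ip_fscale_left
    using assms by (intro sum.cong refl) (simp add: orthonormal_def)
  also have "\<dots> = u b" using assms by (subst sum.delta) (auto simp: orthonormal_def)
  finally show ?thesis .
qed

lemma orthonormal_expansion:
  assumes "orthonormal X B" "f \<in> cfun.span B"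
  shows "f = (\<Sum>b\<in>B. fscale (ip X f b) b)"
proof -
  have "finite B" using assms by (simp add: orthonormal_def)
  then obtain u where u: "f = (\<Sum>b\<in>B. fscale (u b) b)"
    using assms(2) by (auto simp only: cfun.span_finite)
  then have "ip X f b = u b" if "b \<in> B" for b
    using ip_orthonormal_combination[OF assms(1) that] by simp
  then show ?thesis using u by (metis (no_types, lifting) sum.cong)
qed

text \<open>Gram-Schmidt. Since all the functions vanish off \<open>X\<close>, the form
  \<open>ip X\<close> is definite on their span, so a nonzero remainder can be normalised.\<close>

lemma orthonormal_basis_exists:
  assumes "finite S" "finite X" "\<And>f x. f \<in> S \<Longrightarrow> x \<notin> X \<Longrightarrow> f x = 0"
  shows "\<exists>B. orthonormal X B \<and> cfun.span B = cfun.span S"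
  using assms(1,3)
proof (induction S rule: finite_induct)
  case empty
  show ?case by (intro exI[of _ "{}"]) (simp add: orthonormal_def)
next
  case (insert f S)
  then obtain B where B: "orthonormal X B" "cfun.span B = cfun.span S" by blast
  define s where "s = (\<Sum>b\<in>B. fscale (ip X f b) b)"
  define r where "r = f - s"
  have f: "f = r + s" by (simp add: r_def)
  have sB: "s \<in> cfun.span B"
    unfolding s_def by (intro cfun.span_sum cfun.span_scale cfun.span_base)
  have span_f: "cfun.span (insert f S) = cfun.span (insert r B)"
  proof (rule cfun.span_eq[THEN iffD2], intro conjI subsetI)
    fix x assume "x \<in> insert f S"
    moreover have "f \<in> cfun.span (insert r B)"
      unfolding f using sB cfun.span_mono[of B "insert r B"] cfun.span_base[of r "insert r B"]
      by (intro cfun.span_add) auto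
    moreover have "x \<in> cfun.span (insert r B)" if "x \<in> S"
      using cfun.span_base[OF that] B(2) cfun.span_mono[of B "insert r B"] by auto
    ultimately show "x \<in> cfun.span (insert r B)" by blast
  next
    fix x assume "x \<in> insert r B"
    moreover have "r \<in> cfun.span (insert f S)"
      unfolding r_def using sB B(2) cfun.span_mono[of S "insert f S"] cfun.span_base[of f "insert f S"]
      by (intro cfun.span_diff) auto
    moreover have "x \<in> cfun.span (insert f S)" if "x \<in> B"
      using cfun.span_base[OF that] B(2) cfun.span_mono[of S "insert f S"] by auto
    ultimately show "x \<in> cfun.span (insert f S)" by blast
  qed
  have orth: "ip X r b = 0" if "b \<in> B" for b
    unfolding r_def ip_minus_left s_def ip_orthonormal_combination[OF B(1) that] by simp
  show ?case
  proof (cases "r = 0")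
    case True
    have "cfun.span (insert r B) = cfun.span B"
      unfolding True by (rule cfun.span_insert_0)
    then show ?thesis using B(1) span_f by (intro exI[of _ B]) simp
  next
    case False
    define N where "N = (\<Sum>x\<in>X. (cmod (r x))\<^sup>2)"
    have N: "ip X r r = of_real N" by (simp only: ip_self N_def)
    have "r x = 0" if x: "x \<notin> X" for x
    proof -
      have "cfun.subspace {g. g x = 0}" by (auto simp: cfun.subspace_def fscale_def)
      moreover have "S \<subseteq> {g. g x = 0}" using insert.prems x by auto
      ultimately have "cfun.span S \<subseteq> {g. g x = 0}" by (intro cfun.span_minimal)
      then have "s x = 0" using sB B(2) by auto
      then show ?thesis using insert.prems x by (simp add: r_def)
    qed
    then have "\<exists>x\<in>X. r x \<noteq> 0" using False by (auto simp: fun_eq_iff)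
    then have "ip X r r \<noteq> 0" using ip_self_eq_0_iff[OF assms(2)] by blast
    moreover have "N \<ge> 0" unfolding N_def by (intro sum_nonneg) auto
    ultimately have Npos: "N > 0" using N by auto
    define c where "c = complex_of_real (1 / sqrt N)"
    define b0 where "b0 = fscale c r"
    have c0: "c \<noteq> 0" using Npos by (simp add: c_def)
    have "ip X b0 b0 = complex_of_real (1 / sqrt N * (1 / sqrt N) * N)"
      by (simp only: b0_def ip_fscale_left ip_fscale_right N c_def complex_cnj_complex_of_real
          of_real_mult mult.assoc)
    also have "1 / sqrt N * (1 / sqrt N) * N = 1" using Npos by (simp add: field_simps)
    finally have b00: "ip X b0 b0 = 1" by simp
    have b0b: "ip X b0 b = 0" if "b \<in> B" for b
      unfolding b0_def ip_fscale_left orth[OF that] by simp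
    have bb0: "ip X b b0 = 0" if "b \<in> B" for b
      using ip_cnj[of X b0 b] b0b[OF that] by simp
    have "b0 \<notin> B" using b00 b0b by fastforce
    then have "orthonormal X (insert b0 B)"
      using B(1) b00 b0b bb0 by (auto simp: orthonormal_def)
    moreover have "cfun.span (insert b0 B) = cfun.span (insert r B)"
    proof (rule cfun.span_eq[THEN iffD2], intro conjI subsetI)
      fix x assume "x \<in> insert b0 B"
      then show "x \<in> cfun.span (insert r B)"
        unfolding b0_def by (auto intro: cfun.span_scale cfun.span_base)
    next
      fix x assume "x \<in> insert r B"
      moreover have "r = fscale (1 / c) b0"
        using c0 by (auto simp: b0_def fscale_def)
      then have "r \<in> cfun.span (insert b0 B)"
        using cfun.span_scale[OF cfun.span_base[of b0 "insert b0 B"], of "1 / c"] by simp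
      ultimately show "x \<in> cfun.span (insert b0 B)" by (auto intro: cfun.span_base)
    qed
    ultimately show ?thesis using span_f by (intro exI[of _ "insert b0 B"]) simp
  qed
qed

text \<open>Basis independence of the trace. For the basis \<open>D\<close> chosen in
  \<open>trace_on\<close>, \<open>F d\<close> is expanded in \<open>B\<close> and each
  \<open>b\<close> in \<open>D\<close>; the trace and the right-hand side both become the sum of
  \<open>ip X (F d) b\<close> times the coordinate of \<open>b\<close> at \<open>d\<close>.\<close>

lemma trace_on_orthonormal:
  assumes B: "orthonormal X B" and V: "cfun.span B = V"
    and add: "\<And>f g. F (f + g) = F f + F g" and scale: "\<And>c f. F (fscale c f) = fscale c (F f)"
    and inv: "\<And>f. f \<in> V \<Longrightarrow> F f \<in> V"
  shows "trace_on V F = (\<Sum>b\<in>B. ip X (F b) b)"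
proof -
  define D where "D = (SOME D. cfun.independent D \<and> cfun.span D = V)"
  have "\<exists>D. cfun.independent D \<and> cfun.span D = V"
    using cfun.maximal_independent_subset[of B] V
    by (metis cfun.span_eq cfun.span_superset subset_trans)
  then have "cfun.independent D \<and> cfun.span D = V" unfolding D_def by (rule someI_ex)
  then have D: "cfun.independent D" "cfun.span D = V" by auto
  have finB: "finite B" using B by (simp add: orthonormal_def)
  have finD: "finite D"
    using cfun.independent_span_bound[OF finB D(1)] V D(2) cfun.span_superset by blast
  have F0: "F 0 = 0" using scale[of 0 0] by (simp only: cfun.scale_zero_left)
  have Fsum: "F (\<Sum>i\<in>J. g i) = (\<Sum>i\<in>J. F (g i))" for g :: "('a \<Rightarrow> complex) \<Rightarrow> 'a \<Rightarrow> complex" and J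
    by (induction J rule: infinite_finite_induct)
      (simp_all only: F0 add sum.infinite sum.empty sum.insert not_False_eq_True)
  have DV: "d \<in> V" if "d \<in> D" for d using that D(2) cfun.span_base by blast
  have BV: "b \<in> V" if "b \<in> B" for b using that V cfun.span_base by blast
  let ?rep = "cfun.representation D"
  have rep: "?rep (F d) d = (\<Sum>b\<in>B. ip X (F d) b * ?rep b d)" if d: "d \<in> D" for d
  proof -
    have "F d = (\<Sum>b\<in>B. fscale (ip X (F d) b) b)"
      by (rule orthonormal_expansion[OF B]) (use inv[OF DV[OF d]] V in simp)
    then have "?rep (F d) d = ?rep (\<Sum>b\<in>B. fscale (ip X (F d) b) b) d" by simp
    also have "\<dots> = (\<Sum>b\<in>B. ?rep (fscale (ip X (F d) b) b) d)"
      using BV D(2) by (subst cfun.representation_sum[OF D(1)]) (auto intro: cfun.span_scale)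
    also have "\<dots> = (\<Sum>b\<in>B. ip X (F d) b * ?rep b d)"
      using BV D(2) by (intro sum.cong refl) (simp add: cfun.representation_scale[OF D(1)])
    finally show ?thesis .
  qed
  have "trace_on V F = (\<Sum>d\<in>D. ?rep (F d) d)"
    by (simp only: trace_on_def Let_def D_def)
  also have "\<dots> = (\<Sum>b\<in>B. \<Sum>d\<in>D. ip X (F d) b * ?rep b d)"
    using rep by (subst sum.swap) simp
  also have "\<dots> = (\<Sum>b\<in>B. ip X (F b) b)"
  proof (rule sum.cong[OF refl])
    fix b assume b: "b \<in> B"
    have "(\<Sum>d\<in>D. fscale (?rep b d) d) = b"
      by (rule cfun.sum_representation_eq[OF D(1)]) (use BV[OF b] D(2) finD in auto)
    then have "F b = (\<Sum>d\<in>D. fscale (?rep b d) (F d))"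
      using Fsum[of "\<lambda>d. fscale (?rep b d) d" D] by (simp only: scale)
    then have "ip X (F b) b = (\<Sum>d\<in>D. ?rep b d * ip X (F d) b)"
      by (simp only: ip_sum_left ip_fscale_left)
    then show "(\<Sum>d\<in>D. ip X (F d) b * ?rep b d) = ip X (F b) b" by (simp add: mult.commute)
  qed
  finally show ?thesis .
qed

section \<open>Specht modules in terms of words\<close>

text \<open>The tabloid in which the entry \<open>a\<close> lies in row \<open>u a\<close>.\<close>

definition tab :: "'a set \<Rightarrow> (nat \<Rightarrow> nat) \<Rightarrow> ('a \<Rightarrow> nat) \<Rightarrow> (nat \<times> nat \<Rightarrow> 'a) set" where
  "tab A p u = {t \<in> tableaux A p. \<forall>b\<in>diagram p. u (t b) = fst b}"

lemma tableaux_perm: "t \<in> tableaux A p \<Longrightarrow> q permutes diagram p \<Longrightarrow> t \<circ> q \<in> tableaux A p"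
  using permutes_not_in[of q "diagram p"]
  by (auto simp: tableaux_def extensional_def intro: bij_betw_trans[OF permutes_imp_bij])

lemma tab_cong: "(\<And>a. a \<in> A \<Longrightarrow> u a = u' a) \<Longrightarrow> tab A p u = tab A p u'"
  by (auto simp: tab_def tableaux_def bij_betw_def)

text \<open>The box permutation that sends \<open>b\<close> to the box of \<open>t\<close> holding
  \<open>t' b\<close> preserves rows when both tableaux have the row word \<open>u\<close>; so a row
  class is the same as a row word.\<close>

lemma tabloid_of_eq_tab:
  assumes t: "t \<in> tab A p u"
  shows "tabloid_of A p t = tab A p u"
proof (intro equalityI subsetI)
  fix t' assume "t' \<in> tabloid_of A p t"
  then obtain q where q: "q permutes diagram p" "\<forall>b\<in>diagram p. fst (q b) = fst b" "t' = t \<circ> q"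
    "t' \<in> tableaux A p"
    by (auto simp: tabloid_of_def row_equiv_def)
  then show "t' \<in> tab A p u"
    using t permutes_mem[OF q(1)] by (simp add: tab_def)
next
  fix t' assume t': "t' \<in> tab A p u"
  let ?D = "diagram p"
  have bij: "bij_betw t ?D A" "bij_betw t' ?D A" using t t' by (auto simp: tab_def tableaux_def)
  define q where "q = (\<lambda>b. if b \<in> ?D then inv_into ?D t (t' b) else b)"
  have "bij_betw (inv_into ?D t \<circ> t') ?D ?D"
    by (rule bij_betw_trans[OF bij(2) bij_betw_inv_into[OF bij(1)]])
  then have "bij_betw q ?D ?D"
    by (rule bij_betw_cong[THEN iffD1, rotated]) (simp add: q_def)
  then have q: "q permutes ?D" by (rule bij_imp_permutes) (simp add: q_def)
  have tq: "t (q b) = t' b" if "b \<in> ?D" for b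
    using bij_betw_inv_into_right[OF bij(1)] bij_betwE[OF bij(2)] that by (simp add: q_def)
  have "fst (q b) = fst b" if b: "b \<in> ?D" for b
  proof -
    have "fst (q b) = u (t (q b))" using t permutes_mem[OF q b] by (simp add: tab_def)
    also have "\<dots> = fst b" using t' b tq[OF b] by (simp add: tab_def)
    finally show ?thesis .
  qed
  moreover have "t' = t \<circ> q"
  proof
    fix b
    show "t' b = (t \<circ> q) b"
    proof (cases "b \<in> ?D")
      case True
      then show ?thesis using tq by simp
    next
      case False
      then have "t b = undefined" "t' b = undefined"
        using extensional_arb[of t ?D b] extensional_arb[of t' ?D b] t t'
        by (simp_all add: tab_def tableaux_def)
      then show ?thesis using False by (simp add: q_def)
    qed
  qed
  ultimately show "t' \<in> tabloid_of A p t"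
    using t t' q unfolding tabloid_of_def row_equiv_def tab_def by blast
qed

lemma tabloid_of_self: "t \<in> tableaux A p \<Longrightarrow> t \<in> tabloid_of A p t"
  using permutes_id by (force simp: tabloid_of_def row_equiv_def intro!: exI[of _ id])

lemma polytabloid_tab:
  assumes "t \<in> tableaux A p"
  shows "polytabloid A p t (tab A p u) = pt p t u"
  unfolding polytabloid_def pt_def colperms_def[symmetric]
proof (rule sum.cong[OF refl])
  fix q assume "q \<in> colperms p"
  then have tq: "t \<circ> q \<in> tableaux A p" using assms by (auto simp: colperms_def intro: tableaux_perm)
  have "tabloid_of A p (t \<circ> q) = tab A p u \<longleftrightarrow> t \<circ> q \<in> tab A p u"
    using tabloid_of_eq_tab[of "t \<circ> q" A p u] tabloid_of_self[OF tq] by blast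
  also have "\<dots> \<longleftrightarrow> (\<forall>b\<in>diagram p. u (t (q b)) = fst b)"
    using tq by (simp add: tab_def)
  finally show "(if tabloid_of A p (t \<circ> q) = tab A p u then complex_of_int (sign q) else 0) =
      (if \<forall>b\<in>diagram p. u (t (q b)) = fst b then of_int (sign q) else 0)" by simp
qed

lemma words_of_tab:
  assumes "t \<in> tab A p u" "u \<in> extensional A"
  shows "u \<in> words A p"
proof -
  have bij: "bij_betw t (diagram p) A" using assms by (auto simp: tab_def tableaux_def)
  have "wcount A u i = p i" for i
  proof -
    have "t ` {b \<in> diagram p. fst b = i} = {a\<in>A. u a = i}"
      using assms(1) bij_betw_imp_surj_on[OF bij] by (auto simp: tab_def image_iff)
    moreover have "inj_on t {b \<in> diagram p. fst b = i}"
      using bij_betw_imp_inj_on[OF bij] by (rule inj_on_subset) auto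
    ultimately have "card {a\<in>A. u a = i} = card {b \<in> diagram p. fst b = i}"
      using card_image[of t "{b \<in> diagram p. fst b = i}"] by simp
    then show ?thesis by (simp only: wcount_def card_diagram_row)
  qed
  then show ?thesis using assms(2) by (auto simp: words_def)
qed

lemma tab_nonempty:
  assumes "finite A" "p \<in> Par" "u \<in> words A p"
  shows "tab A p u \<noteq> {}"
proof -
  have "card {b\<in>diagram p. fst b = i} = card {a\<in>A. u a = i}" for i
    using assms(3) card_diagram_row[of p i] by (auto simp: words_def wcount_def)
  from fibre_bij[OF finite_diagram[OF assms(2)] assms(1) this]
  obtain h where h: "bij_betw h (diagram p) A" "\<And>b. b \<in> diagram p \<Longrightarrow> u (h b) = fst b"
    by blast
  have "bij_betw (restrict h (diagram p)) (diagram p) A"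
    using h(1) by (rule bij_betw_cong[THEN iffD1, rotated]) simp
  then have "restrict h (diagram p) \<in> tab A p u"
    using h(2) by (simp add: tab_def tableaux_def)
  then show ?thesis by blast
qed

text \<open>Tabloids of shape \<open>p\<close> become words of content \<open>p\<close> whose
  letters are row indices. Through this bijection Specht modules turn into spaces of functions of
  words.\<close>

lemma tab_bij:
  assumes "finite A" "p \<in> Par"
  shows "bij_betw (tab A p) (words A p) (tabloids A p)"
proof (rule bij_betw_imageI)
  show "inj_on (tab A p) (words A p)"
  proof (rule inj_onI)
    fix u v assume u: "u \<in> words A p" and v: "v \<in> words A p" and e: "tab A p u = tab A p v"
    obtain t where t: "t \<in> tab A p u" using tab_nonempty[OF assms u] by blast
    then have "t \<in> tab A p v" using e by simp
    then have "u (t b) = v (t b)" if "b \<in> diagram p" for b using t that by (simp add: tab_def)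
    moreover have "t ` diagram p = A" using t by (simp add: tab_def tableaux_def bij_betw_def)
    ultimately show "u = v"
      using u v by (intro extensionalityI[of _ A]) (auto simp: words_def)
  qed
  show "tab A p ` words A p = tabloids A p"
  proof (intro equalityI subsetI)
    fix X assume "X \<in> tab A p ` words A p"
    then obtain u where u: "u \<in> words A p" "X = tab A p u" by blast
    then obtain t where t: "t \<in> tab A p u" using tab_nonempty[OF assms] by blast
    then have "X = tabloid_of A p t" using tabloid_of_eq_tab[OF t] u(2) by simp
    moreover have "t \<in> tableaux A p" using t by (simp add: tab_def)
    ultimately show "X \<in> tabloids A p" by (auto simp: tabloids_def tabloid_of_def quotient_def)
  next
    fix X assume "X \<in> tabloids A p"
    then obtain t where t: "t \<in> tableaux A p" "X = tabloid_of A p t"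
      by (auto simp: tabloids_def tabloid_of_def quotient_def)
    have bij: "bij_betw t (diagram p) A" using t by (simp add: tableaux_def)
    define u where "u = (\<lambda>a\<in>A. fst (inv_into (diagram p) t a))"
    have "t \<in> tab A p u"
      using t bij_betw_inv_into_left[OF bij] bij_betwE[OF bij] by (simp add: tab_def u_def)
    moreover from this have "u \<in> words A p"
      by (rule words_of_tab) (simp add: u_def)
    ultimately show "X \<in> tab A p ` words A p" using t tabloid_of_eq_tab by blast
  qed
qed

lemma polytabloid_support:
  assumes "t \<in> tableaux A p" "X \<notin> tabloids A p"
  shows "polytabloid A p t X = 0"
  unfolding polytabloid_def
proof (intro sum.neutral ballI)
  fix q assume "q \<in> {q. q permutes diagram p \<and> (\<forall>b\<in>diagram p. snd (q b) = snd b)}"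
  then have "t \<circ> q \<in> tableaux A p" using assms(1) by (auto intro: tableaux_perm)
  then have "tabloid_of A p (t \<circ> q) \<in> tabloids A p"
    by (auto simp: tabloids_def tabloid_of_def quotient_def)
  then show "(if tabloid_of A p (t \<circ> q) = X then complex_of_int (sign q) else 0) = 0"
    using assms(2) by auto
qed

lemma specht_support:
  assumes "f \<in> specht A p" "X \<notin> tabloids A p"
  shows "f X = 0"
proof -
  have "cfun.subspace {f. f X = 0}" by (auto simp: cfun.subspace_def fscale_def)
  moreover have "polytabloid A p ` tableaux A p \<subseteq> {f. f X = 0}"
    using polytabloid_support assms(2) by blast
  ultimately show ?thesis using assms(1) cfun.span_minimal unfolding specht_def by blast
qed

lemma compose_perm_tableaux:
  assumes "\<pi> permutes A" "t \<in> tableaux A p"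
  shows "compose (diagram p) \<pi> t \<in> tableaux A p"
proof -
  have "bij_betw (\<pi> \<circ> t) (diagram p) A"
    using assms by (auto simp: tableaux_def intro: bij_betw_trans permutes_imp_bij)
  then have "bij_betw (compose (diagram p) \<pi> t) (diagram p) A"
    by (rule bij_betw_cong[THEN iffD1, rotated]) (simp add: compose_def)
  then show ?thesis by (simp add: tableaux_def compose_def)
qed

lemma compose_perm_tab:
  assumes \<pi>: "\<pi> permutes A"
  shows "compose (diagram p) \<pi> ` tab A p (u \<circ> \<pi>) = tab A p u"
proof (intro equalityI subsetI)
  fix t assume "t \<in> compose (diagram p) \<pi> ` tab A p (u \<circ> \<pi>)"
  then show "t \<in> tab A p u"
    using compose_perm_tableaux[OF \<pi>] by (auto simp: tab_def compose_def)
next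
  fix t assume t: "t \<in> tab A p u"
  let ?t = "compose (diagram p) (inv_into UNIV \<pi>) t"
  have "?t \<in> tab A p (u \<circ> \<pi>)"
    using t compose_perm_tableaux[OF permutes_inv[OF \<pi>], of t p] permutes_inverses(1)[OF \<pi>]
    by (simp add: tab_def compose_def)
  moreover have "compose (diagram p) \<pi> ?t = t"
    using t permutes_inverses(1)[OF \<pi>]
    by (auto simp: tab_def tableaux_def extensional_def compose_def fun_eq_iff)
  ultimately show "t \<in> compose (diagram p) \<pi> ` tab A p (u \<circ> \<pi>)" by force
qed

text \<open>In terms of row words the action on tabloid vectors is precomposition with
  \<open>\<pi>\<close>, the same convention as in \<open>act\<close>.\<close>

lemma tabloid_vec_act_tab:
  assumes fin: "finite A" and p: "p \<in> Par" and \<pi>: "\<pi> permutes A" and u: "u \<in> words A p"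
  shows "tabloid_vec_act A p \<pi> f (tab A p u) = f (tab A p (u \<circ> \<pi>))"
proof -
  let ?Z = "tab A p (u \<circ> \<pi>)"
  have fint: "finite (tabloids A p)"
    using bij_betw_finite[OF tab_bij[OF fin p]] finite_words[OF fin] by blast
  have u\<pi>: "u \<circ> \<pi> \<in> words A p" using words_perm[OF \<pi>] u by blast
  have "compose (diagram p) \<pi> ` Z = tab A p u \<longleftrightarrow> Z = ?Z" if Z: "Z \<in> tabloids A p" for Z
  proof
    assume e: "compose (diagram p) \<pi> ` Z = tab A p u"
    obtain u' where u': "u' \<in> words A p" "Z = tab A p u'"
      using Z bij_betw_imp_surj_on[OF tab_bij[OF fin p]] by blast
    let ?v = "u' \<circ> inv_into UNIV \<pi>"
    have v: "?v \<in> words A p" using words_perm[OF permutes_inv[OF \<pi>]] u' by blast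
    have v\<pi>: "?v \<circ> \<pi> = u'" by (simp only: comp_assoc permutes_inv_o[OF \<pi>] comp_id)
    have "tab A p ?v = tab A p u" using compose_perm_tab[OF \<pi>, of p ?v] e u'(2) v\<pi> by simp
    then have "?v = u"
      using bij_betw_imp_inj_on[OF tab_bij[OF fin p]] u v by (auto dest: inj_onD)
    then show "Z = ?Z" using u'(2) v\<pi> by simp
  qed (simp add: compose_perm_tab[OF \<pi>])
  then have "tabloid_vec_act A p \<pi> f (tab A p u) =
      (\<Sum>Z\<in>tabloids A p. if Z = ?Z then f Z else 0)"
    unfolding tabloid_vec_act_def by (intro sum.cong) auto
  also have "\<dots> = f ?Z"
    using bij_betwE[OF tab_bij[OF fin p]] u\<pi> fint by (subst sum.delta) auto
  finally show ?thesis .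
qed

lemma tabloid_vec_act_support:
  assumes "finite A" "p \<in> Par" "\<pi> permutes A" "X \<notin> tabloids A p"
  shows "tabloid_vec_act A p \<pi> f X = 0"
  unfolding tabloid_vec_act_def
proof (intro sum.neutral ballI)
  fix Z assume "Z \<in> tabloids A p"
  then obtain u' where u': "u' \<in> words A p" "Z = tab A p u'"
    using bij_betw_imp_surj_on[OF tab_bij[OF assms(1,2)]] by blast
  let ?v = "u' \<circ> inv_into UNIV \<pi>"
  have v: "?v \<in> words A p" using words_perm[OF permutes_inv[OF assms(3)]] u' by blast
  have v\<pi>: "?v \<circ> \<pi> = u'" by (simp only: comp_assoc permutes_inv_o[OF assms(3)] comp_id)
  have "compose (diagram p) \<pi> ` Z = tab A p ?v"
    using compose_perm_tab[OF assms(3), of p ?v] v\<pi> u'(2) by simp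
  then have "compose (diagram p) \<pi> ` Z \<in> tabloids A p"
    using bij_betwE[OF tab_bij[OF assms(1,2)]] v by auto
  then show "(if compose (diagram p) \<pi> ` Z = X then f Z else 0) = 0" using assms(4) by auto
qed

lemma tabloid_vec_act_add:
  "tabloid_vec_act A p \<pi> (f + g) = tabloid_vec_act A p \<pi> f + tabloid_vec_act A p \<pi> g"
  by (rule ext) (auto simp: tabloid_vec_act_def sum.distrib[symmetric] intro!: sum.cong)

lemma tabloid_vec_act_fscale:
  "tabloid_vec_act A p \<pi> (fscale c f) = fscale c (tabloid_vec_act A p \<pi> f)"
  by (rule ext) (auto simp: tabloid_vec_act_def fscale_def sum_distrib_left intro!: sum.cong)

lemma tabloid_vec_act_polytabloid:
  assumes fin: "finite A" and p: "p \<in> Par" and \<pi>: "\<pi> permutes A" and t: "t \<in> tableaux A p"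
  shows "tabloid_vec_act A p \<pi> (polytabloid A p t) = polytabloid A p (compose (diagram p) \<pi> t)"
proof
  fix X
  show "tabloid_vec_act A p \<pi> (polytabloid A p t) X = polytabloid A p (compose (diagram p) \<pi> t) X"
  proof (cases "X \<in> tabloids A p")
    case True
    then obtain u where u: "u \<in> words A p" "X = tab A p u"
      using bij_betw_imp_surj_on[OF tab_bij[OF fin p]] by blast
    have "pt p t (u \<circ> \<pi>) = pt p (compose (diagram p) \<pi> t) u"
      by (rule pt_cong) (simp add: compose_def)
    then show ?thesis
      using tabloid_vec_act_tab[OF fin p \<pi> u(1)] u(2) polytabloid_tab[OF t]
        polytabloid_tab[OF compose_perm_tableaux[OF \<pi> t]] by simp
  next
    case False
    then show ?thesis
      using tabloid_vec_act_support[OF fin p \<pi>] polytabloid_support[OF compose_perm_tableaux[OF \<pi> t]]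
      by simp
  qed
qed

lemma specht_invariant:
  assumes "finite A" "p \<in> Par" "\<pi> permutes A" "f \<in> specht A p"
  shows "tabloid_vec_act A p \<pi> f \<in> specht A p"
proof -
  let ?F = "tabloid_vec_act A p \<pi>"
  have sub: "cfun.subspace (specht A p)" unfolding specht_def by (rule cfun.subspace_span)
  have "?F 0 = 0" by (rule ext) (simp add: tabloid_vec_act_def cong: if_cong)
  then have "cfun.subspace {f. ?F f \<in> specht A p}"
    using sub unfolding cfun.subspace_def
    by (simp only: mem_Collect_eq tabloid_vec_act_add tabloid_vec_act_fscale) blast
  moreover have "polytabloid A p ` tableaux A p \<subseteq> {f. ?F f \<in> specht A p}"
    using tabloid_vec_act_polytabloid[OF assms(1-3)] compose_perm_tableaux[OF assms(3)]
    unfolding specht_def by (auto intro!: cfun.span_base)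
  ultimately show ?thesis using assms(4) cfun.span_minimal unfolding specht_def by blast
qed

section \<open>Orthonormal bases and characters of Specht modules\<close>

definition onb :: "'a set \<Rightarrow> (nat \<Rightarrow> nat) \<Rightarrow> ((nat \<times> nat \<Rightarrow> 'a) set \<Rightarrow> complex) set" where
  "onb A p = (SOME B. orthonormal (tabloids A p) B \<and> cfun.span B = specht A p)"

lemma finite_tableaux:
  assumes "finite A" "p \<in> Par"
  shows "finite (tableaux A p)"
proof -
  have "tableaux A p \<subseteq> diagram p \<rightarrow>\<^sub>E A"
    by (auto simp: tableaux_def PiE_def bij_betw_def)
  moreover have "finite (diagram p \<rightarrow>\<^sub>E A)"
    using finite_diagram[OF assms(2)] assms(1) by (intro finite_PiE)
  ultimately show ?thesis by (rule finite_subset)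
qed

lemma finite_tabloids: "finite A \<Longrightarrow> p \<in> Par \<Longrightarrow> finite (tabloids A p)"
  using bij_betw_finite[OF tab_bij] finite_words by blast

lemma onb:
  assumes "finite A" "p \<in> Par"
  shows "orthonormal (tabloids A p) (onb A p)" "cfun.span (onb A p) = specht A p"
proof -
  have "\<exists>B. orthonormal (tabloids A p) B \<and> cfun.span B = specht A p"
    unfolding specht_def
    using finite_tableaux[OF assms] finite_tabloids[OF assms] polytabloid_support
    by (intro orthonormal_basis_exists) auto
  then have "orthonormal (tabloids A p) (onb A p) \<and> cfun.span (onb A p) = specht A p"
    unfolding onb_def by (rule someI_ex)
  then show "orthonormal (tabloids A p) (onb A p)" "cfun.span (onb A p) = specht A p" by auto
qed

lemma onb_specht: "finite A \<Longrightarrow> p \<in> Par \<Longrightarrow> b \<in> onb A p \<Longrightarrow> b \<in> specht A p"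
  using onb(2) cfun.span_base by blast

text \<open>The trace as a sum of diagonal matrix coefficients in an orthonormal basis. A sum over
  words is the form that multiplies out over blocks of positions.\<close>

lemma sym_char_eq:
  assumes "finite A" "p \<in> Par" "\<pi> permutes A"
  shows "sym_char A p \<pi> =
    (\<Sum>b\<in>onb A p. \<Sum>u\<in>words A p. b (tab A p (u \<circ> \<pi>)) * cnj (b (tab A p u)))"
proof -
  have "sym_char A p \<pi> = (\<Sum>b\<in>onb A p. ip (tabloids A p) (tabloid_vec_act A p \<pi> b) b)"
    unfolding sym_char_def
    using onb[OF assms(1,2)] specht_invariant[OF assms]
    by (intro trace_on_orthonormal) (auto simp: tabloid_vec_act_add tabloid_vec_act_fscale)
  also have "\<dots> = (\<Sum>b\<in>onb A p. \<Sum>u\<in>words A p. tabloid_vec_act A p \<pi> b (tab A p u) * cnj (b (tab A p u)))"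
    unfolding ip_def
    by (intro sum.cong refl sum.reindex_bij_betw[OF tab_bij[OF assms(1,2)], symmetric])
  also have "\<dots> = (\<Sum>b\<in>onb A p. \<Sum>u\<in>words A p. b (tab A p (u \<circ> \<pi>)) * cnj (b (tab A p u)))"
    using tabloid_vec_act_tab[OF assms] by (intro sum.cong refl) simp
  finally show ?thesis .
qed

text \<open>Exchanging the entries of two boxes of one column amounts to composing each column
  permutation on the left with the transposition of the boxes, which reverses all signs.\<close>

lemma pt_transpose:
  assumes p: "p \<in> Par" and t: "t \<in> tableaux A p"
    and b: "b0 \<in> diagram p" "b1 \<in> diagram p" "snd b0 = snd b1" "b0 \<noteq> b1"
  shows "pt p t (u \<circ> transpose (t b0) (t b1)) = - pt p t u"
proof -
  let ?s = "transpose b0 b1"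
  have inj: "inj_on t (diagram p)" using t by (simp add: tableaux_def bij_betw_def)
  have ts: "transpose (t b0) (t b1) (t c) = t (?s c)" if "c \<in> diagram p" for c
    using inj b that by (auto simp: transpose_def inj_on_def)
  have inv2: "?s \<circ> (?s \<circ> f) = f" for f :: "nat \<times> nat \<Rightarrow> nat \<times> nat"
    by (simp add: comp_assoc[symmetric])
  have "pt p t (u \<circ> transpose (t b0) (t b1)) = (\<Sum>q\<in>colperms p.
      if \<forall>b\<in>diagram p. u (t ((?s \<circ> q) b)) = fst b then of_int (sign q) else 0)"
    unfolding pt_def
  proof (rule sum.cong[OF refl])
    fix q assume "q \<in> colperms p"
    then have "q b \<in> diagram p" if "b \<in> diagram p" for b
      using that permutes_mem by (auto simp: colperms_def)
    then show "(if \<forall>b\<in>diagram p. (u \<circ> transpose (t b0) (t b1)) (t (q b)) = fst b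
        then complex_of_int (sign q) else 0) =
      (if \<forall>b\<in>diagram p. u (t ((?s \<circ> q) b)) = fst b then of_int (sign q) else 0)"
      by (simp add: ts cong: ball_cong)
  qed
  also have "\<dots> = (\<Sum>q\<in>colperms p.
      if \<forall>b\<in>diagram p. u (t (q b)) = fst b then of_int (sign (?s \<circ> q)) else 0)"
    by (rule sum.reindex_bij_witness[where i = "\<lambda>q. ?s \<circ> q" and j = "\<lambda>q. ?s \<circ> q"])
      (simp_all only: inv2 colperms_swap(2)[OF b(1-3)])
  also have "\<dots> = (\<Sum>q\<in>colperms p.
      - (if \<forall>b\<in>diagram p. u (t (q b)) = fst b then of_int (sign q) else 0))"
    using sign_swap(2)[OF p _ b(4)] by (intro sum.cong refl) simp
  also have "\<dots> = - pt p t u" by (simp add: pt_def sum_negf)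
  finally show ?thesis .
qed

text \<open>A transposition within a column changes the sign of a polytabloid.\<close>

lemma specht_symmetrization:
  assumes fin: "finite A" and p: "p \<in> Par" and p1: "p 1 \<noteq> 0" and f: "f \<in> specht A p"
  shows "(\<Sum>\<pi> | \<pi> permutes A. f (tab A p (u \<circ> \<pi>))) = 0"
proof -
  let ?V = "{f. (\<Sum>\<pi> | \<pi> permutes A. f (tab A p (u \<circ> \<pi>))) = 0}"
  have "cfun.subspace ?V"
    by (auto simp: cfun.subspace_def fscale_def sum.distrib sum_distrib_left[symmetric])
  moreover have "polytabloid A p ` tableaux A p \<subseteq> ?V"
  proof (rule image_subsetI)
    fix t assume t: "t \<in> tableaux A p"
    have "p 1 \<le> p 0" using p by (auto simp: Par_def antimono_def)
    \<comment> \<open>A second row provides two boxes in the first column.\<close>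
    then have b: "(1, 0) \<in> diagram p" "(0, 0) \<in> diagram p"
      using p1 by (auto simp: diagram_def)
    let ?s = "transpose (t (1, 0)) (t (0, 0))"
    have "t (1, 0) \<in> A" "t (0, 0) \<in> A"
      using t b bij_betwE[of t "diagram p" A] by (auto simp: tableaux_def)
    then have s: "?s permutes A" by (intro permutes_swap_id)
    have inv2: "(f \<circ> ?s) \<circ> ?s = f" for f :: "'a \<Rightarrow> 'a" by (simp add: comp_assoc)
    let ?S = "\<Sum>\<pi> | \<pi> permutes A. pt p t (u \<circ> \<pi>)"
    \<comment> \<open>Composing \<open>\<pi>\<close> with the transposition permutes the summands,
      and by antisymmetry it negates each of them.\<close>
    have "?S = (\<Sum>\<pi> | \<pi> permutes A. pt p t (u \<circ> (\<pi> \<circ> ?s)))"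
      by (rule sum.reindex_bij_witness[where i = "\<lambda>q. q \<circ> ?s" and j = "\<lambda>q. q \<circ> ?s"])
        (simp_all only: inv2 mem_Collect_eq permutes_compose[OF s])
    also have "\<dots> = - ?S"
      using pt_transpose[OF p t b] by (simp add: comp_assoc[symmetric] sum_negf)
    finally have "?S = 0" by simp
    then show "polytabloid A p t \<in> ?V" by (simp add: polytabloid_tab[OF t])
  qed
  ultimately show ?thesis using f cfun.span_minimal unfolding specht_def by blast
qed

section \<open>The dual distribution as a sum of squared norms\<close>

lemma perm_restrict_permutes:
  assumes "inj p" "p ` A = A"
  shows "perm_restrict p A permutes A"
proof (rule bij_imp_permutes)
  have "bij_betw p A A"
    using assms by (auto simp: bij_betw_def intro: inj_on_subset)
  then show "bij_betw (perm_restrict p A) A A"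
    by (rule bij_betw_cong[THEN iffD1, rotated]) (simp add: perm_restrict_def)
qed (simp add: perm_restrict_def)

context wreath_characters
begin

text \<open>Elements of \<open>Lambda G n\<close> are undefined off the carrier; the value 0 there
  makes the content a function with finite support.\<close>

definition content :: "('g \<Rightarrow> nat \<Rightarrow> nat) \<Rightarrow> 'g \<times> nat \<Rightarrow> nat" where
  "content l = (\<lambda>(g, i). if g \<in> carrier G then l g i else 0)"

text \<open>A tensor of vectors of the Specht modules of the blocks, extended by 0 to words whose
  colours do not match the blocks. The translates of such vectors under the wreath product span a
  model of the induced module.\<close>

definition tensor :: "('g \<Rightarrow> nat set) \<Rightarrow> ('g \<Rightarrow> nat \<Rightarrow> nat)
    \<Rightarrow> ('g \<Rightarrow> (nat \<times> nat \<Rightarrow> nat) set \<Rightarrow> complex) \<Rightarrow> (nat \<Rightarrow> 'g \<times> nat) \<Rightarrow> complex" where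
  "tensor P l b w = (if w \<in> extensional I \<and> (\<forall>g\<in>carrier G. \<forall>i\<in>P g. fst (w i) = g)
     then \<Prod>g\<in>carrier G. b g (tab (P g) (l g) (\<lambda>i. snd (w i))) else 0)"

definition onbs :: "('g \<Rightarrow> nat set) \<Rightarrow> ('g \<Rightarrow> nat \<Rightarrow> nat)
    \<Rightarrow> ('g \<Rightarrow> (nat \<times> nat \<Rightarrow> nat) set \<Rightarrow> complex) set" where
  "onbs P l = (\<Pi>\<^sub>E g\<in>carrier G. onb (P g) (l g))"

lemma Lambda_Par: "l \<in> Lambda G n \<Longrightarrow> g \<in> carrier G \<Longrightarrow> l g \<in> Par"
  by (auto simp: Lambda_def)

context
  fixes l :: "'g \<Rightarrow> nat \<Rightarrow> nat" and P :: "'g \<Rightarrow> nat set"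
  assumes l: "l \<in> Lambda G n" and P: "blocks_for G n l P"
begin

lemma P_subset: "g \<in> carrier G \<Longrightarrow> P g \<subseteq> I"
  using P by (auto simp: blocks_for_def I_def)

lemma finite_P: "g \<in> carrier G \<Longrightarrow> finite (P g)"
  using P_subset finite_subset finite_I by metis

lemma P_cover: "i \<in> I \<Longrightarrow> \<exists>g\<in>carrier G. i \<in> P g"
  using P by (auto simp: blocks_for_def I_def)

lemma P_disjoint: "g \<in> carrier G \<Longrightarrow> h \<in> carrier G \<Longrightarrow> i \<in> P g \<Longrightarrow> i \<in> P h \<Longrightarrow> g = h"
  using P by (auto simp: blocks_for_def disjoint_family_on_def)

lemma l_Par: "g \<in> carrier G \<Longrightarrow> l g \<in> Par"
  using l by (rule Lambda_Par)

lemma finite_onbs: "finite (onbs P l)"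
  unfolding onbs_def using onb(1)[OF finite_P l_Par] finG
  by (intro finite_PiE) (auto simp: orthonormal_def)

lemma onbs_specht: "b \<in> onbs P l \<Longrightarrow> g \<in> carrier G \<Longrightarrow> b g \<in> specht (P g) (l g)"
  unfolding onbs_def by (rule onb_specht[OF finite_P l_Par]) (auto dest: PiE_mem)

lemma block_letters:
  assumes "\<forall>g\<in>carrier G. \<forall>i\<in>P g. fst (w i) = g" "g \<in> carrier G"
  shows "{i\<in>I. w i = (g, k)} = {i\<in>P g. snd (w i) = k}"
proof (intro equalityI subsetI)
  fix i assume i: "i \<in> {i\<in>I. w i = (g, k)}"
  then obtain h where h: "h \<in> carrier G" "i \<in> P h" using P_cover by blast
  then have "h = g" using assms(1) i by fastforce
  then show "i \<in> {i\<in>P g. snd (w i) = k}" using h i by simp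
next
  fix i assume "i \<in> {i\<in>P g. snd (w i) = k}"
  then show "i \<in> {i\<in>I. w i = (g, k)}" using assms P_subset by (auto simp: prod_eq_iff)
qed

lemma words_content_iff:
  assumes "w \<in> extensional I" "\<forall>g\<in>carrier G. \<forall>i\<in>P g. fst (w i) = g"
  shows "w \<in> words I (content l) \<longleftrightarrow>
    (\<forall>g\<in>carrier G. restrict (\<lambda>i. snd (w i)) (P g) \<in> words (P g) (l g))"
proof -
  have in_C: "wcount I w (g, k) = wcount (P g) (restrict (\<lambda>i. snd (w i)) (P g)) k" if g: "g \<in> carrier G" for g k
  proof -
    have "{i\<in>P g. restrict (\<lambda>i. snd (w i)) (P g) i = k} = {i\<in>P g. snd (w i) = k}" by auto
    then show ?thesis unfolding wcount_def block_letters[OF assms(2) g] by (simp only:)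
  qed
  have out_C: "wcount I w (g, k) = 0" if g: "g \<notin> carrier G" for g k
  proof -
    have "w i \<noteq> (g, k)" if "i \<in> I" for i
    proof -
      obtain h where "h \<in> carrier G" "i \<in> P h" using P_cover \<open>i \<in> I\<close> by blast
      then have "fst (w i) \<in> carrier G" using assms(2) by simp
      then show ?thesis using g by auto
    qed
    then have "{i\<in>I. w i = (g, k)} = {}" by blast
    then show ?thesis by (simp only: wcount_def card.empty)
  qed
  have "w \<in> words I (content l) \<longleftrightarrow> (\<forall>g k. wcount I w (g, k) = content l (g, k))"
    using assms(1) by (auto simp: words_def fun_eq_iff)
  also have "\<dots> \<longleftrightarrow> (\<forall>g\<in>carrier G. \<forall>k. wcount (P g) (restrict (\<lambda>i. snd (w i)) (P g)) k = l g k)"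
    using in_C out_C by (auto simp: content_def)
  also have "\<dots> \<longleftrightarrow> (\<forall>g\<in>carrier G. restrict (\<lambda>i. snd (w i)) (P g) \<in> words (P g) (l g))"
    by (auto simp: words_def fun_eq_iff)
  finally show ?thesis .
qed

lemma tensor_wt_space:
  assumes b: "b \<in> onbs P l"
  shows "tensor P l b \<in> wt_space I (content l)"
proof -
  have "w \<in> words I (content l)" if nz: "tensor P l b w \<noteq> 0" for w
  proof -
    have w: "w \<in> extensional I" "\<forall>g\<in>carrier G. \<forall>i\<in>P g. fst (w i) = g"
      using nz by (auto simp: tensor_def split: if_splits)
    have "restrict (\<lambda>i. snd (w i)) (P g) \<in> words (P g) (l g)" if g: "g \<in> carrier G" for g
    proof -
      have "b g (tab (P g) (l g) (\<lambda>i. snd (w i))) \<noteq> 0"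
        using nz w g finG by (auto simp: tensor_def)
      then have "tab (P g) (l g) (\<lambda>i. snd (w i)) \<in> tabloids (P g) (l g)"
        using specht_support[OF onbs_specht[OF b g]] by blast
      then obtain u where u: "u \<in> words (P g) (l g)" "tab (P g) (l g) (\<lambda>i. snd (w i)) = tab (P g) (l g) u"
        using bij_betw_imp_surj_on[OF tab_bij[OF finite_P[OF g] l_Par[OF g]]] by (metis imageE)
      then obtain t where "t \<in> tab (P g) (l g) (\<lambda>i. snd (w i))"
        using tab_nonempty[OF finite_P[OF g] l_Par[OF g] u(1)] by auto
      also have "tab (P g) (l g) (\<lambda>i. snd (w i)) = tab (P g) (l g) (restrict (\<lambda>i. snd (w i)) (P g))"
        by (rule tab_cong) simp
      finally show ?thesis by (rule words_of_tab) simp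
    qed
    then show ?thesis using words_content_iff[OF w] by blast
  qed
  then show ?thesis by (auto simp: wt_space_def)
qed

lemma inertia_iff:
  assumes "h \<in> carrier W"
  shows "h \<in> inertia G n P \<longleftrightarrow> (\<forall>g\<in>carrier G. snd h ` P g = P g)"
  using assms by (cases h) (simp add: inertia_def)

text \<open>At a word where both values are nonzero, the colours force \<open>snd h\<close> to map
  each block into itself. So outside the inertia group the supports are disjoint, and the
  restriction in the sum defining an induced character can later be dropped.\<close>

lemma ip_tensor_outside_inertia:
  assumes "h \<in> carrier W" "h \<notin> inertia G n P"
  shows "ip S (act h (tensor P l b)) (tensor P l b) = 0"
  unfolding ip_def
proof (intro sum.neutral ballI)
  fix w
  have p: "snd h permutes I" by (rule wreath_perm[OF assms(1)])
  show "act h (tensor P l b) w * cnj (tensor P l b w) = 0"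
  proof (rule ccontr)
    assume "act h (tensor P l b) w * cnj (tensor P l b w) \<noteq> 0"
    then have "tensor P l b (w \<circ> snd h) \<noteq> 0" "tensor P l b w \<noteq> 0"
      by (auto simp: act_def)
    then have 1: "\<And>g i. g \<in> carrier G \<Longrightarrow> i \<in> P g \<Longrightarrow> fst (w (snd h i)) = g"
      and 2: "\<And>g i. g \<in> carrier G \<Longrightarrow> i \<in> P g \<Longrightarrow> fst (w i) = g"
      by (auto simp: tensor_def split: if_splits)
    have "snd h ` P g = P g" if g: "g \<in> carrier G" for g
    proof (rule card_subset_eq[OF finite_P[OF g]])
      show "snd h ` P g \<subseteq> P g"
      proof (rule image_subsetI)
        fix i assume i: "i \<in> P g"
        then have "snd h i \<in> I" using P_subset[OF g] perm_mem[OF p] by blast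
        then obtain k where k: "k \<in> carrier G" "snd h i \<in> P k" using P_cover by blast
        then have "k = g" using 1[OF g i] 2[OF k] by simp
        then show "snd h i \<in> P g" using k by simp
      qed
      show "card (snd h ` P g) = card (P g)"
        using permutes_inj[OF p] by (intro card_image) (auto intro: inj_on_subset)
    qed
    then show False using assms inertia_iff by blast
  qed
qed

text \<open>On words coloured according to the blocks the phase is constant, and such a word is a
  free choice of one row word for each block, so the sum over words factors.\<close>

lemma ip_tensor_inertia:
  assumes h: "h \<in> carrier W" "h \<in> inertia G n P" and b: "b \<in> onbs P l"
  shows "ip (words I (content l)) (act h (tensor P l b)) (tensor P l b) =
    (\<Prod>g\<in>carrier G. (\<Prod>i\<in>P g. \<theta> g (fst h i)) *
      (\<Sum>u\<in>words (P g) (l g). b g (tab (P g) (l g) (u \<circ> perm_restrict (snd h) (P g))) *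
        cnj (b g (tab (P g) (l g) u))))"
proof -
  let ?S = "words I (content l)"
  define M where "M = {w \<in> ?S. \<forall>g\<in>carrier G. \<forall>i\<in>P g. fst (w i) = g}"
  define \<rho> where "\<rho> = (\<lambda>w :: nat \<Rightarrow> 'g \<times> nat. \<lambda>g\<in>carrier G. restrict (\<lambda>i. snd (w i)) (P g))"
  define F where "F = (\<lambda>g u. b g (tab (P g) (l g) (u \<circ> perm_restrict (snd h) (P g))) *
        cnj (b g (tab (P g) (l g) u)))"
  define ph where "ph = (\<Prod>g\<in>carrier G. \<Prod>i\<in>P g. \<theta> g (fst h i))"
  have stab: "snd h i \<in> P g" if "g \<in> carrier G" "i \<in> P g" for g i
    using inertia_iff[OF h(1)] h(2) that by blast
  have bij: "bij_betw \<rho> M (\<Pi>\<^sub>E g\<in>carrier G. words (P g) (l g))"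
  proof (rule bij_betw_imageI)
    show "inj_on \<rho> M"
    proof (rule inj_onI)
      fix w v assume w: "w \<in> M" and v: "v \<in> M" and e: "\<rho> w = \<rho> v"
      show "w = v"
      proof (rule extensionalityI[of _ I])
        show "w \<in> extensional I" "v \<in> extensional I" using w v by (auto simp: M_def words_def)
        fix i assume "i \<in> I"
        then obtain g where g: "g \<in> carrier G" "i \<in> P g" using P_cover by blast
        from fun_cong[OF fun_cong[OF e, of g], of i] have "snd (w i) = snd (v i)"
          using g by (simp add: \<rho>_def)
        moreover have "fst (w i) = fst (v i)" using w v g by (simp add: M_def)
        ultimately show "w i = v i" by (rule prod_eqI[rotated])
      qed
    qed
    show "\<rho> ` M = (\<Pi>\<^sub>E g\<in>carrier G. words (P g) (l g))"
    proof (intro equalityI subsetI)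
      fix r assume "r \<in> \<rho> ` M"
      then obtain w where w: "w \<in> M" "r = \<rho> w" by blast
      then have "w \<in> extensional I" "\<forall>g\<in>carrier G. \<forall>i\<in>P g. fst (w i) = g" "w \<in> ?S"
        by (auto simp: M_def words_def)
      then show "r \<in> (\<Pi>\<^sub>E g\<in>carrier G. words (P g) (l g))"
        using words_content_iff w(2) by (simp add: \<rho>_def)
    next
      fix r assume r: "r \<in> (\<Pi>\<^sub>E g\<in>carrier G. words (P g) (l g))"
      define \<kappa> where "\<kappa> = (\<lambda>i. THE g. g \<in> carrier G \<and> i \<in> P g)"
      have \<kappa>: "\<kappa> i = g" if "g \<in> carrier G" "i \<in> P g" for g i
        unfolding \<kappa>_def using that P_disjoint by (intro the_equality) auto
      define w where "w = (\<lambda>i\<in>I. (\<kappa> i, r (\<kappa> i) i))"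
      have wi: "w i = (g, r g i)" if "g \<in> carrier G" "i \<in> P g" for g i
        using that \<kappa>[OF that] P_subset by (auto simp: w_def)
      have res: "restrict (\<lambda>i. snd (w i)) (P g) = r g" if g: "g \<in> carrier G" for g
      proof (rule extensionalityI[of _ "P g"])
        show "r g \<in> extensional (P g)" using PiE_mem[OF r g] by (simp add: words_def)
      qed (simp_all add: wi[OF g])
      have w1: "w \<in> extensional I" "\<forall>g\<in>carrier G. \<forall>i\<in>P g. fst (w i) = g"
        using wi by (simp_all add: w_def)
      have "w \<in> ?S" unfolding words_content_iff[OF w1] using res PiE_mem[OF r] by simp
      then have "w \<in> M" using w1 by (simp add: M_def)
      moreover have "\<rho> w = r"
        using res r by (intro extensionalityI[of _ "carrier G"]) (auto simp: \<rho>_def PiE_iff)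
      ultimately show "r \<in> \<rho> ` M" by blast
    qed
  qed
  have phase: "phase (fst h) w = ph" if w: "w \<in> M" for w
  proof -
    have "phase (fst h) w = (\<Prod>i\<in>(\<Union>g\<in>carrier G. P g). chr (fst (w i)) (fst h i))"
      unfolding phase_def using P by (simp add: blocks_for_def I_def)
    also have "\<dots> = (\<Prod>g\<in>carrier G. \<Prod>i\<in>P g. chr (fst (w i)) (fst h i))"
      using finG finite_P P_disjoint by (intro prod.UNION_disjoint) auto
    also have "\<dots> = ph"
      unfolding ph_def using w by (intro prod.cong refl) (simp add: M_def chr_def)
    finally show ?thesis .
  qed
  have summand: "act h (tensor P l b) w * cnj (tensor P l b w) = ph * (\<Prod>g\<in>carrier G. F g (\<rho> w g))"
    if w: "w \<in> M" for w
  proof -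
    have w1: "w \<in> extensional I" "\<forall>g\<in>carrier G. \<forall>i\<in>P g. fst (w i) = g"
      using w by (auto simp: M_def words_def)
    have "w \<circ> snd h \<in> extensional I"
      using w1(1) extensional_perm[OF wreath_perm[OF h(1)]] by blast
    then have "tensor P l b (w \<circ> snd h) = (\<Prod>g\<in>carrier G. b g (tab (P g) (l g) (\<lambda>i. snd (w (snd h i)))))"
      using w1 stab by (simp add: tensor_def)
    also have "\<dots> = (\<Prod>g\<in>carrier G. b g (tab (P g) (l g) (\<rho> w g \<circ> perm_restrict (snd h) (P g))))"
    proof (intro prod.cong refl)
      fix g assume g: "g \<in> carrier G"
      have "tab (P g) (l g) (\<lambda>i. snd (w (snd h i))) = tab (P g) (l g) (\<rho> w g \<circ> perm_restrict (snd h) (P g))"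
        using g stab by (intro tab_cong) (simp add: \<rho>_def perm_restrict_def)
      then show "b g (tab (P g) (l g) (\<lambda>i. snd (w (snd h i)))) =
          b g (tab (P g) (l g) (\<rho> w g \<circ> perm_restrict (snd h) (P g)))" by simp
    qed
    finally have 1: "tensor P l b (w \<circ> snd h) =
        (\<Prod>g\<in>carrier G. b g (tab (P g) (l g) (\<rho> w g \<circ> perm_restrict (snd h) (P g))))" .
    have "tensor P l b w = (\<Prod>g\<in>carrier G. b g (tab (P g) (l g) (\<lambda>i. snd (w i))))"
      using w1 by (simp add: tensor_def)
    also have "\<dots> = (\<Prod>g\<in>carrier G. b g (tab (P g) (l g) (\<rho> w g)))"
    proof (intro prod.cong refl)
      fix g assume g: "g \<in> carrier G"
      have "tab (P g) (l g) (\<lambda>i. snd (w i)) = tab (P g) (l g) (\<rho> w g)"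
        using g by (intro tab_cong) (simp add: \<rho>_def)
      then show "b g (tab (P g) (l g) (\<lambda>i. snd (w i))) = b g (tab (P g) (l g) (\<rho> w g))" by simp
    qed
    finally have 2: "tensor P l b w = (\<Prod>g\<in>carrier G. b g (tab (P g) (l g) (\<rho> w g)))" .
    show ?thesis
      unfolding act_def 1 2 phase[OF w] F_def by (simp add: prod.distrib cnj_prod)
  qed
  have "ip ?S (act h (tensor P l b)) (tensor P l b) =
      (\<Sum>w\<in>M. act h (tensor P l b) w * cnj (tensor P l b w))"
    unfolding ip_def
    by (rule sum.mono_neutral_right) (auto simp: M_def tensor_def finite_words)
  also have "\<dots> = (\<Sum>w\<in>M. ph * (\<Prod>g\<in>carrier G. F g (\<rho> w g)))"
    by (intro sum.cong refl summand)
  also have "\<dots> = (\<Sum>r\<in>(\<Pi>\<^sub>E g\<in>carrier G. words (P g) (l g)). ph * (\<Prod>g\<in>carrier G. F g (r g)))"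
    by (rule sum.reindex_bij_betw[OF bij])
  also have "\<dots> = ph * (\<Prod>g\<in>carrier G. \<Sum>u\<in>words (P g) (l g). F g u)"
    using finG finite_P by (subst prod_sum_PiE) (auto simp: finite_words sum_distrib_left)
  also have "\<dots> = (\<Prod>g\<in>carrier G. (\<Prod>i\<in>P g. \<theta> g (fst h i)) * (\<Sum>u\<in>words (P g) (l g). F g u))"
    by (simp add: ph_def prod.distrib)
  finally show ?thesis by (simp only: F_def)
qed

text \<open>Multiplying out the product of traces over the blocks yields a sum over the choices of
  one basis vector for each block, that is, over \<open>onbs P l\<close>.\<close>

lemma inertia_char_eq:
  assumes h: "h \<in> carrier W" "h \<in> inertia G n P"
  shows "inertia_char G \<theta> P l h =
    (\<Sum>b\<in>onbs P l. ip (words I (content l)) (act h (tensor P l b)) (tensor P l b))"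
proof -
  have "inertia_char G \<theta> P l h =
      (\<Prod>g\<in>carrier G. (\<Prod>i\<in>P g. \<theta> g (fst h i)) * sym_char (P g) (l g) (perm_restrict (snd h) (P g)))"
    by (cases h) (simp add: inertia_char_def)
  also have "\<dots> = (\<Prod>g\<in>carrier G. \<Sum>b\<in>onb (P g) (l g). (\<Prod>i\<in>P g. \<theta> g (fst h i)) *
      (\<Sum>u\<in>words (P g) (l g). b (tab (P g) (l g) (u \<circ> perm_restrict (snd h) (P g))) *
        cnj (b (tab (P g) (l g) u))))"
  proof (intro prod.cong refl)
    fix g assume g: "g \<in> carrier G"
    have "perm_restrict (snd h) (P g) permutes P g"
      using perm_restrict_permutes[OF permutes_inj[OF wreath_perm[OF h(1)]]] inertia_iff[OF h(1)] h(2) g by blast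
    then show "(\<Prod>i\<in>P g. \<theta> g (fst h i)) * sym_char (P g) (l g) (perm_restrict (snd h) (P g)) =
      (\<Sum>b\<in>onb (P g) (l g). (\<Prod>i\<in>P g. \<theta> g (fst h i)) *
      (\<Sum>u\<in>words (P g) (l g). b (tab (P g) (l g) (u \<circ> perm_restrict (snd h) (P g))) *
        cnj (b (tab (P g) (l g) u))))"
      by (simp only: sym_char_eq[OF finite_P[OF g] l_Par[OF g]] sum_distrib_left)
  qed
  also have "\<dots> = (\<Sum>b\<in>onbs P l. \<Prod>g\<in>carrier G. (\<Prod>i\<in>P g. \<theta> g (fst h i)) *
      (\<Sum>u\<in>words (P g) (l g). b g (tab (P g) (l g) (u \<circ> perm_restrict (snd h) (P g))) *
        cnj (b g (tab (P g) (l g) u))))"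
    unfolding onbs_def using finG onb(1)[OF finite_P l_Par]
    by (subst prod_sum_PiE) (auto simp: orthonormal_def)
  also have "\<dots> = (\<Sum>b\<in>onbs P l. ip (words I (content l)) (act h (tensor P l b)) (tensor P l b))"
    by (intro sum.cong refl ip_tensor_inertia[OF h, symmetric])
  finally show ?thesis .
qed

text \<open>The induced character sums over those \<open>w\<close> that conjugate \<open>x\<close>
  into the inertia group. The other \<open>w\<close> contribute 0 to the right-hand side, and
  unitarity moves the conjugation from the operator to the vector.\<close>

lemma wreath_char_eq:
  assumes x: "x \<in> carrier W"
  shows "wreath_char G n \<theta> P l x = (\<Sum>w\<in>carrier W. \<Sum>b\<in>onbs P l.
    ip (words I (content l)) (act x (act w (tensor P l b))) (act w (tensor P l b))) /
    of_nat (card (inertia G n P))"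
proof -
  interpret W: group W by (rule wreath_group)
  let ?S = "words I (content l)"
  let ?c = "\<lambda>w. inv\<^bsub>W\<^esub> w \<otimes>\<^bsub>W\<^esub> x \<otimes>\<^bsub>W\<^esub> w"
  let ?f = "\<lambda>w. \<Sum>b\<in>onbs P l. ip ?S (act (?c w) (tensor P l b)) (tensor P l b)"
  have conj: "ip ?S (act (?c w) v) v = ip ?S (act x (act w v)) (act w v)" if w: "w \<in> carrier W" for w v
  proof -
    have "w \<otimes>\<^bsub>W\<^esub> ?c w = x \<otimes>\<^bsub>W\<^esub> w"
      using w x by (simp add: W.m_assoc[symmetric])
    then have "act w (act (?c w) v) = act x (act w v)"
      using w x act_mult[of w "?c w" v] act_mult[of x w v] by simp
    then show ?thesis using ip_act_act[OF w words_perm, of I "content l" "act (?c w) v" v] by simp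
  qed
  have "(\<Sum>w | w \<in> carrier W \<and> ?c w \<in> inertia G n P. inertia_char G \<theta> P l (?c w)) =
      (\<Sum>w | w \<in> carrier W \<and> ?c w \<in> inertia G n P. ?f w)"
    using x by (intro sum.cong refl inertia_char_eq) auto
  also have "\<dots> = (\<Sum>w\<in>carrier W. ?f w)"
    using x finite_wreath ip_tensor_outside_inertia
    by (intro sum.mono_neutral_left) (auto intro!: sum.neutral)
  also have "\<dots> = (\<Sum>w\<in>carrier W. \<Sum>b\<in>onbs P l.
      ip ?S (act x (act w (tensor P l b))) (act w (tensor P l b)))"
    by (intro sum.cong refl conj)
  finally show ?thesis by (simp only: wreath_char_def induced_char_def)
qed

text \<open>Both factors become sums of squared norms over the same family of vectors, up to the
  order of the inertia group: the degree gives the norms of the vectors, and the double sum over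
  \<open>Y\<close> gives the norms of their images.\<close>

lemma dual_dist_eq_0_iff:
  assumes Y: "Y \<subseteq> carrier W" "Y \<noteq> {}"
  shows "dual_dist G n \<theta> P Y l = 0 \<longleftrightarrow>
    (\<forall>w\<in>carrier W. \<forall>b\<in>onbs P l. opr (\<lambda>y. if y \<in> Y then 1 else 0) (act w (tensor P l b)) = 0)"
proof -
  interpret W: group W by (rule wreath_group)
  let ?S = "words I (content l)"
  let ?M = "opr (\<lambda>y. if y \<in> Y then 1 else 0)"
  let ?v = "\<lambda>w b. act w (tensor P l b)"
  define N where "N = (\<lambda>v :: (nat \<Rightarrow> 'g \<times> nat) \<Rightarrow> complex. \<Sum>x\<in>?S. (cmod (v x))\<^sup>2)"
  have N0: "v = 0" if "N v = 0" "v \<in> wt_space I (content l)" for v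
  proof -
    have "\<forall>x\<in>?S. v x = 0"
      using that(1) finite_words[of I "content l"] by (simp add: N_def sum_nonneg_eq_0_iff)
    then show ?thesis using that(2) by (auto simp: wt_space_def fun_eq_iff)
  qed
  have Npos: "N v \<ge> 0" for v unfolding N_def by (intro sum_nonneg) auto
  have v_wt: "?v w b \<in> wt_space I (content l)" if "w \<in> carrier W" "b \<in> onbs P l" for w b
    using act_wt_space[OF that(1) tensor_wt_space[OF that(2)]] .
  have finY: "finite Y" using Y finite_wreath finite_subset by blast
  have Msum: "?M v w = (\<Sum>y\<in>Y. act y v w)" for v w
    unfolding opr_def using Y finite_wreath by (intro sum.mono_neutral_cong_right) auto
  define S1 where "S1 = (\<Sum>w\<in>carrier W. \<Sum>b\<in>onbs P l. N (?v w b))"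
  define S2 where "S2 = (\<Sum>w\<in>carrier W. \<Sum>b\<in>onbs P l. N (?M (?v w b)))"
  have sum0: "(\<forall>w\<in>carrier W. \<forall>b\<in>onbs P l. f w b = 0)"
    if "(\<Sum>w\<in>carrier W. \<Sum>b\<in>onbs P l. f w b) = 0" "\<And>w b. f w b \<ge> 0" for f :: "_ \<Rightarrow> _ \<Rightarrow> real"
    using that finite_wreath finite_onbs by (simp add: sum_nonneg_eq_0_iff sum_nonneg)
  define k where "k = complex_of_nat (card (inertia G n P))"
  have "\<one>\<^bsub>W\<^esub> \<in> inertia G n P" using W.one_closed by (simp add: inertia_iff wreath_one)
  moreover have "finite (inertia G n P)"
    using finite_wreath by (rule finite_subset[rotated]) (auto simp: inertia_def)
  ultimately have k0: "k \<noteq> 0" by (auto simp: k_def card_eq_0_iff)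
  have chi1: "wreath_char G n \<theta> P l \<one>\<^bsub>W\<^esub> = of_real S1 / k"
    by (simp add: wreath_char_eq[OF W.one_closed] act_one ip_self S1_def N_def k_def)
  have "(\<Sum>x\<in>Y. \<Sum>y\<in>Y. wreath_char G n \<theta> P l (inv\<^bsub>W\<^esub> x \<otimes>\<^bsub>W\<^esub> y)) =
      (\<Sum>x\<in>Y. \<Sum>y\<in>Y. (\<Sum>w\<in>carrier W. \<Sum>b\<in>onbs P l. ip ?S (act y (?v w b)) (act x (?v w b))) / k)"
  proof (intro sum.cong refl)
    fix x y assume "x \<in> Y" "y \<in> Y"
    then have xy: "x \<in> carrier W" "y \<in> carrier W" using Y by auto
    \<comment> \<open>The unitary operator of \<open>x\<close> is applied to both arguments. Summed
      over \<open>x\<close> and \<open>y\<close>, the right-hand side becomes the squared norm of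
      the image under the sum over \<open>Y\<close>.\<close>
    have "ip ?S (act (inv\<^bsub>W\<^esub> x \<otimes>\<^bsub>W\<^esub> y) v) v = ip ?S (act y v) (act x v)" for v
    proof -
      have "x \<otimes>\<^bsub>W\<^esub> (inv\<^bsub>W\<^esub> x \<otimes>\<^bsub>W\<^esub> y) = y" using xy by (simp add: W.m_assoc[symmetric])
      then have "act x (act (inv\<^bsub>W\<^esub> x \<otimes>\<^bsub>W\<^esub> y) v) = act y v"
        using xy act_mult[of x "inv\<^bsub>W\<^esub> x \<otimes>\<^bsub>W\<^esub> y" v] by simp
      then show ?thesis
        using ip_act_act[OF xy(1) words_perm, of I "content l" "act (inv\<^bsub>W\<^esub> x \<otimes>\<^bsub>W\<^esub> y) v" v] by simp
    qed
    then show "wreath_char G n \<theta> P l (inv\<^bsub>W\<^esub> x \<otimes>\<^bsub>W\<^esub> y) =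
        (\<Sum>w\<in>carrier W. \<Sum>b\<in>onbs P l. ip ?S (act y (?v w b)) (act x (?v w b))) / k"
      using xy by (simp add: wreath_char_eq k_def)
  qed
  also have "\<dots> = (\<Sum>w\<in>carrier W. \<Sum>b\<in>onbs P l. \<Sum>x\<in>Y. \<Sum>y\<in>Y. ip ?S (act y (?v w b)) (act x (?v w b))) / k"
    unfolding sum_divide_distrib[symmetric]
    by (intro arg_cong[where f = "\<lambda>z. z / k"])
      (simp only: sum.swap[of _ "onbs P l" Y] sum.swap[of _ "carrier W" Y])
  also have "\<dots> = of_real S2 / k"
  proof -
    have "(\<Sum>x\<in>Y. \<Sum>y\<in>Y. ip ?S (act y v) (act x v)) = of_real (N (?M v))" for v
    proof -
      have "(\<Sum>x\<in>Y. \<Sum>y\<in>Y. ip ?S (act y v) (act x v)) =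
          (\<Sum>w\<in>?S. \<Sum>x\<in>Y. \<Sum>y\<in>Y. act y v w * cnj (act x v w))"
        unfolding ip_def by (simp only: sum.swap[of _ ?S Y])
      also have "\<dots> = ip ?S (?M v) (?M v)"
        unfolding ip_def Msum cnj_sum sum_product
        by (rule sum.cong[OF refl], rule sum.swap)
      finally show ?thesis by (simp only: ip_self N_def)
    qed
    then show ?thesis by (simp add: S2_def)
  qed
  finally have "dual_dist G n \<theta> P Y l = of_real S1 / k / of_nat (card Y) * (of_real S2 / k)"
    by (simp only: dual_dist_def chi1)
  then have iff: "dual_dist G n \<theta> P Y l = 0 \<longleftrightarrow> S1 = 0 \<or> S2 = 0"
    using k0 finY Y(2) by simp
  show ?thesis
  proof
    assume "dual_dist G n \<theta> P Y l = 0"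
    then consider "S1 = 0" | "S2 = 0" using iff by blast
    then show "\<forall>w\<in>carrier W. \<forall>b\<in>onbs P l. ?M (?v w b) = 0"
    proof cases
      \<comment> \<open>If the degree factor vanishes, all the translates are 0, and so are their
        images.\<close>
      case 1
      have "?v w b = 0" if "w \<in> carrier W" "b \<in> onbs P l" for w b
        using N0[OF _ v_wt[OF that]] sum0[OF 1[unfolded S1_def] Npos] that by blast
      then show ?thesis using opr_0 by metis
    next
      case 2
      show ?thesis
        using N0[OF _ opr_wt_space[OF v_wt]] sum0[OF 2[unfolded S2_def] Npos] by blast
    qed
  next
    assume "\<forall>w\<in>carrier W. \<forall>b\<in>onbs P l. ?M (?v w b) = 0"
    then have "S2 = 0" unfolding S2_def by (intro sum.neutral ballI) (simp add: N_def)
    then show "dual_dist G n \<theta> P Y l = 0" using iff by blast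
  qed
qed

end

end

section \<open>Dominance order and killed weight spaces\<close>

lemma finite_support_bound:
  assumes "p \<in> Par" shows "\<exists>K. \<forall>k\<ge>K. p k = 0"
proof -
  have "finite {i. p i \<noteq> 0}" using assms by (simp add: Par_def)
  then obtain K where "{i. p i \<noteq> 0} \<subseteq> {..<K}" using finite_nat_iff_bounded by blast
  then show ?thesis by (intro exI[of _ K]) force
qed

lemma psize_eq:
  assumes "p \<in> Par" "\<forall>k\<ge>K. p k = 0" shows "psize p = (\<Sum>i<K. p i)"
proof -
  have "i < K" if "p i \<noteq> 0" for i using assms(2) that by (cases "i < K") auto
  then show ?thesis unfolding psize_def by (intro sum.mono_neutral_left) auto
qed

lemma dominated_psize:
  assumes "p \<in> Par" "q \<in> Par" "dominated p q" shows "psize p \<le> psize q"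
proof -
  obtain K L where "\<forall>k\<ge>K. p k = 0" "\<forall>k\<ge>L. q k = 0" using finite_support_bound assms by metis
  then have "\<forall>k\<ge>max K L. p k = 0" "\<forall>k\<ge>max K L. q k = 0" by auto
  then show ?thesis using assms psize_eq[of p "max K L"] psize_eq[of q "max K L"] by (simp add: dominated_def)
qed

lemma sum_move:
  fixes p :: "nat \<Rightarrow> nat"
  assumes "i < j" "p j \<noteq> 0"
  shows "(\<Sum>a<k. (p(i := Suc (p i), j := p j - 1)) a) = (\<Sum>a<k. p a) + (if i < k \<and> k \<le> j then 1 else 0)"
proof (induction k)
  case (Suc k)
  consider "k < i" | "k = i" | "i < k" "k < j" | "k = j" | "j < k" using assms(1) by linarith
  then show ?case using Suc assms by cases auto
qed simp

text \<open>Row \<open>i\<close> is the first in which the partitions differ, and \<open>j\<close>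
  is the first row from \<open>i\<close> on after which the partial sums agree again. As
  \<open>p\<close> agrees with \<open>q\<close> above row \<open>i\<close> and
  \<open>p i < q i\<close>, a box can be added in row \<open>i\<close>; as \<open>q j < p j\<close>
  and \<open>p (Suc j) \<le> q (Suc j)\<close>, one can be removed from row \<open>j\<close>. The
  partial sums in between are strictly smaller, which leaves room for the moved box.\<close>

lemma dominance_step:
  assumes p: "p \<in> Par" and q: "q \<in> Par" and dom: "dominated p q" and sz: "psize p = psize q" and ne: "p \<noteq> q"
  obtains i j where "i < j" "p j \<noteq> 0" "p j \<le> p i"
    "p(i := Suc (p i), j := p j - 1) \<in> Par" "dominated (p(i := Suc (p i), j := p j - 1)) q"
proof -
  define Sp where "Sp = (\<lambda>k. \<Sum>a<k. p a)"
  define Sq where "Sq = (\<lambda>k. \<Sum>a<k. q a)"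
  have le: "Sp k \<le> Sq k" for k using dom by (simp add: dominated_def Sp_def Sq_def)
  have SpS: "Sp (Suc k) = Sp k + p k" and SqS: "Sq (Suc k) = Sq k + q k" for k
    by (simp_all add: Sp_def Sq_def)
  have anti_p: "a \<le> b \<Longrightarrow> p b \<le> p a" and anti_q: "a \<le> b \<Longrightarrow> q b \<le> q a" for a b
    using p q by (auto simp: Par_def antimono_def)
  obtain i0 where "p i0 \<noteq> q i0" using ne by blast
  define i where "i = (LEAST i. p i \<noteq> q i)"
  have i: "p i \<noteq> q i" unfolding i_def by (rule LeastI) (rule \<open>p i0 \<noteq> q i0\<close>)
  have before: "p a = q a" if "a < i" for a using not_less_Least[of a] that unfolding i_def by blast
  have Si: "Sp i = Sq i" unfolding Sp_def Sq_def using before by (intro sum.cong) auto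
  have pq_i: "p i < q i" using le[of "Suc i"] Si i unfolding SpS SqS by linarith
  obtain K L where "\<forall>k\<ge>K. p k = 0" "\<forall>k\<ge>L. q k = 0" using finite_support_bound p q by metis
  then have "\<forall>k\<ge>Suc (K + L + i). p k = 0" "\<forall>k\<ge>Suc (K + L + i). q k = 0" by auto
  then have "Sp (Suc (K + L + i)) = psize p" "Sq (Suc (K + L + i)) = psize q"
    using psize_eq[OF p] psize_eq[OF q] by (simp_all only: Sp_def Sq_def)
  then have ex: "Sp (Suc (K + L + i)) = Sq (Suc (K + L + i)) \<and> i \<le> K + L + i" using sz by simp
  define j where "j = (LEAST j. Sp (Suc j) = Sq (Suc j) \<and> i \<le> j)"
  have j: "Sp (Suc j) = Sq (Suc j) \<and> i \<le> j" unfolding j_def by (rule LeastI) (rule ex)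
  have "j \<noteq> i" using j Si pq_i unfolding SpS SqS by auto
  then have ij: "i < j" using j by simp
  have strict: "Sp (Suc k) < Sq (Suc k)" if "i \<le> k" "k < j" for k
  proof -
    have "\<not> (Sp (Suc k) = Sq (Suc k) \<and> i \<le> k)"
      using not_less_Least[of k "\<lambda>j. Sp (Suc j) = Sq (Suc j) \<and> i \<le> j"] that by (simp add: j_def)
    then show ?thesis using le[of "Suc k"] that by linarith
  qed
  have "Sp j < Sq j" using strict[of "j - 1"] ij by simp
  then have qp_j: "q j < p j" using j unfolding SpS SqS by linarith
  have next_j: "p (Suc j) \<le> q (Suc j)" using le[of "Suc (Suc j)"] j unfolding SpS[of "Suc j"] SqS[of "Suc j"] by linarith
  let ?p = "p(i := Suc (p i), j := p j - 1)"
  have "?p (Suc k) \<le> ?p k" for k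
  proof -
    consider "Suc k = i" | "k = i" | "Suc k = j" "k \<noteq> i" | "k = j" | "k \<noteq> i" "k \<noteq> j" "Suc k \<noteq> i" "Suc k \<noteq> j"
      by blast
    then show ?thesis
    proof cases
      case 1
      then have "p k = q k" using before by simp
      then show ?thesis using 1 ij pq_i anti_q[of k i] by auto
    next
      case 2
      then show ?thesis using ij anti_p[of i "Suc i"] by auto
    next
      case 3
      then show ?thesis using ij anti_p[of k j] by auto
    next
      case 4
      then show ?thesis using ij qp_j next_j anti_q[of j "Suc j"] by auto
    next
      case 5
      then show ?thesis using anti_p[of k "Suc k"] by auto
    qed
  qed
  then have "antimono ?p" by (rule decseq_SucI)
  moreover have "finite {a. ?p a \<noteq> 0}"
  proof (rule finite_subset)
    show "{a. ?p a \<noteq> 0} \<subseteq> insert i {a. p a \<noteq> 0}" using qp_j by auto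
    show "finite (insert i {a. p a \<noteq> 0})" using p by (simp add: Par_def)
  qed
  ultimately have "?p \<in> Par" by (simp add: Par_def)
  moreover have "dominated ?p q"
    unfolding dominated_def
  proof
    fix k
    have "Sp k + (if i < k \<and> k \<le> j then 1 else 0) \<le> Sq k"
      using le[of k] strict by (cases k) (auto simp: Suc_le_eq less_Suc_eq_le)
    then show "sum ?p {..<k} \<le> sum q {..<k}"
      using sum_move[OF ij, of p k] qp_j by (simp add: Sp_def Sq_def)
  qed
  ultimately show ?thesis using that[OF ij] qp_j anti_p[of i j] ij by simp
qed

lemma sum_card_fibres:
  assumes "finite A" "finite J" "f ` A \<subseteq> J"
  shows "(\<Sum>j\<in>J. card {a\<in>A. f a = j}) = card A"
  using sum.group[OF assms, of "\<lambda>_. 1 :: nat"] by simp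

context wreath_characters
begin

lemma card_I: "card I = n"
  by (simp add: I_def)

lemma content_word_exists:
  assumes "l \<in> Lambda G n"
  obtains w where "w \<in> words I (content l)"
proof -
  define B where "B = Sigma (carrier G) (\<lambda>g. diagram (l g))"
  have finD: "finite (diagram (l g))" if "g \<in> carrier G" for g
    using finite_diagram Lambda_Par[OF assms that] by blast
  have finB: "finite B" unfolding B_def using finG finD by (intro finite_SigmaI) auto
  have "card B = (\<Sum>g\<in>carrier G. psize (l g))"
    unfolding B_def using finG finD card_diagram[OF Lambda_Par[OF assms]]
    by (subst card_SigmaI) auto
  then have "card I = card B" using assms by (simp add: Lambda_def card_I)
  then obtain h where h: "bij_betw h I B" using finite_same_card_bij[OF finite_I finB] by blast
  define w where "w = (\<lambda>i\<in>I. (fst (h i), fst (snd (h i))))"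
  have "wcount I w (g, k) = content l (g, k)" for g k
  proof -
    have "h ` {i\<in>I. w i = (g, k)} = {b\<in>B. fst b = g \<and> fst (snd b) = k}"
      using bij_betw_imp_surj_on[OF h] by (auto simp: w_def image_iff)
    moreover have "inj_on h {i\<in>I. w i = (g, k)}"
      using bij_betw_imp_inj_on[OF h] by (rule inj_on_subset) auto
    ultimately have "wcount I w (g, k) = card {b\<in>B. fst b = g \<and> fst (snd b) = k}"
      unfolding wcount_def using card_image[of h "{i\<in>I. w i = (g, k)}"] by simp
    also have "{b\<in>B. fst b = g \<and> fst (snd b) = k} =
        (if g \<in> carrier G then Pair g ` {b\<in>diagram (l g). fst b = k} else {})"
      by (auto simp: B_def)
    also have "card \<dots> = content l (g, k)"
      by (simp add: card_image inj_on_def card_diagram_row content_def)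
    finally show ?thesis .
  qed
  then have "w \<in> words I (content l)" by (auto simp: words_def w_def fun_eq_iff)
  then show ?thesis by (rule that)
qed

text \<open>Boxes are moved up one at a time within a colour by \<open>dominance_step\<close>, and
  each move is an instance of \<open>kills_up\<close>: afterwards row \<open>i\<close> is strictly
  longer than row \<open>j\<close>. The word \<open>w\<close> supplies the measure, the sum of its
  row indices, which drops with every move.\<close>

lemma kills_dominating:
  assumes l: "l \<in> Lambda G n" and m: "m \<in> Lambda G n"
    and dom: "\<And>g. g \<in> carrier G \<Longrightarrow> dominated (m g) (l g)"
    and kills: "kills c (content m)"
  shows "kills c (content l)"
proof -
  obtain w where w: "w \<in> words I (content m)" using content_word_exists[OF m] .
  show ?thesis
    using w m dom kills
  proof (induction "\<Sum>i\<in>I. snd (w i)" arbitrary: w m rule: less_induct)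
    case less
    note m = less.prems(2) and dom = less.prems(3)
    have sz_le: "psize (m g) \<le> psize (l g)" if "g \<in> carrier G" for g
      using dominated_psize[OF Lambda_Par[OF m that] Lambda_Par[OF l that] dom[OF that]] .
    have "(\<Sum>g\<in>carrier G. psize (m g)) = (\<Sum>g\<in>carrier G. psize (l g))"
      using m l by (simp add: Lambda_def)
    \<comment> \<open>Dominance gives an inequality of sizes in each colour; since both totals are
      \<open>n\<close>, all of them are equalities.\<close>
    from sum_mono_inv[OF this sz_le _ finG]
    have sz: "psize (m g) = psize (l g)" if "g \<in> carrier G" for g using that by simp
    show ?case
    proof (cases "m = l")
      case True
      then show ?thesis using less.prems(4) by simp
    next
      case False
      then obtain g where "m g \<noteq> l g" by blast
      moreover have "g \<in> carrier G"
      proof (rule ccontr)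
        assume "g \<notin> carrier G"
        then have "m g = undefined" "l g = undefined"
          using m l unfolding Lambda_def mem_Collect_eq by (meson PiE_arb)+
        then show False using \<open>m g \<noteq> l g\<close> by simp
      qed
      ultimately have g: "g \<in> carrier G" "m g \<noteq> l g" by auto
      obtain i j where ij: "i < j" "m g j \<noteq> 0" "m g j \<le> m g i"
        and par: "(m g)(i := Suc (m g i), j := m g j - 1) \<in> Par"
        and dom': "dominated ((m g)(i := Suc (m g i), j := m g j - 1)) (l g)"
        using dominance_step[OF Lambda_Par[OF m g(1)] Lambda_Par[OF l g(1)] dom[OF g(1)] sz[OF g(1)] g(2)]
        by blast
      define m' where "m' = m(g := (m g)(i := Suc (m g i), j := m g j - 1))"
      have cm': "content m' = (content m)((g, i) := Suc (content m (g, i)), (g, j) := content m (g, j) - 1)"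
        using g ij by (auto simp: m'_def content_def fun_eq_iff)
      have "{a\<in>I. w a = (g, j)} \<noteq> {}"
      proof -
        have "wcount I w (g, j) \<noteq> 0"
          using less.prems(1) ij(2) g(1) by (simp add: words_def content_def)
        then show ?thesis unfolding wcount_def by (metis card.empty)
      qed
      then obtain a where a: "a \<in> I" "w a = (g, j)" by blast
      define w' where "w' = w(a := (g, i))"
      have w'_words: "w' \<in> words I (content m')"
      proof -
        have "wcount I w = content m" "w \<in> extensional I" using less.prems(1) by (auto simp: words_def)
        moreover have "w' \<in> extensional I"
          using \<open>w \<in> extensional I\<close> a(1) by (auto simp: w'_def extensional_def)
        ultimately show ?thesis
          using wcount_upd[OF finite_I a(1), of w "(g, i)"] a(2) ij(1) by (simp add: words_def cm' w'_def)
      qed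
      have "(\<Sum>k\<in>I. snd (w' k)) < (\<Sum>k\<in>I. snd (w k))"
        using a ij(1) by (intro sum_strict_mono_ex1) (auto simp: w'_def intro!: bexI[of _ a])
      moreover have "m' \<in> Lambda G n"
      proof -
        have p1: "m' h \<in> Par" if "h \<in> carrier G" for h
          using Lambda_Par[OF m that] par by (auto simp: m'_def)
        \<comment> \<open>The size is squeezed: the move can only increase partial sums, so it does
          not drop below that of \<open>m g\<close>, and by dominance it does not exceed that of
          \<open>l g\<close>, which is the same.\<close>
        have "psize (m' g) = psize (m g)"
          using dominated_psize[OF p1[OF g(1)] Lambda_Par[OF l g(1)]] dom' sz[OF g(1)]
            dominated_psize[OF Lambda_Par[OF m g(1)] p1[OF g(1)]] sum_move[of i j "m g"] ij
          by (auto simp: m'_def dominated_def)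
        then have "psize (m' h) = psize (m h)" for h by (cases "h = g") (auto simp: m'_def)
        moreover have "m' \<in> extensional (carrier G)"
          using m g(1) by (auto simp: Lambda_def m'_def PiE_def extensional_def)
        ultimately show ?thesis using m p1 by (auto simp: Lambda_def PiE_iff)
      qed
      moreover have "dominated (m' h) (l h)" if "h \<in> carrier G" for h
        using dom[OF that] dom' by (auto simp: m'_def)
      moreover have "kills c (content m')"
      proof (rule kills_up[of "(g, i)" "(g, j)"])
        have "(content m')((g, j) := Suc (content m' (g, j)), (g, i) := content m' (g, i) - 1) = content m"
          unfolding cm' using ij g(1) by (auto simp: content_def fun_eq_iff)
        then show "kills c ((content m')((g, j) := Suc (content m' (g, j)), (g, i) := content m' (g, i) - 1))"
          using less.prems(4) by simp
      qed (use ij g(1) in \<open>auto simp: m'_def content_def\<close>)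
      ultimately show ?thesis using less.hyps[of w' m'] w'_words by blast
    qed
  qed
qed

text \<open>Induction on the sum of the row indices, which every raising decreases. The hypothesis
  on dominating partitions is inherited by the raised content, because raising only increases
  partial sums; so \<open>kills_down\<close> reduces the claim to the highest weight vectors of the
  content itself.\<close>

lemma kills_from_HW:
  assumes ext: "w \<in> extensional I" and col: "\<And>i. i \<in> I \<Longrightarrow> fst (w i) \<in> carrier G"
    and hw: "\<And>l v. l \<in> Lambda G n \<Longrightarrow>
      (\<And>g. g \<in> carrier G \<Longrightarrow> dominated (\<lambda>i. wcount I w (g, i)) (l g)) \<Longrightarrow>
      v \<in> HW (carrier G) I (content l) \<Longrightarrow> opr c v = 0"
  shows "kills c (wcount I w)"
  using assms
proof (induction "\<Sum>i\<in>I. snd (w i)" arbitrary: w rule: less_induct)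
  case less
  let ?\<tau> = "wcount I w"
  show ?case
  proof (rule kills_down[of "carrier G"])
    fix v assume v: "v \<in> HW (carrier G) I ?\<tau>"
    show "opr c v = 0"
    proof (cases "v = 0")
      case True
      then show ?thesis by (simp only: opr_0)
    next
      case False
      \<comment> \<open>A nonzero highest weight vector makes the content a partition in each
        colour, so it is \<open>content l\<close>; dominance is reflexive, and the hypothesis
        applies to this \<open>l\<close>.\<close>
      define l where "l = (\<lambda>g\<in>carrier G. \<lambda>i. ?\<tau> (g, i))"
      have par: "(\<lambda>i. ?\<tau> (g, i)) \<in> Par" if "g \<in> carrier G" for g
        using HW_dominant[OF finite_I v False that] .
      have psz: "psize (l g) = card {i\<in>I. fst (w i) = g}" if g: "g \<in> carrier G" for g
      proof -
        let ?A = "{i\<in>I. fst (w i) = g}"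
        have e: "{a\<in>?A. snd (w a) = k} = {a\<in>I. w a = (g, k)}" for k by (auto simp: prod_eq_iff)
        have "psize (l g) = (\<Sum>k | ?\<tau> (g, k) \<noteq> 0. ?\<tau> (g, k))" using g by (simp add: psize_def l_def)
        also have "\<dots> = (\<Sum>k | ?\<tau> (g, k) \<noteq> 0. card {a\<in>?A. snd (w a) = k})"
          unfolding e by (simp only: wcount_def)
        also have "\<dots> = card ?A"
        proof (rule sum_card_fibres)
          show "finite {k. ?\<tau> (g, k) \<noteq> 0}" using par[OF g] by (simp add: Par_def)
          show "(\<lambda>a. snd (w a)) ` ?A \<subseteq> {k. ?\<tau> (g, k) \<noteq> 0}"
          proof (rule image_subsetI)
            fix a assume "a \<in> ?A"
            then have "a \<in> I" "w a = (g, snd (w a))" by (auto simp: prod_eq_iff)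
            then show "snd (w a) \<in> {k. ?\<tau> (g, k) \<noteq> 0}" using wcount_pos[OF finite_I, of a w] by simp
          qed
        qed simp
        finally show ?thesis .
      qed
      have "(\<Sum>g\<in>carrier G. psize (l g)) = (\<Sum>g\<in>carrier G. card {i\<in>I. fst (w i) = g})"
        using psz by simp
      also have "\<dots> = n"
        using sum_card_fibres[OF finite_I finG, of "\<lambda>i. fst (w i)"] less.prems(2) card_I by auto
      finally have l: "l \<in> Lambda G n" using par by (auto simp: Lambda_def l_def)
      have "content l = ?\<tau>"
      proof
        fix x :: "'g \<times> nat"
        obtain g k where x: "x = (g, k)" by fastforce
        show "content l x = ?\<tau> x"
        proof (cases "g \<in> carrier G")
          case False
          then have "{i\<in>I. w i = (g, k)} = {}" using less.prems(2) by force
          then show ?thesis using False x by (simp only: wcount_def content_def prod.case if_False card.empty)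
        qed (simp add: content_def l_def x)
      qed
      then show ?thesis
        using less.prems(3)[OF l _, of v] v by (simp add: l_def dominated_def)
    qed
  next
    fix g i assume g: "g \<in> carrier G" and nz: "?\<tau> (g, Suc i) \<noteq> 0"
    have "{a\<in>I. w a = (g, Suc i)} \<noteq> {}"
    proof
      assume "{a\<in>I. w a = (g, Suc i)} = {}"
      then show False using nz by (simp only: wcount_def card.empty)
    qed
    then obtain a where a: "a \<in> I" "w a = (g, Suc i)" by blast
    define w' where "w' = w(a := (g, i))"
    have \<tau>': "wcount I w' = ?\<tau>((g, i) := Suc (?\<tau> (g, i)), (g, Suc i) := ?\<tau> (g, Suc i) - 1)"
      using wcount_upd[OF finite_I a(1), of w "(g, i)"] a(2) by (simp add: w'_def)
    have "kills c (wcount I w')"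
    proof (rule less.hyps)
      show "(\<Sum>k\<in>I. snd (w' k)) < (\<Sum>k\<in>I. snd (w k))"
        using a by (intro sum_strict_mono_ex1) (auto simp: w'_def intro!: bexI[of _ a])
      show "w' \<in> extensional I" using less.prems(1) a(1) by (auto simp: w'_def extensional_def)
      show "fst (w' k) \<in> carrier G" if "k \<in> I" for k using less.prems(2)[OF that] g by (simp add: w'_def)
    next
      fix l v assume l: "l \<in> Lambda G n" and v: "v \<in> HW (carrier G) I (content l)"
        and dom: "\<And>h. h \<in> carrier G \<Longrightarrow> dominated (\<lambda>k. wcount I w' (h, k)) (l h)"
      have "dominated (\<lambda>k. ?\<tau> (h, k)) (l h)" if h: "h \<in> carrier G" for h
        unfolding dominated_def
      proof
        fix k
        have "(\<Sum>a<k. ?\<tau> (h, a)) \<le> (\<Sum>a<k. wcount I w' (h, a))"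
        proof (cases "h = g")
          case True
          have "wcount I w' (h, a) =
              ((\<lambda>a. ?\<tau> (g, a))(i := Suc (?\<tau> (g, i)), Suc i := ?\<tau> (g, Suc i) - 1)) a" for a
            unfolding \<tau>' using True by auto
          then have "(\<Sum>a<k. wcount I w' (h, a)) =
              (\<Sum>a<k. ((\<lambda>a. ?\<tau> (g, a))(i := Suc (?\<tau> (g, i)), Suc i := ?\<tau> (g, Suc i) - 1)) a)"
            by (simp only:)
          also have "\<dots> = (\<Sum>a<k. ?\<tau> (g, a)) + (if i < k \<and> k \<le> Suc i then 1 else 0)"
            by (rule sum_move) (use nz in auto)
          finally show ?thesis using True by simp
        next
          case False
          then show ?thesis unfolding \<tau>' by (intro sum_mono) auto
        qed
        also have "\<dots> \<le> sum (l h) {..<k}" using dom[OF h] by (simp add: dominated_def)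
        finally show "(\<Sum>a<k. ?\<tau> (h, a)) \<le> sum (l h) {..<k}" .
      qed
      then show "opr c v = 0" using less.prems(3)[OF l _ v] by blast
    qed
    then show "kills c (?\<tau>((g, i) := Suc (?\<tau> (g, i)), (g, Suc i) := ?\<tau> (g, Suc i) - 1))"
      by (simp only: \<tau>')
  qed
qed

end

section \<open>Irreducible modules\<close>

lemma sum_fun_apply: "(\<Sum>b\<in>J. f b) x = (\<Sum>b\<in>J. f b x)"
  for f :: "'b \<Rightarrow> 'c \<Rightarrow> 'd :: comm_monoid_add"
  by (induction J rule: infinite_finite_induct) simp_all

lemma psize_one_part: "psize (one_part n) = n"
proof -
  have "{i. one_part n i \<noteq> 0} = (if n = 0 then {} else {0})" by (auto simp: one_part_def)
  then show ?thesis by (simp add: psize_def one_part_def)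
qed

lemma psize_eq_0:
  assumes "p \<in> Par" "psize p = 0" shows "p = (\<lambda>_. 0)"
proof -
  have "finite {i. p i \<noteq> 0}" using assms(1) by (simp add: Par_def)
  then show ?thesis using assms(2) by (auto simp: psize_def fun_eq_iff)
qed

context wreath_characters
begin

lemma act_0: "act y 0 = 0"
  by (rule ext) (simp add: act_def)

lemma opr_act_span:
  assumes "\<And>v. v \<in> S \<Longrightarrow> opr c (act y v) = 0" "v \<in> cfun.span S"
  shows "opr c (act y v) = 0"
proof -
  have "cfun.subspace {v. opr c (act y v) = 0}"
    by (intro cfun.subspaceI CollectI)
      (simp_all only: act_0 act_add act_fscale opr_0 opr_add opr_fscale cfun.scale_zero_right add_0_left mem_Collect_eq)
  then show ?thesis
    using cfun.span_minimal[of S "{v. opr c (act y v) = 0}"] assms by blast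
qed

text \<open>Each polytabloid is expanded in the orthonormal basis of its Specht module, and the
  product over the colours is multiplied out.\<close>

lemma mpt_in_span_tensors:
  assumes l: "l \<in> Lambda G n" and P: "blocks_for G n l P"
    and \<kappa>: "\<And>g i. g \<in> carrier G \<Longrightarrow> i \<in> P g \<Longrightarrow> \<kappa> i = g"
    and t: "\<And>g. g \<in> carrier G \<Longrightarrow> t g \<in> tableaux (P g) (l g)"
    and l': "\<And>g. g \<in> carrier G \<Longrightarrow> l' g = l g"
  shows "mpt (carrier G) I \<kappa> l' t \<in> cfun.span (tensor P l ` onbs P l)"
proof -
  define a where "a = (\<lambda>g b. ip (tabloids (P g) (l g)) (polytabloid (P g) (l g) (t g)) b)"
  have exp: "polytabloid (P g) (l g) (t g) X = (\<Sum>b\<in>onb (P g) (l g). a g b * b X)" if g: "g \<in> carrier G" for g X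
  proof -
    note onb = onb[OF finite_P[OF l P g] Lambda_Par[OF l g]]
    have "polytabloid (P g) (l g) (t g) \<in> cfun.span (onb (P g) (l g))"
      unfolding onb(2) specht_def using t[OF g] by (intro cfun.span_base) blast
    from orthonormal_expansion[OF onb(1) this]
    have "polytabloid (P g) (l g) (t g) X = (\<Sum>b\<in>onb (P g) (l g). fscale (a g b) b) X"
      unfolding a_def by (rule fun_cong)
    then show ?thesis by (simp only: sum_fun_apply fscale_def)
  qed
  have "mpt (carrier G) I \<kappa> l' t w = (\<Sum>b\<in>onbs P l. (\<Prod>g\<in>carrier G. a g (b g)) * tensor P l b w)" for w
  proof -
    have iff: "(\<forall>i\<in>I. fst (w i) = \<kappa> i) \<longleftrightarrow> (\<forall>g\<in>carrier G. \<forall>i\<in>P g. fst (w i) = g)"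
      using \<kappa> P_cover[OF l P] P_subset[OF l P] by (metis subsetD)
    show ?thesis
    proof (cases "w \<in> extensional I \<and> (\<forall>g\<in>carrier G. \<forall>i\<in>P g. fst (w i) = g)")
      case True
      let ?u = "\<lambda>i. snd (w i)"
      have "mpt (carrier G) I \<kappa> l' t w = (\<Prod>g\<in>carrier G. pt (l g) (t g) ?u)"
        using True iff l' by (simp add: mpt_def)
      also have "\<dots> = (\<Prod>g\<in>carrier G. \<Sum>b\<in>onb (P g) (l g). a g b * b (tab (P g) (l g) ?u))"
        by (intro prod.cong refl) (simp only: polytabloid_tab[OF t, symmetric] exp)
      also have "\<dots> = (\<Sum>b\<in>onbs P l. \<Prod>g\<in>carrier G. a g (b g) * b g (tab (P g) (l g) ?u))"
        unfolding onbs_def using finG onb(1)[OF finite_P[OF l P] Lambda_Par[OF l]]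
        by (subst prod_sum_PiE) (auto simp: orthonormal_def)
      also have "\<dots> = (\<Sum>b\<in>onbs P l. (\<Prod>g\<in>carrier G. a g (b g)) * tensor P l b w)"
        using True by (simp add: tensor_def prod.distrib)
      finally show ?thesis .
    next
      case False
      then have "mpt (carrier G) I \<kappa> l' t w = 0" "tensor P l b w = 0" for b
        using iff unfolding mpt_def tensor_def by (auto simp only: if_False)
      then show ?thesis by simp
    qed
  qed
  then have "mpt (carrier G) I \<kappa> l' t =
      (\<Sum>b\<in>onbs P l. fscale (\<Prod>g\<in>carrier G. a g (b g)) (tensor P l b))"
    by (simp add: fun_eq_iff sum_fun_apply fscale_def)
  also have "\<dots> \<in> cfun.span (tensor P l ` onbs P l)"
    by (intro cfun.span_sum cfun.span_scale cfun.span_base imageI)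
  finally show ?thesis .
qed

text \<open>A highest weight vector combines products of polytabloids for all colourings of the
  positions, whereas tensors are formed only for the blocks \<open>P\<close>. A permutation of the
  positions carries one colouring to the other; for this reason the hypothesis speaks of all
  translates of the tensors.\<close>

lemma HW_killed:
  assumes l: "l \<in> Lambda G n" and P: "blocks_for G n l P"
    and kill: "\<And>w b. w \<in> carrier W \<Longrightarrow> b \<in> onbs P l \<Longrightarrow> opr c (act w (tensor P l b)) = 0"
    and v: "v \<in> HW (carrier G) I (content l)"
  shows "opr c v = 0"
proof (rule opr_span_eq_0)
  show "v \<in> cfun.span (mpts (carrier G) I (curry (content l)))"
    using HW_subset_span_mpts[OF finite_I finG _ v] by (auto simp: content_def split: if_splits)
next
  fix f assume "f \<in> mpts (carrier G) I (curry (content l))"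
  then obtain \<kappa> t where f: "f = mpt (carrier G) I \<kappa> (curry (content l)) t" and \<kappa>: "\<kappa> \<in> I \<rightarrow> carrier G"
    and t0: "\<And>g. g \<in> carrier G \<Longrightarrow> t g \<in> tableaux {i\<in>I. \<kappa> i = g} (curry (content l) g)"
    by (auto simp: mpts_def)
  have cl: "curry (content l) g = l g" if "g \<in> carrier G" for g using that by (auto simp: content_def)
  have t: "t g \<in> tableaux {i\<in>I. \<kappa> i = g} (l g)" if "g \<in> carrier G" for g using t0[OF that] cl[OF that] by simp
  define \<kappa>P where "\<kappa>P = (\<lambda>i. THE g. g \<in> carrier G \<and> i \<in> P g)"
  have \<kappa>P: "\<kappa>P i = g" if "g \<in> carrier G" "i \<in> P g" for g i
    unfolding \<kappa>P_def using that P_disjoint[OF l P] by (intro the_equality) auto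
  have Pk: "{i\<in>I. \<kappa>P i = g} = P g" if "g \<in> carrier G" for g
    using \<kappa>P P_cover[OF l P] P_subset[OF l P that] that by blast
  \<comment> \<open>In both colourings the number of positions of colour \<open>g\<close> is the
    size of \<open>l g\<close>, so a permutation can match them.\<close>
  have "card {i\<in>I. \<kappa>P i = g} = card {i\<in>I. \<kappa> i = g}" for g
  proof (cases "g \<in> carrier G")
    case True
    have "card {i\<in>I. \<kappa> i = g} = psize (l g)"
      using t[OF True] card_diagram[OF Lambda_Par[OF l True]] bij_betw_same_card by (fastforce simp: tableaux_def)
    then show ?thesis using Pk[OF True] P True by (simp add: blocks_for_def)
  next
    case False
    then have "{i\<in>I. \<kappa>P i = g} = {}" "{i\<in>I. \<kappa> i = g} = {}"
      using \<kappa>P P_cover[OF l P] \<kappa> by blast+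
    then show ?thesis by (simp only:)
  qed
  from fibre_bij[OF finite_I finite_I this]
  obtain h where h: "bij_betw h I I" "\<And>i. i \<in> I \<Longrightarrow> \<kappa> (h i) = \<kappa>P i" by blast
  define p where "p = (\<lambda>i. if i \<in> I then h i else i)"
  have "bij_betw p I I" using h(1) by (rule bij_betw_cong[THEN iffD1, rotated]) (simp add: p_def)
  then have p: "p permutes I" by (rule bij_imp_permutes) (simp add: p_def)
  have pk: "\<kappa> (p i) = \<kappa>P i" if "i \<in> I" for i using h(2) that by (simp add: p_def)
  let ?p' = "inv_into UNIV p"
  define t' where "t' = (\<lambda>g. compose (diagram (l g)) ?p' (t g))"
  have t': "t' g \<in> tableaux (P g) (l g)" if g: "g \<in> carrier G" for g
  proof -
    have "bij_betw ?p' {i\<in>I. \<kappa> i = g} (P g)"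
    proof (rule bij_betw_imageI)
      show "inj_on ?p' {i\<in>I. \<kappa> i = g}" using permutes_inj[OF permutes_inv[OF p]] by (auto intro: inj_on_subset)
      show "?p' ` {i\<in>I. \<kappa> i = g} = P g"
      proof (intro equalityI subsetI)
        fix i assume "i \<in> ?p' ` {i\<in>I. \<kappa> i = g}"
        then obtain j where j: "j \<in> I" "\<kappa> j = g" "i = ?p' j" by blast
        then have "i \<in> I" "p i = j" using perm_inv_mem[OF p] permutes_inverses(1)[OF p] by auto
        then show "i \<in> P g" using pk[of i] j(2) Pk[OF g] by auto
      next
        fix i assume "i \<in> P g"
        then have i: "i \<in> I" "\<kappa>P i = g" using Pk[OF g] by auto
        then have "p i \<in> {i\<in>I. \<kappa> i = g}" using pk perm_mem[OF p] by simp
        then show "i \<in> ?p' ` {i\<in>I. \<kappa> i = g}"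
          using permutes_inverses(2)[OF p, of i] by (metis imageI)
      qed
    qed
    moreover have "bij_betw (t g) (diagram (l g)) {i\<in>I. \<kappa> i = g}" using t[OF g] by (simp add: tableaux_def)
    ultimately have "bij_betw (?p' \<circ> t g) (diagram (l g)) (P g)" by (rule bij_betw_trans[rotated])
    then have "bij_betw (t' g) (diagram (l g)) (P g)"
      by (rule bij_betw_cong[THEN iffD1, rotated]) (simp add: t'_def compose_def)
    then show ?thesis by (simp add: tableaux_def t'_def compose_def)
  qed
  \<comment> \<open>A pure permutation: its component in the base group is trivial and contributes
    no phase.\<close>
  define y where "y = (\<lambda>i\<in>I. \<one>, p)"
  have y: "y \<in> carrier W" using p by (simp add: y_def wreath_carrier)
  have ph: "phase (fst y) w = 1" for w :: "nat \<Rightarrow> 'g \<times> nat"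
    by (simp add: y_def phase_def chr_one)
  have "f = act y (mpt (carrier G) I \<kappa>P l t')"
  proof
    fix w :: "nat \<Rightarrow> 'g \<times> nat"
    have "(\<forall>i\<in>I. fst (w i) = \<kappa> i) \<longleftrightarrow> (\<forall>i\<in>I. fst (w (p i)) = \<kappa>P i)"
    proof
      assume *: "\<forall>i\<in>I. fst (w (p i)) = \<kappa>P i"
      show "\<forall>i\<in>I. fst (w i) = \<kappa> i"
      proof
        fix i assume "i \<in> I"
        then have "?p' i \<in> I" by (rule perm_inv_mem[OF p])
        then show "fst (w i) = \<kappa> i" using * pk[of "?p' i"] permutes_inverses(1)[OF p, of i] by force
      qed
    qed (use pk perm_mem[OF p] in auto)
    moreover have "pt (l g) (t g) (\<lambda>a. snd (w a)) = pt (l g) (t' g) (\<lambda>a. snd (w (p a)))" for g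
      by (rule pt_cong) (simp add: t'_def compose_def permutes_inverses(1)[OF p])
    ultimately show "f w = act y (mpt (carrier G) I \<kappa>P l t') w"
      unfolding f act_def ph using cl extensional_perm[OF p, of w]
      by (simp add: mpt_def y_def)
  qed
  moreover have "opr c (act y (mpt (carrier G) I \<kappa>P l t')) = 0"
  proof (rule opr_act_span)
    show "mpt (carrier G) I \<kappa>P l t' \<in> cfun.span (tensor P l ` onbs P l)"
      using \<kappa>P t' by (intro mpt_in_span_tensors[OF l P]) simp_all
    show "opr c (act y v) = 0" if "v \<in> tensor P l ` onbs P l" for v
      using that kill[OF y] by blast
  qed
  ultimately show "opr c f = 0" by simp
qed

lemma Lambda_split:
  assumes "l \<in> Lambda G n"
  shows "psize (l \<one>) + (\<Sum>g\<in>carrier G - {\<one>}. psize (l g)) = n"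
  using assms sum.remove[OF finG one_closed, of "\<lambda>g. psize (l g)"] by (simp add: Lambda_def)

text \<open>The content is concentrated on the letter \<open>(\<one>, 0)\<close>, so there is a
  single word and every group element fixes it; \<open>c\<close> acts by the sum of its
  coefficients.\<close>

lemma opr_trivial:
  assumes l: "l \<in> Lambda G n" and triv: "l \<one> = one_part n"
    and v: "v \<in> wt_space I (content l)" and c: "(\<Sum>y\<in>carrier W. c y) = 0"
  shows "opr c v = 0"
proof
  fix w :: "nat \<Rightarrow> 'g \<times> nat"
  have "(\<Sum>g\<in>carrier G - {\<one>}. psize (l g)) = 0"
    using Lambda_split[OF l] triv psize_one_part by simp
  then have lg: "l g = (\<lambda>_. 0)" if "g \<in> carrier G" "g \<noteq> \<one>" for g
    using psize_eq_0[OF Lambda_Par[OF l that(1)]] that finG by simp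
  have ct: "x = (\<one>, 0)" if nz: "content l x \<noteq> 0" for x
  proof -
    obtain g k where x: "x = (g, k)" by fastforce
    then have g: "g \<in> carrier G" "l g k \<noteq> 0" using nz by (auto simp: content_def split: if_splits)
    have "g = \<one>"
    proof (rule ccontr)
      assume "g \<noteq> \<one>"
      have "l g k = 0" by (simp only: lg[OF g(1) \<open>g \<noteq> \<one>\<close>])
      then show False using g(2) by simp
    qed
    moreover from this have "k = 0" using g(2) triv by (auto simp: one_part_def split: if_splits)
    ultimately show ?thesis using x by simp
  qed
  show "opr c v w = 0 w"
  proof (cases "w \<in> words I (content l)")
    case True
    have w: "w i = (\<one>, 0)" if "i \<in> I" for i
      using words_support[OF finite_I True] that by (intro ct) blast
    have "act y v w = v w" if y: "y \<in> carrier W" for y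
    proof -
      have "w \<circ> snd y = w"
      proof
        fix i
        show "(w \<circ> snd y) i = w i"
          using w perm_mem[OF wreath_perm[OF y], of i] permutes_not_in[OF wreath_perm[OF y], of i]
          by (cases "i \<in> I") auto
      qed
      moreover have "phase (fst y) w = 1"
        unfolding phase_def using w wreath_coord[OF y] chr_trivial by (intro prod.neutral) auto
      ultimately show ?thesis by (simp add: act_def)
    qed
    then have "opr c v w = (\<Sum>y\<in>carrier W. c y) * v w"
      by (simp add: opr_def sum_distrib_right)
    then show ?thesis using c by simp
  next
    case False
    then show ?thesis using opr_wt_space[OF v, of c] by (simp add: wt_space_def)
  qed
qed

text \<open>The sum over the group produces an invariant vector. At a word with a letter of
  nontrivial colour, invariance under the base group forces the value 0. Otherwise all colours are
  trivial, \<open>l \<one>\<close> is a partition of \<open>n\<close> with at least two rows, and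
  the symmetrisation of a vector of its Specht module vanishes.\<close>

lemma opr_all_tensor:
  assumes l: "l \<in> Lambda G n" and P: "blocks_for G n l P" and nontriv: "l \<one> \<noteq> one_part n"
    and b: "b \<in> onbs P l" and z: "z \<in> carrier W"
  shows "opr (\<lambda>_. 1) (act z (tensor P l b)) = 0"
proof -
  interpret W: group W by (rule wreath_group)
  let ?t = "tensor P l b"
  let ?f = "opr (\<lambda>_. 1) ?t"
  have "opr (\<lambda>_. 1) (act z ?t) w = ?f w" for w
  proof -
    have "(\<Sum>y\<in>carrier W. act y (act z ?t) w) = (\<Sum>y\<in>carrier W. act (y \<otimes>\<^bsub>W\<^esub> z) ?t w)"
      by (intro sum.cong refl) (rule fun_cong[OF act_mult[OF _ z, symmetric]])
    also have "\<dots> = (\<Sum>y\<in>carrier W. act y ?t w)"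
      by (rule sum.reindex_bij_witness[where i = "\<lambda>y. y \<otimes>\<^bsub>W\<^esub> inv\<^bsub>W\<^esub> z" and j = "\<lambda>y. y \<otimes>\<^bsub>W\<^esub> z"])
        (use z in \<open>auto simp: W.m_assoc\<close>)
    finally show ?thesis by (simp add: opr_def)
  qed
  then have fz: "opr (\<lambda>_. 1) (act z ?t) = ?f" by (simp add: fun_eq_iff)
  have left_inv: "act z ?f = ?f" if z: "z \<in> carrier W" for z
  proof
    fix w :: "nat \<Rightarrow> 'g \<times> nat"
    have "act z ?f w = (\<Sum>y\<in>carrier W. act z (act y ?t) w)"
      by (simp add: act_def opr_def sum_distrib_left)
    also have "\<dots> = (\<Sum>y\<in>carrier W. act (z \<otimes>\<^bsub>W\<^esub> y) ?t w)"
      by (intro sum.cong refl) (rule fun_cong[OF act_mult[OF z, symmetric]])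
    also have "\<dots> = (\<Sum>y\<in>carrier W. act y ?t w)"
      by (rule sum.reindex_bij_witness[where i = "\<lambda>y. inv\<^bsub>W\<^esub> z \<otimes>\<^bsub>W\<^esub> y" and j = "\<lambda>y. z \<otimes>\<^bsub>W\<^esub> y"])
        (use z in \<open>auto simp: W.m_assoc[symmetric]\<close>)
    finally show "act z ?f w = ?f w" by (simp add: opr_def)
  qed
  have "?f w = 0" for w
  proof (cases "w \<in> words I (content l)")
    case False
    then show ?thesis using opr_wt_space[OF tensor_wt_space[OF l P b]] by (simp add: wt_space_def)
  next
    case True
    have supp: "content l (w i) \<noteq> 0" if "i \<in> I" for i
      using words_support[OF finite_I True] that by blast
    then have wC: "fst (w i) \<in> carrier G" if "i \<in> I" for i
      using that by (cases "w i") (force simp: content_def split: if_splits)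
    show ?thesis
    proof (cases "\<forall>i\<in>I. fst (w i) = \<one>")
      case False
      then obtain i where i: "i \<in> I" "fst (w i) \<noteq> \<one>" by blast
      then obtain x where x: "x \<in> carrier G" "chr (fst (w i)) x \<noteq> 1"
        using chr_inj[OF wC[OF i(1)] one_closed] chr_trivial by metis
      \<comment> \<open>An element of the base group concentrated at position \<open>i\<close>,
        chosen such that the character of the colour of \<open>w i\<close> differs from 1 there. It
        multiplies the value at \<open>w\<close> by this number.\<close>
      define y where "y = ((\<lambda>j\<in>I. if j = i then x else \<one>), id :: nat \<Rightarrow> nat)"
      have "y \<in> carrier W" using x by (simp add: y_def wreath_carrier permutes_id)
      from fun_cong[OF left_inv[OF this], of w] have "phase (fst y) w * ?f w = ?f w"
        by (simp add: act_def y_def)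
      moreover have "phase (fst y) w = chr (fst (w i)) x"
        unfolding phase_def y_def using i(1) by (subst prod.remove[OF finite_I i(1)]) (simp add: chr_one)
      ultimately show ?thesis using x(2) by simp
    next
      case True': True
      have lz: "l g = (\<lambda>_. 0)" if g: "g \<in> carrier G" "g \<noteq> \<one>" for g
      proof
        fix k
        have "{i\<in>I. w i = (g, k)} = {}" using True' g(2) by force
        then have "wcount I w (g, k) = 0" by (simp only: wcount_def card.empty)
        then show "l g k = 0" using True g(1) by (simp add: words_def content_def)
      qed
      then have "psize (l g) = 0" if "g \<in> carrier G" "g \<noteq> \<one>" for g using that by (simp add: psize_def)
      then have psz: "psize (l \<one>) = n" and Pg: "\<And>g. g \<in> carrier G \<Longrightarrow> g \<noteq> \<one> \<Longrightarrow> P g = {}"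
        using Lambda_split[OF l] P finite_P[OF l P] by (auto simp: blocks_for_def)
      have par1: "l \<one> \<in> Par" by (rule Lambda_Par[OF l one_closed])
      have P1: "P \<one> = I"
        using P_cover[OF l P] Pg P_subset[OF l P one_closed] by blast
      \<comment> \<open>A partition of \<open>n\<close> without a second row is
        \<open>one_part n\<close>, which is excluded.\<close>
      have l1: "l \<one> 1 \<noteq> 0"
      proof
        assume "l \<one> 1 = 0"
        then have z: "\<forall>k\<ge>1. l \<one> k = 0" using par1 by (auto simp: Par_def antimono_def) (metis One_nat_def le_0_eq)
        then have "l \<one> 0 = n" using psize_eq[OF par1, of 1] psz by simp
        then have "l \<one> = one_part n" using z by (auto simp: one_part_def fun_eq_iff Suc_le_eq)
        then show False using nontriv by simp
      qed
      let ?u = "\<lambda>i. snd (w i)"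
      define K where "K = (\<Prod>g\<in>carrier G - {\<one>}. b g (tab (P g) (l g) ?u))"
      have act_eq: "act y ?t w = K * b \<one> (tab I (l \<one>) (?u \<circ> snd y))" if y: "y \<in> carrier W" for y
      proof -
        have p: "snd y permutes I" by (rule wreath_perm[OF y])
        have "phase (fst y) w = 1"
          unfolding phase_def using True' wreath_coord[OF y] chr_trivial by (intro prod.neutral) auto
        moreover have "w \<circ> snd y \<in> extensional I"
          using True extensional_perm[OF p] by (auto simp: words_def)
        moreover have "\<forall>g\<in>carrier G. \<forall>i\<in>P g. fst ((w \<circ> snd y) i) = g"
        proof (intro ballI)
          fix g i assume g: "g \<in> carrier G" "i \<in> P g"
          then have "g = \<one>" using Pg by blast
          then show "fst ((w \<circ> snd y) i) = g" using g P1 True' perm_mem[OF p] by simp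
        qed
        ultimately have "act y ?t w = (\<Prod>g\<in>carrier G. b g (tab (P g) (l g) (\<lambda>i. snd (w (snd y i)))))"
          by (simp add: act_def tensor_def)
        also have "\<dots> = b \<one> (tab I (l \<one>) (\<lambda>i. snd (w (snd y i)))) *
            (\<Prod>g\<in>carrier G - {\<one>}. b g (tab (P g) (l g) (\<lambda>i. snd (w (snd y i)))))"
          by (subst prod.remove[OF finG one_closed]) (simp add: P1)
        also have "(\<Prod>g\<in>carrier G - {\<one>}. b g (tab (P g) (l g) (\<lambda>i. snd (w (snd y i))))) = K"
          unfolding K_def
        proof (intro prod.cong refl)
          fix g assume "g \<in> carrier G - {\<one>}"
          then have "tab (P g) (l g) (\<lambda>i. snd (w (snd y i))) = tab (P g) (l g) ?u"
            using Pg by (intro tab_cong) auto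
          then show "b g (tab (P g) (l g) (\<lambda>i. snd (w (snd y i)))) = b g (tab (P g) (l g) ?u)" by simp
        qed
        finally show ?thesis by (simp add: comp_def)
      qed
      have "carrier W = (I \<rightarrow>\<^sub>E carrier G) \<times> {p. p permutes I}"
        by (rule Set.set_eqI) (simp only: wreath_carrier mem_Times_iff mem_Collect_eq)
      then have "?f w = (\<Sum>(x, p)\<in>(I \<rightarrow>\<^sub>E carrier G) \<times> {p. p permutes I}. K * b \<one> (tab I (l \<one>) (?u \<circ> p)))"
        unfolding opr_def using act_eq by (intro sum.cong) auto
      also have "\<dots> = (\<Sum>x\<in>I \<rightarrow>\<^sub>E carrier G. K * (\<Sum>p | p permutes I. b \<one> (tab I (l \<one>) (?u \<circ> p))))"
        by (simp add: sum.cartesian_product[symmetric] sum_distrib_left)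
      also have "(\<Sum>p | p permutes I. b \<one> (tab I (l \<one>) (?u \<circ> p))) = 0"
        using onbs_specht[OF l P b one_closed] P1 by (intro specht_symmetrization par1 l1 finite_I) simp
      finally show ?thesis by simp
    qed
  qed
  then show ?thesis unfolding fz by (simp add: fun_eq_iff)
qed

end

section \<open>Fourier analysis on words of cosets\<close>

lemma orthonormal_independent:
  assumes "orthonormal X B" shows "cfun.independent B"
proof -
  have "finite B" using assms by (simp add: orthonormal_def)
  moreover have "u b = 0" if "(\<Sum>b\<in>B. fscale (u b) b) = 0" "b \<in> B" for u b
    using ip_orthonormal_combination[OF assms that(2), of u] that(1) by (simp only: ip_0_left)
  ultimately show ?thesis using cfun.independent_if_scalars_zero[of B] by blast
qed

lemma sum_singleton_times: "(\<Sum>x\<in>{a} \<times> C. f x) = (\<Sum>c\<in>C. f (a, c))"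
  by (rule sum.reindex_bij_witness[where i = "Pair a" and j = snd]) auto

lemma sum_times_singleton: "(\<Sum>x\<in>C \<times> {a}. f x) = (\<Sum>c\<in>C. f (c, a))"
  by (rule sum.reindex_bij_witness[where i = "\<lambda>c. (c, a)" and j = fst]) auto

context wreath_characters
begin

lemma sum_chr_eq_0:
  assumes U: "subgroup U G" and u: "u \<in> U" "chr g u \<noteq> 1"
  shows "(\<Sum>x\<in>U. chr g x) = 0"
proof -
  have UG: "U \<subseteq> carrier G" using U by (rule subgroup.subset)
  have "(\<Sum>x\<in>U. chr g x) = (\<Sum>x\<in>U. chr g (u \<otimes> x))"
    by (rule sum.reindex_bij_witness[where i = "\<lambda>x. u \<otimes> x" and j = "\<lambda>x. inv u \<otimes> x"])
      (use U UG u in \<open>auto simp: m_assoc[symmetric] subgroup.m_closed subgroup.m_inv_closed subset_iff\<close>)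
  also have "\<dots> = chr g u * (\<Sum>x\<in>U. chr g x)"
    unfolding sum_distrib_left using UG u by (intro sum.cong refl chr_mult) auto
  finally show ?thesis using u(2) by simp
qed

lemma chr_orthogonal:
  assumes g: "g \<in> carrier G" "h \<in> carrier G" "g \<noteq> h"
  shows "(\<Sum>x\<in>carrier G. chr g x * cnj (chr h x)) = 0"
proof -
  obtain y where y: "y \<in> carrier G" "chr g y \<noteq> chr h y" using chr_inj[OF g(1,2)] g(3) by blast
  let ?S = "\<Sum>x\<in>carrier G. chr g x * cnj (chr h x)"
  have "?S = (\<Sum>x\<in>carrier G. chr g (y \<otimes> x) * cnj (chr h (y \<otimes> x)))"
    by (rule sum.reindex_bij_witness[where i = "\<lambda>x. y \<otimes> x" and j = "\<lambda>x. inv y \<otimes> x"])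
      (use y in \<open>auto simp: m_assoc[symmetric]\<close>)
  also have "\<dots> = (chr g y * cnj (chr h y)) * ?S"
    unfolding sum_distrib_left using y by (intro sum.cong refl) (simp add: chr_mult)
  finally have "?S = 0 \<or> chr g y * cnj (chr h y) = 1" by auto
  moreover have "chr g y * cnj (chr h y) \<noteq> 1"
  proof
    assume "chr g y * cnj (chr h y) = 1"
    then have "chr g y * (chr h y * cnj (chr h y)) = chr h y" by (simp add: mult_ac)
    then show False using chr_cnj[OF y(1), of h] y(2) by simp
  qed
  ultimately show ?thesis by blast
qed

text \<open>There are as many characters as elements, so the characters form an orthogonal basis.\<close>

lemma chr_dual_orthogonal:
  assumes x: "x \<in> carrier G" and y: "y \<in> carrier G"
  shows "(\<Sum>g\<in>carrier G. chr g x * cnj (chr g y)) = (if x = y then of_nat (order G) else 0)"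
proof -
  define N where "N = real (order G)"
  have N: "N > 0" using finG by (simp add: N_def order_gt_0_iff_finite)
  \<comment> \<open>One over the square root of the group order, the scaling that makes the
    characters orthonormal.\<close>
  define \<gamma> where "\<gamma> = complex_of_real (1 / sqrt N)"
  have \<gamma>: "\<gamma> * cnj \<gamma> * of_real N = 1"
  proof -
    have "\<gamma> * cnj \<gamma> * of_real N = of_real (1 / sqrt N * (1 / sqrt N) * N)"
      by (simp only: \<gamma>_def complex_cnj_complex_of_real of_real_mult)
    also have "1 / sqrt N * (1 / sqrt N) * N = 1" using N by (simp add: field_simps)
    finally show ?thesis by simp
  qed
  define X where "X = (\<lambda>g x. if x \<in> carrier G then \<gamma> * chr g x else 0)"
  define \<delta> where "\<delta> = (\<lambda>(y :: 'g) (x :: 'g). if x = y then 1 else 0 :: complex)"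
  let ?B = "X ` carrier G"
  let ?T = "\<delta> ` carrier G"
  have ipX: "ip (carrier G) (X g) (X h) = (if g = h then 1 else 0)"
    if "g \<in> carrier G" "h \<in> carrier G" for g h
  proof -
    have "ip (carrier G) (X g) (X h) = \<gamma> * cnj \<gamma> * (\<Sum>x\<in>carrier G. chr g x * cnj (chr h x))"
      unfolding ip_def sum_distrib_left by (intro sum.cong refl) (simp add: X_def mult_ac)
    also have "\<dots> = (if g = h then 1 else 0)"
      using chr_orthogonal[OF that] \<gamma> by (simp add: chr_cnj N_def order_def)
    finally show ?thesis .
  qed
  have injX: "inj_on X (carrier G)"
  proof (rule inj_onI)
    fix g h assume gh: "g \<in> carrier G" "h \<in> carrier G" "X g = X h"
    then have "ip (carrier G) (X g) (X h) = 1" using ipX[of h h] by simp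
    then show "g = h" using ipX[OF gh(1,2)] by (simp split: if_splits)
  qed
  have orth: "orthonormal (carrier G) ?B"
    unfolding orthonormal_def using finG ipX injX by (auto dest: inj_onD)
  have BT: "?B \<subseteq> cfun.span ?T"
  proof (rule image_subsetI)
    fix g assume "g \<in> carrier G"
    have "X g = (\<Sum>z\<in>carrier G. fscale (X g z) (\<delta> z))"
    proof
      fix w :: 'g
      have "(\<Sum>z\<in>carrier G. fscale (X g z) (\<delta> z)) w = (\<Sum>z\<in>carrier G. if z = w then X g z else 0)"
        unfolding sum_fun_apply by (intro sum.cong refl) (simp add: fscale_def \<delta>_def)
      also have "\<dots> = X g w" using finG by (subst sum.delta) (auto simp: X_def)
      finally show "X g w = (\<Sum>z\<in>carrier G. fscale (X g z) (\<delta> z)) w" by simp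
    qed
    also have "\<dots> \<in> cfun.span ?T" by (intro cfun.span_sum cfun.span_scale cfun.span_base imageI)
    finally show "X g \<in> cfun.span ?T" .
  qed
  \<comment> \<open>Otherwise \<open>\<delta> y\<close> together with the characters would be
    \<open>order G + 1\<close> independent vectors in a space spanned by \<open>order G\<close>
    indicator functions.\<close>
  have "\<delta> y \<in> cfun.span ?B"
  proof (rule ccontr)
    assume n: "\<delta> y \<notin> cfun.span ?B"
    then have "cfun.independent (insert (\<delta> y) ?B)"
      using orthonormal_independent[OF orth] by (intro cfun.independent_insertI)
    moreover have "insert (\<delta> y) ?B \<subseteq> cfun.span ?T"
      using BT cfun.span_base[of "\<delta> y" ?T] y by auto
    ultimately have "card (insert (\<delta> y) ?B) \<le> card ?T"
      using cfun.independent_span_bound[of ?T] finG by blast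
    moreover have "\<delta> y \<notin> ?B" using n cfun.span_base by blast
    ultimately have "Suc (card (carrier G)) \<le> card ?T" using finG injX by (simp add: card_image)
    then show False using card_image_le[OF finG, of \<delta>] by simp
  qed
  \<comment> \<open>The coefficient of \<open>\<delta> y\<close> at a character is a conjugate value
    at \<open>y\<close>; evaluating the expansion at \<open>x\<close> gives the claim up to
    scaling.\<close>
  from orthonormal_expansion[OF orth this]
  have "\<delta> y x = (\<Sum>b\<in>?B. fscale (ip (carrier G) (\<delta> y) b) b) x" by simp
  also have "\<dots> = (\<Sum>g\<in>carrier G. ip (carrier G) (\<delta> y) (X g) * X g x)"
    unfolding sum_fun_apply sum.reindex[OF injX] by (simp add: fscale_def)
  also have "\<dots> = (\<Sum>g\<in>carrier G. \<gamma> * cnj \<gamma> * (chr g x * cnj (chr g y)))"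
  proof (intro sum.cong refl)
    fix g
    have "ip (carrier G) (\<delta> y) (X g) = (\<Sum>z\<in>carrier G. if z = y then cnj (X g z) else 0)"
      unfolding ip_def by (intro sum.cong refl) (simp add: \<delta>_def)
    also have "\<dots> = cnj (X g y)" using finG y by (subst sum.delta) auto
    finally show "ip (carrier G) (\<delta> y) (X g) * X g x = \<gamma> * cnj \<gamma> * (chr g x * cnj (chr g y))"
      using x y by (simp add: X_def mult_ac)
  qed
  finally have *: "\<gamma> * cnj \<gamma> * (\<Sum>g\<in>carrier G. chr g x * cnj (chr g y)) = (if x = y then 1 else 0)"
    by (simp only: sum_distrib_left \<delta>_def)
  have "(\<gamma> * cnj \<gamma> * of_real N) * (\<Sum>g\<in>carrier G. chr g x * cnj (chr g y)) =
      of_real N * (\<gamma> * cnj \<gamma> * (\<Sum>g\<in>carrier G. chr g x * cnj (chr g y)))"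
    by (simp only: mult_ac)
  also have "\<dots> = (if x = y then of_nat (order G) else 0)"
    unfolding * by (simp add: N_def)
  finally show ?thesis by (simp only: \<gamma> mult_1_left)
qed

section \<open>Characters of the quotients by subgroups\<close>

abbreviation ann :: "'g set \<Rightarrow> 'g set" where "ann U \<equiv> annihilator G \<theta> U"

lemma ann_iff: "U \<subseteq> carrier G \<Longrightarrow> g \<in> ann U \<longleftrightarrow> g \<in> carrier G \<and> (\<forall>u\<in>U. chr g u = 1)"
  by (auto simp: annihilator_def chr_def)

text \<open>A character in the annihilator of \<open>U\<close> is constant on the cosets of
  \<open>U\<close>, so for these the choice of the representative does not matter; see
  \<open>chrc_eq\<close>.\<close>

definition chrc :: "'g \<Rightarrow> 'g set \<Rightarrow> complex" where
  "chrc g c = chr g (SOME a. a \<in> c)"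

lemma chrc_eq:
  assumes U: "subgroup U G" and c: "c \<in> rcosets U" and g: "g \<in> ann U" and a: "a \<in> c"
  shows "chrc g c = chr g a"
proof -
  have UG: "U \<subseteq> carrier G" using U by (rule subgroup.subset)
  obtain b where b: "b \<in> carrier G" "c = U #> b" using c by (auto simp: RCOSETS_def)
  have "chr g x = chr g b" if "x \<in> c" for x
  proof -
    obtain u where "u \<in> U" "x = u \<otimes> b" using \<open>x \<in> c\<close> b(2) by (auto simp: r_coset_def)
    then show ?thesis using g ann_iff[OF UG] b(1) UG by (auto simp: chr_mult)
  qed
  moreover have "(SOME a. a \<in> c) \<in> c" using a by (rule someI)
  ultimately show ?thesis using a by (simp add: chrc_def)
qed

lemma coset_nonempty:
  assumes U: "subgroup U G" and c: "c \<in> rcosets U"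
  obtains a where "a \<in> c" "a \<in> carrier G" "c = U #> a"
proof -
  obtain b where b: "b \<in> carrier G" "c = U #> b" using c by (auto simp: RCOSETS_def)
  moreover have "b \<in> c" using rcos_self[OF b(1) U] b(2) by simp
  ultimately show ?thesis using that by blast
qed

lemma coset_shift:
  assumes U: "subgroup U G" and c: "c \<in> rcosets U" and x: "x \<in> carrier G"
  shows "c #> x \<in> rcosets U" "g \<in> ann U \<Longrightarrow> chrc g (c #> x) = chrc g c * chr g x"
proof -
  have UG: "U \<subseteq> carrier G" using U by (rule subgroup.subset)
  obtain a where a: "a \<in> c" "a \<in> carrier G" "c = U #> a" using coset_nonempty[OF U c] .
  have "c #> x = U #> (a \<otimes> x)" using a x UG by (simp add: coset_mult_assoc)
  then show cx: "c #> x \<in> rcosets U" using a x by (auto simp: RCOSETS_def)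
  assume g: "g \<in> ann U"
  have "a \<otimes> x \<in> c #> x" using a(1) by (auto simp: r_coset_def)
  then show "chrc g (c #> x) = chrc g c * chr g x"
    using chrc_eq[OF U cx g] chrc_eq[OF U c g a(1)] chr_mult[OF a(2) x] by simp
qed

lemma coset_shift_inv:
  assumes U: "subgroup U G" and c: "c \<in> rcosets U" and x: "x \<in> carrier G"
  shows "(c #> x) #> inv x = c" "(c #> inv x) #> x = c"
proof -
  have "c \<subseteq> carrier G" using subgroup.rcosets_carrier[OF U is_group c] .
  then show "(c #> x) #> inv x = c" "(c #> inv x) #> x = c" using x by (simp_all add: coset_mult_assoc)
qed

lemma norm_chrc:
  assumes U: "subgroup U G" and c: "c \<in> rcosets U" and g: "g \<in> ann U"
  shows "chrc g c * cnj (chrc g c) = 1"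
proof -
  obtain a where a: "a \<in> c" "a \<in> carrier G" "c = U #> a" using coset_nonempty[OF U c] .
  then show ?thesis using chrc_eq[OF U c g a(1)] chr_cnj[OF a(2)] by simp
qed

lemma coset_orthogonal:
  assumes U: "subgroup U G" and g: "g \<in> ann U" "h \<in> ann U"
  shows "(\<Sum>c\<in>rcosets U. chrc g c * cnj (chrc h c)) = (if g = h then of_nat (card (rcosets U)) else 0)"
proof (cases "g = h")
  case True
  then show ?thesis using norm_chrc[OF U _ g(1)] by simp
next
  case False
  have gG: "g \<in> carrier G" "h \<in> carrier G" using g by (auto simp: annihilator_def)
  obtain y where y: "y \<in> carrier G" "chr g y \<noteq> chr h y" using chr_inj[OF gG] False by blast
  let ?S = "\<Sum>c\<in>rcosets U. chrc g c * cnj (chrc h c)"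
  have "?S = (\<Sum>c\<in>rcosets U. chrc g (c #> y) * cnj (chrc h (c #> y)))"
    by (rule sum.reindex_bij_witness[where i = "\<lambda>c. c #> y" and j = "\<lambda>c. c #> inv y"])
      (use coset_shift(1)[OF U] coset_shift_inv[OF U] y in auto)
  also have "\<dots> = (chr g y * cnj (chr h y)) * ?S"
    unfolding sum_distrib_left using coset_shift(2)[OF U _ y(1)] g
    by (intro sum.cong refl) (simp add: mult_ac)
  finally have "?S = 0 \<or> chr g y * cnj (chr h y) = 1" by auto
  moreover have "chr g y * cnj (chr h y) \<noteq> 1"
  proof
    assume "chr g y * cnj (chr h y) = 1"
    then have "chr g y * (chr h y * cnj (chr h y)) = chr h y" by (simp add: mult_ac)
    then show False using chr_cnj[OF y(1), of h] y(2) by simp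
  qed
  ultimately show ?thesis using False by auto
qed

text \<open>For different cosets, the sum over the annihilator is cut out of the sum over all
  characters by a weight, the conjugate sum over \<open>U\<close>, which is \<open>card U\<close> on
  the annihilator and 0 elsewhere. Exchanging the sums leaves the orthogonality relation of
  \<open>G\<close> at \<open>a\<close> and \<open>u \<otimes> b\<close>, which never
  coincide.\<close>

lemma coset_dual_orthogonal:
  assumes U: "subgroup U G" and c: "c \<in> rcosets U" "d \<in> rcosets U"
  shows "(\<Sum>g\<in>ann U. chrc g c * cnj (chrc g d)) = (if c = d then of_nat (card (ann U)) else 0)"
proof (cases "c = d")
  case True
  then show ?thesis using norm_chrc[OF U c(1)] by simp
next
  case False
  have UG: "U \<subseteq> carrier G" using U by (rule subgroup.subset)
  obtain a where a: "a \<in> c" "a \<in> carrier G" "c = U #> a" using coset_nonempty[OF U c(1)] .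
  obtain b where b: "b \<in> d" "b \<in> carrier G" "d = U #> b" using coset_nonempty[OF U c(2)] .
  have ne: "a \<noteq> u \<otimes> b" if "u \<in> U" for u
  proof
    assume "a = u \<otimes> b"
    then have "a \<in> U #> b" using that by (auto simp: r_coset_def)
    then show False using repr_independence[OF _ b(2) U] a(3) b(3) False by metis
  qed
  have "(\<Sum>g\<in>carrier G. chr g a * cnj (chr g b) * (\<Sum>u\<in>U. cnj (chr g u))) =
      (\<Sum>u\<in>U. \<Sum>g\<in>carrier G. chr g a * cnj (chr g (u \<otimes> b)))"
    unfolding sum_distrib_left using UG b(2)
    by (subst sum.swap) (auto intro!: sum.cong simp: chr_mult subset_iff mult_ac)
  also have "\<dots> = 0"
  proof (rule sum.neutral, rule ballI)
    fix u assume u: "u \<in> U"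
    then have "u \<otimes> b \<in> carrier G" using UG b(2) by auto
    then show "(\<Sum>g\<in>carrier G. chr g a * cnj (chr g (u \<otimes> b))) = 0"
      using chr_dual_orthogonal[OF a(2)] ne[OF u] by simp
  qed
  finally have zero: "(\<Sum>g\<in>carrier G. chr g a * cnj (chr g b) * (\<Sum>u\<in>U. cnj (chr g u))) = 0" .
  have inner: "(\<Sum>u\<in>U. cnj (chr g u)) = (if g \<in> ann U then of_nat (card U) else 0)" if g: "g \<in> carrier G" for g
  proof (cases "g \<in> ann U")
    case True
    then show ?thesis using ann_iff[OF UG] by simp
  next
    case False
    then obtain u where "u \<in> U" "chr g u \<noteq> 1" using ann_iff[OF UG] g by blast
    then have "cnj (\<Sum>u\<in>U. chr g u) = 0" using sum_chr_eq_0[OF U] by simp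
    then show ?thesis using False by simp
  qed
  have "(\<Sum>g\<in>carrier G. chr g a * cnj (chr g b) * (\<Sum>u\<in>U. cnj (chr g u))) =
      (\<Sum>g\<in>ann U. chr g a * cnj (chr g b) * of_nat (card U))"
    using inner finG by (intro sum.mono_neutral_cong_right) (auto simp: annihilator_def)
  also have "\<dots> = of_nat (card U) * (\<Sum>g\<in>ann U. chrc g c * cnj (chrc g d))"
    unfolding sum_distrib_left using chrc_eq[OF U c(1) _ a(1)] chrc_eq[OF U c(2) _ b(1)]
    by (intro sum.cong refl) (simp add: mult_ac)
  finally have "of_nat (card U) * (\<Sum>g\<in>ann U. chrc g c * cnj (chrc g d)) = 0"
    using zero by simp
  moreover have "card U \<noteq> 0"
    using subgroup.one_closed[OF U] finite_subset[OF UG finG] by auto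
  ultimately show ?thesis using False by simp
qed

section \<open>Fourier transform between coset words and coloured words\<close>

definition Zs :: "(nat \<Rightarrow> 'g set \<times> nat) \<Rightarrow> (nat \<Rightarrow> ('g set \<times> nat) \<times> 'g set) set" where
  "Zs \<rho> = (\<Pi>\<^sub>E i\<in>I. {\<rho> i} \<times> rcosets (fst (\<rho> i)))"

text \<open>\<open>\<rho>\<close> assigns to each index its row, a pair of a subgroup and a row
  number. Over a fixed \<open>\<rho>\<close>, \<open>Zs\<close> runs through the choices of cosets
  of these subgroups and \<open>Xs\<close> through the choices of characters of the quotients, and
  the two are dual to each other.\<close>

definition Xs :: "(nat \<Rightarrow> 'g set \<times> nat) \<Rightarrow> (nat \<Rightarrow> 'g \<times> 'g set \<times> nat) set" where
  "Xs \<rho> = (\<Pi>\<^sub>E i\<in>I. ann (fst (\<rho> i)) \<times> {\<rho> i})"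

text \<open>Here the words themselves are moved, so the inverse permutation occurs, in contrast to
  \<open>act\<close>, which moves functions.\<close>

definition zact :: "(nat \<Rightarrow> 'g) \<times> (nat \<Rightarrow> nat) \<Rightarrow> (nat \<Rightarrow> ('g set \<times> nat) \<times> 'g set)
    \<Rightarrow> nat \<Rightarrow> ('g set \<times> nat) \<times> 'g set" where
  "zact y z = (\<lambda>i\<in>I. (fst (z (inv_into UNIV (snd y) i)), snd (z (inv_into UNIV (snd y) i)) #> fst y i))"

text \<open>The matrix of the Fourier transform of the product of the quotient groups.\<close>

definition ew :: "(nat \<Rightarrow> 'g \<times> 'g set \<times> nat) \<Rightarrow> (nat \<Rightarrow> ('g set \<times> nat) \<times> 'g set) \<Rightarrow> complex" where
  "ew w z = (\<Prod>i\<in>I. chrc (fst (w i)) (snd (z i)))"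

text \<open>The matrix entry of \<open>opr c\<close> at the words \<open>w'\<close> and
  \<open>w\<close>; see \<open>kills_iff_kernel\<close>. The corresponding entry for the permutation
  module on coset words is \<open>zsum\<close>.\<close>

definition wkernel :: "((nat \<Rightarrow> 'g) \<times> (nat \<Rightarrow> nat) \<Rightarrow> complex) \<Rightarrow> (nat \<Rightarrow> 'g \<times> 'r) \<Rightarrow> (nat \<Rightarrow> 'g \<times> 'r) \<Rightarrow> complex" where
  "wkernel c w' w = (\<Sum>y\<in>carrier W. if w' \<circ> snd y = w then c y * phase (fst y) w' else 0)"

definition zsum :: "((nat \<Rightarrow> 'g) \<times> (nat \<Rightarrow> nat) \<Rightarrow> complex) \<Rightarrow> (nat \<Rightarrow> ('g set \<times> nat) \<times> 'g set)
    \<Rightarrow> (nat \<Rightarrow> ('g set \<times> nat) \<times> 'g set) \<Rightarrow> complex" where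
  "zsum c z z' = (\<Sum>y\<in>carrier W. if zact y z = z' then c y else 0)"

lemma finite_ann: "finite (ann U)"
  using finG by (rule finite_subset[rotated]) (auto simp: annihilator_def)

lemma finite_rcosets: "subgroup U G \<Longrightarrow> finite (rcosets U)"
  using finG subgroup.rcosets_carrier[OF _ is_group]
  by (intro finite_subset[of "rcosets U" "Pow (carrier G)"]) auto

lemma finite_Zs: "(\<And>i. i \<in> I \<Longrightarrow> subgroup (fst (\<rho> i)) G) \<Longrightarrow> finite (Zs \<rho>)"
  unfolding Zs_def using finite_rcosets by (intro finite_PiE) auto

lemma finite_Xs: "finite (Xs \<rho>)"
  unfolding Xs_def using finite_ann by (intro finite_PiE) auto

lemma zact_mem_Zs_iff:
  assumes y: "y \<in> carrier W" and z: "z \<in> Zs \<rho>" and sub: "\<And>i. i \<in> I \<Longrightarrow> subgroup (fst (\<rho> i)) G"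
  shows "zact y z \<in> Zs \<rho>' \<longleftrightarrow> (\<forall>i\<in>I. \<rho>' (snd y i) = \<rho> i)"
proof -
  have p: "snd y permutes I" by (rule wreath_perm[OF y])
  have zi: "fst (z i) = \<rho> i" "snd (z i) \<in> rcosets (fst (\<rho> i))" if "i \<in> I" for i
    using PiE_mem[OF z[unfolded Zs_def] that] by auto
  have "zact y z \<in> Zs \<rho>' \<longleftrightarrow> (\<forall>i\<in>I. \<rho> (inv_into UNIV (snd y) i) = \<rho>' i)"
  proof
    assume *: "zact y z \<in> Zs \<rho>'"
    show "\<forall>i\<in>I. \<rho> (inv_into UNIV (snd y) i) = \<rho>' i"
    proof
      fix i assume i: "i \<in> I"
      have "zact y z i \<in> {\<rho>' i} \<times> rcosets (fst (\<rho>' i))" using PiE_mem[OF *[unfolded Zs_def] i] .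
      then show "\<rho> (inv_into UNIV (snd y) i) = \<rho>' i"
        using zi(1)[OF perm_inv_mem[OF p i]] i by (simp add: zact_def)
    qed
  next
    assume *: "\<forall>i\<in>I. \<rho> (inv_into UNIV (snd y) i) = \<rho>' i"
    show "zact y z \<in> Zs \<rho>'"
      unfolding Zs_def
    proof (rule PiE_I)
      fix i assume i: "i \<in> I"
      let ?j = "inv_into UNIV (snd y) i"
      have j: "?j \<in> I" by (rule perm_inv_mem[OF p i])
      have "snd (z ?j) #> fst y i \<in> rcosets (fst (\<rho> ?j))"
        by (rule coset_shift(1)[OF sub[OF j] zi(2)[OF j] wreath_coord[OF y i]])
      then show "zact y z i \<in> {\<rho>' i} \<times> rcosets (fst (\<rho>' i))"
        using * i zi(1)[OF j] by (simp add: zact_def)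
    qed (simp add: zact_def)
  qed
  also have "\<dots> \<longleftrightarrow> (\<forall>i\<in>I. \<rho>' (snd y i) = \<rho> i)"
  proof (intro iffI ballI)
    fix i assume *: "\<forall>i\<in>I. \<rho> (inv_into UNIV (snd y) i) = \<rho>' i" and i: "i \<in> I"
    show "\<rho>' (snd y i) = \<rho> i"
      using bspec[OF * perm_mem[OF p i]] permutes_inverses(2)[OF p, of i] by simp
  next
    fix i assume *: "\<forall>i\<in>I. \<rho>' (snd y i) = \<rho> i" and i: "i \<in> I"
    show "\<rho> (inv_into UNIV (snd y) i) = \<rho>' i"
      using bspec[OF * perm_inv_mem[OF p i]] permutes_inverses(1)[OF p, of i] by simp
  qed
  finally show ?thesis .
qed

lemma comp_mem_Xs_iff:
  assumes y: "y \<in> carrier W" and w': "w' \<in> Xs \<rho>'"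
  shows "w' \<circ> snd y \<in> Xs \<rho> \<longleftrightarrow> (\<forall>i\<in>I. \<rho>' (snd y i) = \<rho> i)"
proof -
  have p: "snd y permutes I" by (rule wreath_perm[OF y])
  have wi: "fst (w' i) \<in> ann (fst (\<rho>' i))" "snd (w' i) = \<rho>' i" if "i \<in> I" for i
    using PiE_mem[OF w'[unfolded Xs_def] that] by auto
  have ext: "w' \<circ> snd y \<in> extensional I"
    using w' extensional_perm[OF p, of w'] by (simp add: Xs_def PiE_def)
  have "w' \<circ> snd y \<in> Xs \<rho> \<longleftrightarrow> (\<forall>i\<in>I. w' (snd y i) \<in> ann (fst (\<rho> i)) \<times> {\<rho> i})"
    unfolding Xs_def PiE_iff using ext by simp
  also have "\<dots> \<longleftrightarrow> (\<forall>i\<in>I. \<rho>' (snd y i) = \<rho> i)"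
    using wi[OF perm_mem[OF p]] by (fastforce simp: mem_Times_iff)
  finally show ?thesis .
qed

text \<open>The Fourier kernel intertwines the two actions: translating the coset at
  \<open>i\<close> multiplies by a character value, and these values together form the
  phase.\<close>

lemma ew_zact:
  assumes y: "y \<in> carrier W" and z: "z \<in> Zs \<rho>" and sub: "\<And>i. i \<in> I \<Longrightarrow> subgroup (fst (\<rho> i)) G"
    and w': "w' \<in> Xs \<rho>'" and rows: "\<forall>i\<in>I. \<rho>' (snd y i) = \<rho> i"
  shows "ew w' (zact y z) = phase (fst y) w' * ew (w' \<circ> snd y) z"
proof -
  have p: "snd y permutes I" by (rule wreath_perm[OF y])
  let ?p' = "inv_into UNIV (snd y)"
  have zi: "snd (z i) \<in> rcosets (fst (\<rho> i))" if "i \<in> I" for i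
    using PiE_mem[OF z[unfolded Zs_def] that] by auto
  have wi: "fst (w' i) \<in> ann (fst (\<rho>' i))" if "i \<in> I" for i
    using PiE_mem[OF w'[unfolded Xs_def] that] by auto
  have "ew w' (zact y z) = (\<Prod>i\<in>I. chr (fst (w' i)) (fst y i) * chrc (fst (w' i)) (snd (z (?p' i))))"
    unfolding ew_def
  proof (intro prod.cong refl)
    fix i assume i: "i \<in> I"
    have j: "?p' i \<in> I" by (rule perm_inv_mem[OF p i])
    have "\<rho>' i = \<rho> (?p' i)" using bspec[OF rows j] permutes_inverses(1)[OF p, of i] by simp
    then have "fst (w' i) \<in> ann (fst (\<rho> (?p' i)))" using wi[OF i] by simp
    then have "chrc (fst (w' i)) (snd (z (?p' i)) #> fst y i) =
        chrc (fst (w' i)) (snd (z (?p' i))) * chr (fst (w' i)) (fst y i)"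
      by (rule coset_shift(2)[OF sub[OF j] zi[OF j] wreath_coord[OF y i]])
    then show "chrc (fst (w' i)) (snd (zact y z i)) =
        chr (fst (w' i)) (fst y i) * chrc (fst (w' i)) (snd (z (?p' i)))"
      using i by (simp add: zact_def)
  qed
  also have "\<dots> = phase (fst y) w' * (\<Prod>i\<in>I. chrc (fst (w' i)) (snd (z (?p' i))))"
    by (simp add: phase_def prod.distrib)
  also have "(\<Prod>i\<in>I. chrc (fst (w' i)) (snd (z (?p' i)))) = ew (w' \<circ> snd y) z"
    unfolding ew_def by (subst prod.permute[OF p]) (simp add: permutes_inverses(2)[OF p])
  finally show ?thesis .
qed

text \<open>A matrix identity: Fourier transform times \<open>zsum\<close> equals
  \<open>wkernel\<close> times Fourier transform. On both sides only those group elements contribute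
  whose permutation takes \<open>\<rho>\<close> to \<open>\<rho>'\<close>.\<close>

lemma ew_kernel_zsum:
  assumes z: "z \<in> Zs \<rho>" and sub: "\<And>i. i \<in> I \<Longrightarrow> subgroup (fst (\<rho> i)) G"
    and sub': "\<And>i. i \<in> I \<Longrightarrow> subgroup (fst (\<rho>' i)) G" and w': "w' \<in> Xs \<rho>'"
  shows "(\<Sum>z'\<in>Zs \<rho>'. ew w' z' * zsum c z z') = (\<Sum>w\<in>Xs \<rho>. wkernel c w' w * ew w z)"
proof -
  have "(\<Sum>z'\<in>Zs \<rho>'. ew w' z' * zsum c z z') =
      (\<Sum>y\<in>carrier W. \<Sum>z'\<in>Zs \<rho>'. if zact y z = z' then ew w' z' * c y else 0)"
    unfolding zsum_def sum_distrib_left by (subst sum.swap) (auto intro!: sum.cong)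
  also have "\<dots> = (\<Sum>y\<in>carrier W. if zact y z \<in> Zs \<rho>' then ew w' (zact y z) * c y else 0)"
    using finite_Zs[OF sub'] by (intro sum.cong refl) (simp add: sum.delta')
  also have "\<dots> = (\<Sum>y\<in>carrier W. if w' \<circ> snd y \<in> Xs \<rho> then c y * phase (fst y) w' * ew (w' \<circ> snd y) z else 0)"
    using zact_mem_Zs_iff[OF _ z sub] comp_mem_Xs_iff[OF _ w'] ew_zact[OF _ z sub w']
    by (intro sum.cong refl) (simp add: mult_ac)
  also have "\<dots> = (\<Sum>y\<in>carrier W. \<Sum>w\<in>Xs \<rho>. if w' \<circ> snd y = w then c y * phase (fst y) w' * ew w z else 0)"
    using finite_Xs by (intro sum.cong refl) (simp add: sum.delta')
  also have "\<dots> = (\<Sum>w\<in>Xs \<rho>. wkernel c w' w * ew w z)"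
    unfolding wkernel_def sum_distrib_right by (subst sum.swap) (auto intro!: sum.cong)
  finally show ?thesis .
qed

lemma ew_orthogonal:
  assumes sub: "\<And>i. i \<in> I \<Longrightarrow> subgroup (fst (\<rho> i)) G" and u: "u \<in> Xs \<rho>" and w: "w \<in> Xs \<rho>"
  shows "(\<Sum>z\<in>Zs \<rho>. ew u z * cnj (ew w z)) =
    (if u = w then \<Prod>i\<in>I. of_nat (card (rcosets (fst (\<rho> i)))) else 0)"
proof -
  have ui: "fst (u i) \<in> ann (fst (\<rho> i))" "snd (u i) = \<rho> i" if "i \<in> I" for i
    using PiE_mem[OF u[unfolded Xs_def] that] by auto
  have wi: "fst (w i) \<in> ann (fst (\<rho> i))" "snd (w i) = \<rho> i" if "i \<in> I" for i
    using PiE_mem[OF w[unfolded Xs_def] that] by auto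
  have "(\<Sum>z\<in>Zs \<rho>. ew u z * cnj (ew w z)) =
      (\<Sum>z\<in>Zs \<rho>. \<Prod>i\<in>I. chrc (fst (u i)) (snd (z i)) * cnj (chrc (fst (w i)) (snd (z i))))"
    by (simp add: ew_def prod.distrib cnj_prod)
  also have "\<dots> = (\<Prod>i\<in>I. \<Sum>x\<in>{\<rho> i} \<times> rcosets (fst (\<rho> i)). chrc (fst (u i)) (snd x) * cnj (chrc (fst (w i)) (snd x)))"
    unfolding Zs_def using finite_rcosets[OF sub] by (subst prod_sum_PiE) auto
  also have "\<dots> = (\<Prod>i\<in>I. if fst (u i) = fst (w i) then of_nat (card (rcosets (fst (\<rho> i)))) else 0)"
    using coset_orthogonal[OF sub ui(1) wi(1)]
    by (intro prod.cong refl) (simp add: sum_singleton_times)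
  also have "\<dots> = (if u = w then \<Prod>i\<in>I. of_nat (card (rcosets (fst (\<rho> i)))) else 0)"
  proof (cases "u = w")
    case False
    have "\<exists>i\<in>I. fst (u i) \<noteq> fst (w i)"
    proof (rule ccontr)
      assume "\<not> ?thesis"
      then have "u i = w i" if "i \<in> I" for i using ui(2) wi(2) that by (simp add: prod_eq_iff)
      moreover have "u \<in> extensional I" "w \<in> extensional I" using u w by (auto simp: Xs_def PiE_def)
      ultimately have "u = w" by (intro extensionalityI[of u I w])
      then show False using False by simp
    qed
    then show ?thesis using False by (auto intro!: prod_zero)
  qed simp
  finally show ?thesis .
qed

lemma ew_dual_orthogonal:
  assumes sub: "\<And>i. i \<in> I \<Longrightarrow> subgroup (fst (\<rho> i)) G" and z: "z \<in> Zs \<rho>" and z': "z' \<in> Zs \<rho>"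
  shows "(\<Sum>w\<in>Xs \<rho>. ew w z * cnj (ew w z')) =
    (if z = z' then \<Prod>i\<in>I. of_nat (card (ann (fst (\<rho> i)))) else 0)"
proof -
  have zi: "fst (z i) = \<rho> i" "snd (z i) \<in> rcosets (fst (\<rho> i))" if "i \<in> I" for i
    using PiE_mem[OF z[unfolded Zs_def] that] by auto
  have zi': "fst (z' i) = \<rho> i" "snd (z' i) \<in> rcosets (fst (\<rho> i))" if "i \<in> I" for i
    using PiE_mem[OF z'[unfolded Zs_def] that] by auto
  have "(\<Sum>w\<in>Xs \<rho>. ew w z * cnj (ew w z')) =
      (\<Sum>w\<in>Xs \<rho>. \<Prod>i\<in>I. chrc (fst (w i)) (snd (z i)) * cnj (chrc (fst (w i)) (snd (z' i))))"
    by (simp add: ew_def prod.distrib cnj_prod)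
  also have "\<dots> = (\<Prod>i\<in>I. \<Sum>x\<in>ann (fst (\<rho> i)) \<times> {\<rho> i}. chrc (fst x) (snd (z i)) * cnj (chrc (fst x) (snd (z' i))))"
    unfolding Xs_def using finite_ann by (subst prod_sum_PiE) auto
  also have "\<dots> = (\<Prod>i\<in>I. if snd (z i) = snd (z' i) then of_nat (card (ann (fst (\<rho> i)))) else 0)"
    using coset_dual_orthogonal[OF sub zi(2) zi'(2)]
    by (intro prod.cong refl) (simp add: sum_times_singleton)
  also have "\<dots> = (if z = z' then \<Prod>i\<in>I. of_nat (card (ann (fst (\<rho> i)))) else 0)"
  proof (cases "z = z'")
    case False
    have "\<exists>i\<in>I. snd (z i) \<noteq> snd (z' i)"
    proof (rule ccontr)
      assume "\<not> ?thesis"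
      then have "z i = z' i" if "i \<in> I" for i using zi(1) zi'(1) that by (simp add: prod_eq_iff)
      moreover have "z \<in> extensional I" "z' \<in> extensional I" using z z' by (auto simp: Zs_def PiE_def)
      ultimately have "z = z'" by (intro extensionalityI[of z I z'])
      then show False using False by simp
    qed
    then show ?thesis using False by (auto intro!: prod_zero)
  qed simp
  finally show ?thesis .
qed

lemma one_in_ann: "U \<subseteq> carrier G \<Longrightarrow> \<one> \<in> ann U"
  using ann_iff chr_trivial by auto

text \<open>The Fourier matrices are invertible: multiplying the identity of
  \<open>ew_kernel_zsum\<close> by the conjugate transform on one side isolates a single entry of
  \<open>zsum\<close>, and on the other side a single entry of \<open>wkernel\<close>.\<close>

lemma kernel_zero_iff_zsum_zero:
  assumes sub: "\<And>i. i \<in> I \<Longrightarrow> subgroup (fst (\<rho> i)) G" and sub': "\<And>i. i \<in> I \<Longrightarrow> subgroup (fst (\<rho>' i)) G"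
  shows "(\<forall>w'\<in>Xs \<rho>'. \<forall>w\<in>Xs \<rho>. wkernel c w' w = 0) \<longleftrightarrow> (\<forall>z\<in>Zs \<rho>. \<forall>z'\<in>Zs \<rho>'. zsum c z z' = 0)"
proof
  assume K: "\<forall>w'\<in>Xs \<rho>'. \<forall>w\<in>Xs \<rho>. wkernel c w' w = 0"
  show "\<forall>z\<in>Zs \<rho>. \<forall>z'\<in>Zs \<rho>'. zsum c z z' = 0"
  proof (intro ballI)
    fix z z' assume z: "z \<in> Zs \<rho>" and z': "z' \<in> Zs \<rho>'"
    have M: "(\<Sum>x\<in>Zs \<rho>'. ew w' x * zsum c z x) = 0" if "w' \<in> Xs \<rho>'" for w'
      using ew_kernel_zsum[OF z sub sub' that, of c] K that by simp
    have "0 = (\<Sum>w'\<in>Xs \<rho>'. (\<Sum>x\<in>Zs \<rho>'. ew w' x * zsum c z x) * cnj (ew w' z'))"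
      using M by simp
    also have "\<dots> = (\<Sum>x\<in>Zs \<rho>'. (\<Sum>w'\<in>Xs \<rho>'. ew w' x * cnj (ew w' z')) * zsum c z x)"
      unfolding sum_distrib_right by (subst sum.swap) (simp add: mult_ac)
    also have "\<dots> = (\<Sum>x\<in>Zs \<rho>'. if x = z' then (\<Prod>i\<in>I. of_nat (card (ann (fst (\<rho>' i))))) * zsum c z x else 0)"
      using ew_dual_orthogonal[OF sub' _ z'] by (intro sum.cong refl) simp
    also have "\<dots> = (\<Prod>i\<in>I. of_nat (card (ann (fst (\<rho>' i))))) * zsum c z z'"
      using finite_Zs[OF sub'] z' by (subst sum.delta) auto
    finally have "(\<Prod>i\<in>I. complex_of_nat (card (ann (fst (\<rho>' i))))) * zsum c z z' = 0" by simp
    moreover have "card (ann (fst (\<rho>' i))) \<noteq> 0" if "i \<in> I" for i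
      using one_in_ann[OF subgroup.subset[OF sub'[OF that]]] finite_ann by auto
    ultimately show "zsum c z z' = 0" by simp
  qed
next
  assume Z: "\<forall>z\<in>Zs \<rho>. \<forall>z'\<in>Zs \<rho>'. zsum c z z' = 0"
  show "\<forall>w'\<in>Xs \<rho>'. \<forall>w\<in>Xs \<rho>. wkernel c w' w = 0"
  proof (intro ballI)
    fix w' w assume w': "w' \<in> Xs \<rho>'" and w: "w \<in> Xs \<rho>"
    have M: "(\<Sum>x\<in>Xs \<rho>. wkernel c w' x * ew x z) = 0" if "z \<in> Zs \<rho>" for z
      using ew_kernel_zsum[OF that sub sub' w', of c] Z that by simp
    have "0 = (\<Sum>z\<in>Zs \<rho>. (\<Sum>x\<in>Xs \<rho>. wkernel c w' x * ew x z) * cnj (ew w z))"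
      using M by simp
    also have "\<dots> = (\<Sum>x\<in>Xs \<rho>. (\<Sum>z\<in>Zs \<rho>. ew x z * cnj (ew w z)) * wkernel c w' x)"
      unfolding sum_distrib_right by (subst sum.swap) (simp add: mult_ac)
    also have "\<dots> = (\<Sum>x\<in>Xs \<rho>. if x = w then (\<Prod>i\<in>I. of_nat (card (rcosets (fst (\<rho> i))))) * wkernel c w' x else 0)"
      using ew_orthogonal[OF sub _ w] by (intro sum.cong refl) simp
    also have "\<dots> = (\<Prod>i\<in>I. of_nat (card (rcosets (fst (\<rho> i))))) * wkernel c w' w"
      using finite_Xs w by (subst sum.delta) auto
    finally have "(\<Prod>i\<in>I. complex_of_nat (card (rcosets (fst (\<rho> i))))) * wkernel c w' w = 0" by simp
    moreover have "card (rcosets (fst (\<rho> i))) \<noteq> 0" if "i \<in> I" for i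
      using finite_rcosets[OF sub[OF that]] rcosets_part_G[OF sub[OF that]] one_closed by auto
    ultimately show "wkernel c w' w = 0" by simp
  qed
qed

lemma kills_iff_kernel:
  "kills c \<tau> \<longleftrightarrow> (\<forall>w'\<in>words I \<tau>. \<forall>w\<in>words I \<tau>. wkernel c w' w = 0)"
proof
  assume k: "kills c \<tau>"
  show "\<forall>w'\<in>words I \<tau>. \<forall>w\<in>words I \<tau>. wkernel c w' w = 0"
  proof (intro ballI)
    fix w' w assume w': "w' \<in> words I \<tau>" and w: "w \<in> words I \<tau>"
    have "(\<lambda>u. if u = w then 1 else 0) \<in> wt_space I \<tau>" using w by (auto simp: wt_space_def)
    then have "opr c (\<lambda>u. if u = w then 1 else 0) = 0" using k unfolding kills_def by blast
    then have "opr c (\<lambda>u. if u = w then 1 else 0) w' = 0" by simp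
    moreover have "opr c (\<lambda>u. if u = w then 1 else 0) w' = wkernel c w' w"
      unfolding opr_def wkernel_def act_def by (intro sum.cong refl) simp
    ultimately show "wkernel c w' w = 0" by simp
  qed
next
  assume K: "\<forall>w'\<in>words I \<tau>. \<forall>w\<in>words I \<tau>. wkernel c w' w = 0"
  show "kills c \<tau>"
    unfolding kills_def
  proof
    fix v assume v: "v \<in> wt_space I \<tau>"
    have "opr c v w' = 0" if w': "w' \<in> words I \<tau>" for w'
    proof -
      have "opr c v w' = (\<Sum>y\<in>carrier W. \<Sum>w\<in>words I \<tau>. if w' \<circ> snd y = w then c y * phase (fst y) w' * v w else 0)"
        unfolding opr_def act_def using w'
        by (intro sum.cong refl) (simp add: sum.delta' finite_words words_perm[OF wreath_perm])
      also have "\<dots> = (\<Sum>w\<in>words I \<tau>. wkernel c w' w * v w)"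
        unfolding wkernel_def sum_distrib_right by (subst sum.swap) (auto intro!: sum.cong)
      also have "\<dots> = 0" using K w' by simp
      finally show ?thesis .
    qed
    then show "opr c v = 0" using opr_wt_space[OF v, of c] by (auto simp: wt_space_def fun_eq_iff)
  qed
qed

lemma kernel_other_content:
  assumes "wcount I w' \<noteq> wcount I w" shows "wkernel c w' w = 0"
proof -
  have "w' \<circ> snd y \<noteq> w" if "y \<in> carrier W" for y
    using wcount_perm[OF wreath_perm[OF that], of w'] assms by auto
  then show ?thesis unfolding wkernel_def by (intro sum.neutral) simp
qed

end

section \<open>Tabloids as words of cosets\<close>

lemma card_fibre_bij:
  assumes "bij_betw h A B"
  shows "card {a\<in>A. P (h a)} = card {b\<in>B. P b}"
proof (rule bij_betw_same_card)
  show "bij_betw h {a\<in>A. P (h a)} {b\<in>B. P b}"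
  proof (rule bij_betw_imageI)
    show "inj_on h {a\<in>A. P (h a)}"
      using bij_betw_imp_inj_on[OF assms] by (rule inj_on_subset) auto
    show "h ` {a\<in>A. P (h a)} = {b\<in>B. P b}"
      unfolding bij_betw_imp_surj_on[OF assms, symmetric] by blast
  qed
qed

lemma words_eq_perm:
  assumes "finite A" "w \<in> words A \<tau>" "w' \<in> words A \<tau>"
  obtains p where "p permutes A" "w = w' \<circ> p"
proof -
  have "card {a\<in>A. w a = x} = card {a\<in>A. w' a = x}" for x
    using assms(2,3) by (simp add: words_def wcount_def fun_eq_iff)
  from fibre_bij[OF assms(1,1) this]
  obtain h where h: "bij_betw h A A" "\<And>a. a \<in> A \<Longrightarrow> w' (h a) = w a" by blast
  define p where "p = (\<lambda>a. if a \<in> A then h a else a)"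
  have "bij_betw p A A" using h(1) by (rule bij_betw_cong[THEN iffD1, rotated]) (simp add: p_def)
  then have p: "p permutes A" by (rule bij_imp_permutes) (simp add: p_def)
  have "w = w' \<circ> p"
  proof
    fix a
    show "w a = (w' \<circ> p) a"
    proof (cases "a \<in> A")
      case True
      then show ?thesis using h(2) by (simp add: p_def)
    next
      case False
      then show ?thesis using assms(2,3) extensional_arb[of w A a] extensional_arb[of w' A a]
        by (simp add: words_def p_def)
    qed
  qed
  then show ?thesis using p that by blast
qed

definition brow :: "'s \<times> nat \<times> nat \<Rightarrow> 's \<times> nat" where
  "brow b = (fst b, fst (snd b))"

context wreath_characters
begin

text \<open>The analogue of \<open>tab\<close> for entries with cosets: \<open>z\<close> records for
  each index the row in which it stands and the coset attached to it.\<close>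

definition ctab :: "('g set \<Rightarrow> nat \<Rightarrow> nat) \<Rightarrow> (nat \<Rightarrow> ('g set \<times> nat) \<times> 'g set)
    \<Rightarrow> ('g set \<times> nat \<times> nat \<Rightarrow> 'g set \<times> nat) set" where
  "ctab s z = {T \<in> coset_tableaux G n s. \<forall>b\<in>boxes G s. z (snd (T b)) = (brow b, fst (T b))}"

definition Rs :: "('g set \<Rightarrow> nat \<Rightarrow> nat) \<Rightarrow> (nat \<Rightarrow> 'g set \<times> nat) set" where
  "Rs s = words I (\<lambda>x. card {b\<in>boxes G s. brow b = x})"

definition Zall :: "('g set \<Rightarrow> nat \<Rightarrow> nat) \<Rightarrow> (nat \<Rightarrow> ('g set \<times> nat) \<times> 'g set) set" where
  "Zall s = (\<Union>\<rho>\<in>Rs s. Zs \<rho>)"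

lemma finite_subgroups: "finite {U. subgroup U G}"
proof (rule finite_subset)
  show "{U. subgroup U G} \<subseteq> Pow (carrier G)"
    by (intro subsetI PowI subgroup.subset) simp
qed (simp add: finG)

context
  fixes s assumes s: "s \<in> Sigma_par G n"
begin

abbreviation B :: "('g set \<times> nat \<times> nat) set" where "B \<equiv> boxes G s"

lemma boxes_Sigma: "B = Sigma {U. subgroup U G} (\<lambda>U. diagram (s U))"
  by (auto simp: boxes_def)

lemma s_Par: "subgroup U G \<Longrightarrow> s U \<in> Par"
  using s by (auto simp: Sigma_par_def)

lemma finite_B: "finite B"
  unfolding boxes_Sigma using finite_subgroups finite_diagram[OF s_Par] by (intro finite_SigmaI) auto

lemma card_B: "card B = n"
proof -
  have "card B = (\<Sum>U | subgroup U G. psize (s U))"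
    unfolding boxes_Sigma using finite_subgroups finite_diagram[OF s_Par] card_diagram[OF s_Par]
    by (subst card_SigmaI) auto
  then show ?thesis using s by (simp add: Sigma_par_def)
qed

lemma coset_tableaux_iff:
  "T \<in> coset_tableaux G n s \<longleftrightarrow> T \<in> extensional B \<and> inj_on (\<lambda>b. snd (T b)) B \<and>
    (\<forall>b\<in>B. fst (T b) \<in> rcosets (fst b) \<and> snd (T b) \<in> I)"
  by (auto simp: coset_tableaux_def PiE_iff I_def mem_Times_iff)

lemma tableau_index_bij:
  assumes "T \<in> coset_tableaux G n s" shows "bij_betw (\<lambda>b. snd (T b)) B I"
proof -
  have inj: "inj_on (\<lambda>b. snd (T b)) B" using assms by (simp add: coset_tableaux_iff)
  moreover have "(\<lambda>b. snd (T b)) ` B = I"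
  proof (rule card_subset_eq[OF finite_I])
    show "(\<lambda>b. snd (T b)) ` B \<subseteq> I" using assms coset_tableaux_iff by blast
    show "card ((\<lambda>b. snd (T b)) ` B) = card I" using card_image[OF inj] card_B card_I by simp
  qed
  ultimately show ?thesis by (simp add: bij_betw_def)
qed

lemma ctab_perm:
  assumes T: "T \<in> ctab s z" and q: "q permutes B" "\<And>b. b \<in> B \<Longrightarrow> brow (q b) = brow b"
  shows "T \<circ> q \<in> ctab s z"
proof -
  have Tt: "T \<in> coset_tableaux G n s" using T by (simp add: ctab_def)
  have qB: "q b \<in> B" if "b \<in> B" for b using permutes_mem[OF q(1) that] .
  have "T \<circ> q \<in> extensional B"
    using Tt extensional_perm[OF q(1), of T] by (simp add: coset_tableaux_iff)
  moreover have "inj_on (\<lambda>b. snd ((T \<circ> q) b)) B"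
    using comp_inj_on[of q B "\<lambda>b. snd (T b)"] permutes_inj_on[OF q(1), of B] permutes_image[OF q(1)] Tt
    by (simp add: coset_tableaux_iff comp_def)
  moreover have "fst ((T \<circ> q) b) \<in> rcosets (fst b)" "snd ((T \<circ> q) b) \<in> I" if b: "b \<in> B" for b
  proof -
    have "fst (q b) = fst b" using q(2)[OF b] by (simp add: brow_def)
    moreover have "fst (T (q b)) \<in> rcosets (fst (q b)) \<and> snd (T (q b)) \<in> I"
      using Tt qB[OF b] by (simp only: coset_tableaux_iff)
    ultimately show "fst ((T \<circ> q) b) \<in> rcosets (fst b)" "snd ((T \<circ> q) b) \<in> I" by simp_all
  qed
  ultimately have "T \<circ> q \<in> coset_tableaux G n s" unfolding coset_tableaux_iff by blast
  moreover have "z (snd ((T \<circ> q) b)) = (brow b, fst ((T \<circ> q) b))" if b: "b \<in> B" for b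
    using T qB[OF b] q(2)[OF b] by (simp add: ctab_def)
  ultimately show ?thesis by (simp add: ctab_def)
qed

lemma ctab_perm_ex:
  assumes T: "T \<in> ctab s z" and T': "T' \<in> ctab s z"
  obtains q where "q permutes B" "\<And>b. b \<in> B \<Longrightarrow> brow (q b) = brow b" "T' = T \<circ> q"
proof -
  have tt: "T \<in> coset_tableaux G n s" "T' \<in> coset_tableaux G n s" using T T' by (auto simp: ctab_def)
  note bij = tableau_index_bij[OF tt(1)] tableau_index_bij[OF tt(2)]
  let ?inv = "inv_into B (\<lambda>b. snd (T b))"
  define q where "q = (\<lambda>b. if b \<in> B then ?inv (snd (T' b)) else b)"
  have "bij_betw (?inv \<circ> (\<lambda>b. snd (T' b))) B B"
    by (rule bij_betw_trans[OF bij(2) bij_betw_inv_into[OF bij(1)]])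
  then have "bij_betw q B B" by (rule bij_betw_cong[THEN iffD1, rotated]) (simp add: q_def)
  then have q: "q permutes B" by (rule bij_imp_permutes) (simp add: q_def)
  have sq: "snd (T (q b)) = snd (T' b)" if "b \<in> B" for b
    using bij_betw_inv_into_right[OF bij(1)] bij_betwE[OF bij(2)] that by (simp add: q_def)
  have zq: "(brow (q b), fst (T (q b))) = (brow b, fst (T' b))" if b: "b \<in> B" for b
  proof -
    have "z (snd (T (q b))) = (brow (q b), fst (T (q b)))"
      using T permutes_mem[OF q b] by (simp add: ctab_def)
    moreover have "z (snd (T' b)) = (brow b, fst (T' b))" using T' b by (simp add: ctab_def)
    ultimately show ?thesis using sq[OF b] by simp
  qed
  have "T' = T \<circ> q"
  proof
    fix b
    show "T' b = (T \<circ> q) b"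
    proof (cases "b \<in> B")
      case True
      then show ?thesis using zq[OF True] sq[OF True] by (simp add: prod_eq_iff)
    next
      case False
      then show ?thesis using tt extensional_arb[of T B b] extensional_arb[of T' B b]
        by (simp add: q_def coset_tableaux_iff)
    qed
  qed
  then show ?thesis using that q zq by blast
qed

lemma row_class_eq_ctab:
  assumes T: "T \<in> ctab s z"
  shows "row_equiv B (\<lambda>(U, r, j). (U, r)) (coset_tableaux G n s) `` {T} = ctab s z"
proof -
  have row: "(\<lambda>(U, r, j). (U, r)) = (brow :: 'g set \<times> nat \<times> nat \<Rightarrow> _)"
    by (auto simp: brow_def fun_eq_iff)
  show ?thesis
    unfolding row
  proof (intro equalityI subsetI)
    fix T' assume "T' \<in> row_equiv B brow (coset_tableaux G n s) `` {T}"
    then obtain q where "q permutes B" "\<forall>b\<in>B. brow (q b) = brow b" "T' = T \<circ> q"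
      by (auto simp: row_equiv_def)
    then show "T' \<in> ctab s z" using ctab_perm[OF T] by simp
  next
    fix T' assume T': "T' \<in> ctab s z"
    obtain q where "q permutes B" "\<And>b. b \<in> B \<Longrightarrow> brow (q b) = brow b" "T' = T \<circ> q"
      using ctab_perm_ex[OF T T'] by blast
    then show "T' \<in> row_equiv B brow (coset_tableaux G n s) `` {T}"
      using T T' unfolding row_equiv_def ctab_def by blast
  qed
qed

text \<open>A row that occurs in \<open>\<rho>\<close> has boxes, and boxes exist only for
  subgroups.\<close>

lemma Rs_subgroup:
  assumes "\<rho> \<in> Rs s" "i \<in> I" shows "subgroup (fst (\<rho> i)) G"
proof -
  have "card {b\<in>B. brow b = \<rho> i} \<noteq> 0"
    using assms words_support[OF finite_I, of \<rho>] unfolding Rs_def by blast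
  then have "{b\<in>B. brow b = \<rho> i} \<noteq> {}" by (metis card.empty)
  then obtain b where "b \<in> B" "brow b = \<rho> i" by blast
  then have "b \<in> B" "fst b = fst (\<rho> i)" by (auto simp: brow_def prod_eq_iff)
  then show ?thesis unfolding boxes_Sigma by auto
qed

lemma finite_Zall: "finite (Zall s)"
  unfolding Zall_def
proof (rule finite_UN_I)
  show "finite (Rs s)" unfolding Rs_def by (rule finite_words[OF finite_I])
  show "finite (Zs \<rho>)" if "\<rho> \<in> Rs s" for \<rho> using Rs_subgroup[OF that] by (rule finite_Zs)
qed

lemma ctab_nonempty:
  assumes "z \<in> Zall s" shows "ctab s z \<noteq> {}"
proof -
  obtain \<rho> where \<rho>: "\<rho> \<in> Rs s" "z \<in> Zs \<rho>" using assms by (auto simp: Zall_def)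
  have zi: "fst (z i) = \<rho> i" "snd (z i) \<in> rcosets (fst (\<rho> i))" if "i \<in> I" for i
    using PiE_mem[OF \<rho>(2)[unfolded Zs_def] that] by auto
  have "card {b\<in>B. brow b = x} = card {i\<in>I. \<rho> i = x}" for x
  proof -
    have "wcount I \<rho> x = card {b\<in>B. brow b = x}" using \<rho>(1) by (simp add: Rs_def words_def)
    then show ?thesis by (simp only: wcount_def)
  qed
  from fibre_bij[OF finite_B finite_I this]
  obtain h where h: "bij_betw h B I" "\<And>b. b \<in> B \<Longrightarrow> \<rho> (h b) = brow b" by blast
  have hI: "h b \<in> I" if "b \<in> B" for b using bij_betwE[OF h(1)] that by blast
  define T where "T = (\<lambda>b\<in>B. (snd (z (h b)), h b))"
  have "T \<in> coset_tableaux G n s"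
    unfolding coset_tableaux_iff
  proof (intro conjI ballI)
    show "T \<in> extensional B" by (simp add: T_def)
    show "inj_on (\<lambda>b. snd (T b)) B"
      using bij_betw_imp_inj_on[OF h(1)] by (simp add: T_def inj_on_def)
    fix b assume b: "b \<in> B"
    have "fst (\<rho> (h b)) = fst b" using h(2)[OF b] by (simp add: brow_def)
    then show "fst (T b) \<in> rcosets (fst b)" using zi(2)[OF hI[OF b]] b by (simp add: T_def)
    show "snd (T b) \<in> I" using hI[OF b] b by (simp add: T_def)
  qed
  moreover have "z (snd (T b)) = (brow b, fst (T b))" if b: "b \<in> B" for b
    using zi(1)[OF hI[OF b]] h(2)[OF b] b by (simp add: T_def prod_eq_iff)
  ultimately have "T \<in> ctab s z" by (simp add: ctab_def)
  then show ?thesis by blast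
qed

lemma word_of_tableau:
  assumes T: "T \<in> coset_tableaux G n s"
  shows "\<exists>z\<in>Zall s. T \<in> ctab s z"
proof -
  note bij = tableau_index_bij[OF T]
  define h where "h = inv_into B (\<lambda>b. snd (T b))"
  have h: "bij_betw h I B" unfolding h_def by (rule bij_betw_inv_into[OF bij])
  have hB: "h i \<in> B" if "i \<in> I" for i using bij_betwE[OF h] that by blast
  define \<rho> where "\<rho> = (\<lambda>i\<in>I. brow (h i))"
  define z where "z = (\<lambda>i\<in>I. (\<rho> i, fst (T (h i))))"
  have "wcount I \<rho> x = card {b\<in>B. brow b = x}" for x
  proof -
    have "{i\<in>I. \<rho> i = x} = {i\<in>I. brow (h i) = x}" by (auto simp: \<rho>_def)
    then show ?thesis unfolding wcount_def using card_fibre_bij[OF h, of "\<lambda>b. brow b = x"] by simp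
  qed
  then have "\<rho> \<in> Rs s" by (auto simp: Rs_def words_def \<rho>_def)
  moreover have "z \<in> Zs \<rho>"
    unfolding Zs_def
  proof (rule PiE_I)
    fix i assume i: "i \<in> I"
    have "fst (T (h i)) \<in> rcosets (fst (h i))" using T hB[OF i] by (simp only: coset_tableaux_iff)
    then show "z i \<in> {\<rho> i} \<times> rcosets (fst (\<rho> i))" using i by (simp add: z_def \<rho>_def brow_def)
  qed (simp add: z_def)
  ultimately have "z \<in> Zall s" by (auto simp: Zall_def)
  moreover have "z (snd (T b)) = (brow b, fst (T b))" if b: "b \<in> B" for b
  proof -
    have "snd (T b) \<in> I" using T b by (simp only: coset_tableaux_iff)
    moreover have "h (snd (T b)) = b" unfolding h_def using bij_betw_inv_into_left[OF bij b] .
    ultimately show ?thesis by (simp add: z_def \<rho>_def)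
  qed
  then have "T \<in> ctab s z" using T by (simp add: ctab_def)
  ultimately show ?thesis by blast
qed

lemma Zall_extensional: "z \<in> Zall s \<Longrightarrow> z \<in> extensional I"
  by (auto simp: Zall_def Zs_def PiE_def)

lemma ctab_inj:
  assumes "z \<in> Zall s" "z' \<in> Zall s" "ctab s z = ctab s z'" shows "z = z'"
proof -
  obtain T where T: "T \<in> ctab s z" using ctab_nonempty[OF assms(1)] by blast
  then have T': "T \<in> ctab s z'" using assms(3) by simp
  have bij: "bij_betw (\<lambda>b. snd (T b)) B I" using T tableau_index_bij by (simp add: ctab_def)
  have "z i = z' i" if "i \<in> I" for i
  proof -
    have "i \<in> (\<lambda>b. snd (T b)) ` B" unfolding bij_betw_imp_surj_on[OF bij] by (rule that)
    then obtain b where "b \<in> B" "i = snd (T b)" by auto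
    then show ?thesis using T T' by (simp add: ctab_def)
  qed
  then show ?thesis
    using Zall_extensional[OF assms(1)] Zall_extensional[OF assms(2)] by (intro extensionalityI[of z I z'])
qed

lemma coset_tabloids_eq: "coset_tabloids G n s = ctab s ` Zall s"
proof (intro equalityI subsetI)
  fix X assume "X \<in> coset_tabloids G n s"
  then obtain T where T: "T \<in> coset_tableaux G n s"
    "X = row_equiv B (\<lambda>(U, r, j). (U, r)) (coset_tableaux G n s) `` {T}"
    by (auto simp: coset_tabloids_def quotient_def)
  obtain z where z: "z \<in> Zall s" "T \<in> ctab s z" using word_of_tableau[OF T(1)] by blast
  then show "X \<in> ctab s ` Zall s" using T(2) row_class_eq_ctab[OF z(2)] by blast
next
  fix X assume "X \<in> ctab s ` Zall s"
  then obtain z where z: "z \<in> Zall s" "X = ctab s z" by blast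
  obtain T where T: "T \<in> ctab s z" using ctab_nonempty[OF z(1)] by blast
  have "T \<in> coset_tableaux G n s" using T by (simp add: ctab_def)
  then show "X \<in> coset_tabloids G n s"
    using row_class_eq_ctab[OF T] z(2) unfolding coset_tabloids_def quotient_def by blast
qed

lemma zact_Zall:
  assumes y: "y \<in> carrier W" and z: "z \<in> Zall s" shows "zact y z \<in> Zall s"
proof -
  have p: "snd y permutes I" by (rule wreath_perm[OF y])
  obtain \<rho> where \<rho>: "\<rho> \<in> Rs s" "z \<in> Zs \<rho>" using z by (auto simp: Zall_def)
  let ?\<rho>' = "\<rho> \<circ> inv_into UNIV (snd y)"
  have "?\<rho>' \<in> Rs s" using \<rho>(1) words_perm[OF permutes_inv[OF p]] unfolding Rs_def by blast
  moreover have "zact y z \<in> Zs ?\<rho>'"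
    using zact_mem_Zs_iff[OF y \<rho>(2) Rs_subgroup[OF \<rho>(1)], of ?\<rho>'] permutes_inverses(2)[OF p] by simp
  ultimately show ?thesis by (auto simp: Zall_def)
qed

lemma entry_act_tableau:
  assumes y: "y \<in> carrier W" and T: "T \<in> ctab s z"
  shows "compose B (entry_act G y) T \<in> ctab s (zact y z)"
proof -
  have p: "snd y permutes I" by (rule wreath_perm[OF y])
  have Tt: "T \<in> coset_tableaux G n s" using T by (simp add: ctab_def)
  have ea: "entry_act G y x = (fst x #> fst y (snd y (snd x)), snd y (snd x))" for x
    by (cases y; cases x) (simp add: entry_act_def)
  have Tb: "fst (T b) \<in> rcosets (fst b)" "snd (T b) \<in> I" if "b \<in> B" for b
    using Tt that by (simp_all only: coset_tableaux_iff)
  have sub: "subgroup (fst b) G" if "b \<in> B" for b using that unfolding boxes_Sigma by auto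
  have "compose B (entry_act G y) T \<in> coset_tableaux G n s"
    unfolding coset_tableaux_iff
  proof (intro conjI ballI)
    show "compose B (entry_act G y) T \<in> extensional B" by simp
    show "inj_on (\<lambda>b. snd (compose B (entry_act G y) T b)) B"
    proof (rule inj_onI)
      fix b b' assume b: "b \<in> B" "b' \<in> B"
        and e: "snd (compose B (entry_act G y) T b) = snd (compose B (entry_act G y) T b')"
      then have "snd y (snd (T b)) = snd y (snd (T b'))" by (simp add: compose_eq ea)
      then have "snd (T b) = snd (T b')" using permutes_inj[OF p] by (simp add: inj_eq)
      then show "b = b'" using Tt b unfolding coset_tableaux_iff inj_on_def by blast
    qed
    fix b assume b: "b \<in> B"
    have pI: "snd y (snd (T b)) \<in> I" by (rule perm_mem[OF p Tb(2)[OF b]])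
    show "fst (compose B (entry_act G y) T b) \<in> rcosets (fst b)"
      using coset_shift(1)[OF sub[OF b] Tb(1)[OF b] wreath_coord[OF y pI]] b by (simp add: compose_eq ea)
    show "snd (compose B (entry_act G y) T b) \<in> I" using pI b by (simp add: compose_eq ea)
  qed
  moreover have "zact y z (snd (compose B (entry_act G y) T b)) = (brow b, fst (compose B (entry_act G y) T b))"
    if b: "b \<in> B" for b
  proof -
    have "z (snd (T b)) = (brow b, fst (T b))" using T b by (simp add: ctab_def)
    then show ?thesis
      using perm_mem[OF p Tb(2)[OF b]] b permutes_inverses(2)[OF p, of "snd (T b)"]
      by (simp add: compose_eq ea zact_def)
  qed
  ultimately show ?thesis by (simp add: ctab_def)
qed

text \<open>Acting on entries commutes with permuting boxes, so the image of a row class is a whole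
  row class and not merely contained in one.\<close>

lemma coset_tabloid_act_ctab:
  assumes y: "y \<in> carrier W" and z: "z \<in> Zall s"
  shows "coset_tabloid_act G s y (ctab s z) = ctab s (zact y z)"
  unfolding coset_tabloid_act_def
proof (intro equalityI subsetI)
  fix T' assume "T' \<in> compose B (entry_act G y) ` ctab s z"
  then show "T' \<in> ctab s (zact y z)" using entry_act_tableau[OF y] by blast
next
  fix T' assume T': "T' \<in> ctab s (zact y z)"
  obtain T where T: "T \<in> ctab s z" using ctab_nonempty[OF z] by blast
  obtain q where q: "q permutes B" "\<And>b. b \<in> B \<Longrightarrow> brow (q b) = brow b" "T' = compose B (entry_act G y) T \<circ> q"
    using ctab_perm_ex[OF entry_act_tableau[OF y T] T'] by blast
  have "compose B (entry_act G y) T \<circ> q = compose B (entry_act G y) (T \<circ> q)"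
    using permutes_in_image[OF q(1)] by (auto simp: compose_def)
  then show "T' \<in> compose B (entry_act G y) ` ctab s z" using ctab_perm[OF T q(1,2)] q(3) by simp
qed

lemma sigma_transitive_iff:
  assumes Y: "Y \<subseteq> carrier W"
  shows "sigma_transitive G n s Y \<longleftrightarrow>
    (\<exists>c::nat. c > 0 \<and> (\<forall>z\<in>Zall s. \<forall>z'\<in>Zall s. card {y\<in>Y. zact y z = z'} = c))"
proof -
  have "{y\<in>Y. coset_tabloid_act G s y (ctab s z) = ctab s z'} = {y\<in>Y. zact y z = z'}"
    if z: "z \<in> Zall s" "z' \<in> Zall s" for z z'
  proof (rule Collect_cong, rule conj_cong[OF refl])
    fix y assume "y \<in> Y"
    then have y: "y \<in> carrier W" using Y by blast
    show "coset_tabloid_act G s y (ctab s z) = ctab s z' \<longleftrightarrow> zact y z = z'"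
      unfolding coset_tabloid_act_ctab[OF y z(1)]
      using ctab_inj[OF zact_Zall[OF y z(1)] z(2)] by blast
  qed
  then show ?thesis
    by (simp add: sigma_transitive_def transitive_on_def coset_tabloids_eq)
qed

text \<open>Cosets are multiplied on the right, so two translations are composed in the reverse
  order; commutativity of \<open>G\<close> makes this a left action.\<close>

lemma zact_mult:
  assumes x: "x \<in> carrier W" and y: "y \<in> carrier W" and z: "z \<in> Zall s"
  shows "zact (x \<otimes>\<^bsub>W\<^esub> y) z = zact x (zact y z)"
proof (rule extensionalityI[of _ I])
  fix i assume i: "i \<in> I"
  obtain \<rho> where \<rho>: "\<rho> \<in> Rs s" "z \<in> Zs \<rho>" using z by (auto simp: Zall_def)
  have p: "snd x permutes I" "snd y permutes I" by (rule wreath_perm[OF x], rule wreath_perm[OF y])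
  let ?k = "inv_into UNIV (snd x) i"
  let ?j = "inv_into UNIV (snd y) ?k"
  have k: "?k \<in> I" by (rule perm_inv_mem[OF p(1) i])
  have j: "?j \<in> I" by (rule perm_inv_mem[OF p(2) k])
  have inv: "inv_into UNIV (snd x \<circ> snd y) i = ?j"
    using o_inv_distrib[OF permutes_bij[OF p(1)] permutes_bij[OF p(2)]] by (simp add: fun_eq_iff)
  have "snd (z ?j) \<in> rcosets (fst (\<rho> ?j))" using PiE_mem[OF \<rho>(2)[unfolded Zs_def] j] by auto
  then have "snd (z ?j) \<subseteq> carrier G"
    using subgroup.rcosets_carrier[OF Rs_subgroup[OF \<rho>(1) j] is_group] by blast
  moreover have "fst x i \<otimes> fst y ?k = fst y ?k \<otimes> fst x i"
    by (rule m_comm[OF wreath_coord[OF x i] wreath_coord[OF y k]])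
  ultimately have "snd (z ?j) #> (fst x i \<otimes> fst y ?k) = (snd (z ?j) #> fst y ?k) #> fst x i"
    using wreath_coord[OF x i] wreath_coord[OF y k] by (simp add: coset_mult_assoc)
  then show "zact (x \<otimes>\<^bsub>W\<^esub> y) z i = zact x (zact y z) i"
    using i k inv by (simp add: zact_def wreath_mult)
qed (simp_all add: zact_def)

lemma zact_one:
  assumes z: "z \<in> Zall s" shows "zact \<one>\<^bsub>W\<^esub> z = z"
proof (rule extensionalityI[of _ I])
  fix i assume i: "i \<in> I"
  obtain \<rho> where \<rho>: "\<rho> \<in> Rs s" "z \<in> Zs \<rho>" using z by (auto simp: Zall_def)
  have "snd (z i) \<in> rcosets (fst (\<rho> i))" using PiE_mem[OF \<rho>(2)[unfolded Zs_def] i] by auto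
  then have "snd (z i) \<subseteq> carrier G"
    using subgroup.rcosets_carrier[OF Rs_subgroup[OF \<rho>(1) i] is_group] by blast
  then show "zact \<one>\<^bsub>W\<^esub> z i = z i" using i by (simp add: zact_def wreath_one inv_id)
qed (use Zall_extensional[OF z] in \<open>simp_all add: zact_def\<close>)

text \<open>A permutation matches the row words, which have the same content. Then the base group
  adjusts the coset at each index separately, since \<open>G\<close> permutes the cosets of a
  subgroup transitively.\<close>

lemma zact_transitive:
  assumes z: "z \<in> Zall s" and z': "z' \<in> Zall s"
  obtains y where "y \<in> carrier W" "zact y z = z'"
proof -
  obtain \<rho> where \<rho>: "\<rho> \<in> Rs s" "z \<in> Zs \<rho>" using z by (auto simp: Zall_def)
  obtain \<rho>' where \<rho>': "\<rho>' \<in> Rs s" "z' \<in> Zs \<rho>'" using z' by (auto simp: Zall_def)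
  obtain p where p: "p permutes I" "\<rho> = \<rho>' \<circ> p"
    using words_eq_perm[OF finite_I \<rho>(1)[unfolded Rs_def] \<rho>'(1)[unfolded Rs_def]] .
  let ?p' = "inv_into UNIV p"
  have "\<exists>x\<in>carrier G. snd (z (?p' i)) #> x = snd (z' i)" if i: "i \<in> I" for i
  proof -
    have j: "?p' i \<in> I" by (rule perm_inv_mem[OF p(1) i])
    have sub: "subgroup (fst (\<rho>' i)) G" by (rule Rs_subgroup[OF \<rho>'(1) i])
    have "\<rho> (?p' i) = \<rho>' i" using p(2) permutes_inverses(1)[OF p(1), of i] by simp
    then have c: "snd (z (?p' i)) \<in> rcosets (fst (\<rho>' i))"
      using PiE_mem[OF \<rho>(2)[unfolded Zs_def] j] by auto
    have d: "snd (z' i) \<in> rcosets (fst (\<rho>' i))" using PiE_mem[OF \<rho>'(2)[unfolded Zs_def] i] by auto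
    obtain a where a: "a \<in> carrier G" "snd (z (?p' i)) = fst (\<rho>' i) #> a" using coset_nonempty[OF sub c] by blast
    obtain b where b: "b \<in> carrier G" "snd (z' i) = fst (\<rho>' i) #> b" using coset_nonempty[OF sub d] by blast
    have "snd (z (?p' i)) #> (inv a \<otimes> b) = fst (\<rho>' i) #> (a \<otimes> (inv a \<otimes> b))"
      unfolding a(2) using a(1) b(1) subgroup.subset[OF sub] by (simp add: coset_mult_assoc)
    also have "a \<otimes> (inv a \<otimes> b) = b" using a(1) b(1) by (simp add: m_assoc[symmetric])
    finally show ?thesis using a(1) b by (intro bexI[of _ "inv a \<otimes> b"]) auto
  qed
  then obtain x where x: "\<And>i. i \<in> I \<Longrightarrow> x i \<in> carrier G \<and> snd (z (?p' i)) #> x i = snd (z' i)" by metis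
  define y where "y = (restrict x I, p)"
  have "y \<in> carrier W" using x p(1) by (simp add: y_def wreath_carrier)
  moreover have "zact y z = z'"
  proof (rule extensionalityI[of _ I])
    fix i assume i: "i \<in> I"
    have j: "?p' i \<in> I" by (rule perm_inv_mem[OF p(1) i])
    have "fst (z (?p' i)) = \<rho> (?p' i)" using PiE_mem[OF \<rho>(2)[unfolded Zs_def] j] by auto
    also have "\<dots> = \<rho>' i" using p(2) permutes_inverses(1)[OF p(1), of i] by simp
    also have "\<dots> = fst (z' i)" using PiE_mem[OF \<rho>'(2)[unfolded Zs_def] i] by auto
    finally show "zact y z i = z' i" using x[OF i] i by (simp add: zact_def y_def prod_eq_iff)
  qed (use Zall_extensional[OF z'] in \<open>simp_all add: zact_def\<close>)
  ultimately show ?thesis using that by blast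
qed

text \<open>For \<open>zact a u = z\<close> and \<open>zact b z' = u'\<close>, sending
  \<open>y\<close> to the product of \<open>b\<close>, \<open>y\<close> and \<open>a\<close> is a
  bijection between the two sets. Thus the whole group has constant counts, with which those of
  \<open>Y\<close> are compared.\<close>

lemma card_zact_const:
  assumes "z \<in> Zall s" "z' \<in> Zall s" "u \<in> Zall s" "u' \<in> Zall s"
  shows "card {y\<in>carrier W. zact y z = z'} = card {y\<in>carrier W. zact y u = u'}"
proof -
  interpret W: group W by (rule wreath_group)
  obtain a where a: "a \<in> carrier W" "zact a u = z" using zact_transitive[OF assms(3,1)] .
  obtain b where b: "b \<in> carrier W" "zact b z' = u'" using zact_transitive[OF assms(2,4)] .
  have inv: "zact (inv\<^bsub>W\<^esub> y) x' = x" if "y \<in> carrier W" "x \<in> Zall s" "zact y x = x'" for y x x'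
    using zact_mult[of "inv\<^bsub>W\<^esub> y" y x] that zact_one by simp
  have canc: "inv\<^bsub>W\<^esub> x \<otimes>\<^bsub>W\<^esub> (x \<otimes>\<^bsub>W\<^esub> y \<otimes>\<^bsub>W\<^esub> v) \<otimes>\<^bsub>W\<^esub> inv\<^bsub>W\<^esub> v = y"
    if "x \<in> carrier W" "y \<in> carrier W" "v \<in> carrier W" for x y v
  proof -
    have "inv\<^bsub>W\<^esub> x \<otimes>\<^bsub>W\<^esub> (x \<otimes>\<^bsub>W\<^esub> y \<otimes>\<^bsub>W\<^esub> v) = y \<otimes>\<^bsub>W\<^esub> v"
      using W.m_assoc[of x y v] W.m_assoc[of "inv\<^bsub>W\<^esub> x" x "y \<otimes>\<^bsub>W\<^esub> v", symmetric] that by simp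
    then show ?thesis using W.m_assoc[of y v "inv\<^bsub>W\<^esub> v"] that by simp
  qed
  have "bij_betw (\<lambda>y. b \<otimes>\<^bsub>W\<^esub> y \<otimes>\<^bsub>W\<^esub> a) {y\<in>carrier W. zact y z = z'} {y\<in>carrier W. zact y u = u'}"
  proof (rule bij_betw_byWitness[where f' = "\<lambda>y. inv\<^bsub>W\<^esub> b \<otimes>\<^bsub>W\<^esub> y \<otimes>\<^bsub>W\<^esub> inv\<^bsub>W\<^esub> a"])
    show "\<forall>y\<in>{y\<in>carrier W. zact y z = z'}. inv\<^bsub>W\<^esub> b \<otimes>\<^bsub>W\<^esub> (b \<otimes>\<^bsub>W\<^esub> y \<otimes>\<^bsub>W\<^esub> a) \<otimes>\<^bsub>W\<^esub> inv\<^bsub>W\<^esub> a = y"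
      using canc[OF b(1) _ a(1)] by simp
    show "\<forall>y\<in>{y\<in>carrier W. zact y u = u'}. b \<otimes>\<^bsub>W\<^esub> (inv\<^bsub>W\<^esub> b \<otimes>\<^bsub>W\<^esub> y \<otimes>\<^bsub>W\<^esub> inv\<^bsub>W\<^esub> a) \<otimes>\<^bsub>W\<^esub> a = y"
      using canc[of "inv\<^bsub>W\<^esub> b" _ "inv\<^bsub>W\<^esub> a"] a(1) b(1) by simp
    show "(\<lambda>y. b \<otimes>\<^bsub>W\<^esub> y \<otimes>\<^bsub>W\<^esub> a) ` {y\<in>carrier W. zact y z = z'} \<subseteq> {y\<in>carrier W. zact y u = u'}"
      using a b assms by (auto simp: zact_mult zact_Zall)
    show "(\<lambda>y. inv\<^bsub>W\<^esub> b \<otimes>\<^bsub>W\<^esub> y \<otimes>\<^bsub>W\<^esub> inv\<^bsub>W\<^esub> a) ` {y\<in>carrier W. zact y u = u'} \<subseteq> {y\<in>carrier W. zact y z = z'}"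
      using a b assms inv[OF a(1) assms(3) a(2)] inv[OF b(1) assms(2) b(2)]
      by (auto simp: zact_mult zact_Zall)
  qed
  then show ?thesis by (rule bij_betw_same_card)
qed

text \<open>Averaging over \<open>W\<close> turns transitivity into the vanishing of an element of the group algebra.\<close>

lemma sigma_transitive_iff_zsum:
  assumes Y: "Y \<subseteq> carrier W" "Y \<noteq> {}"
  defines "c \<equiv> \<lambda>y. (if y \<in> Y then 1 else 0) - of_nat (card Y) / complex_of_nat (card (carrier W))"
  shows "sigma_transitive G n s Y \<longleftrightarrow> (\<forall>z\<in>Zall s. \<forall>z'\<in>Zall s. zsum c z z' = 0)"
proof -
  interpret W: group W by (rule wreath_group)
  let ?N = "\<lambda>Y z z'. card {y\<in>Y. zact y z = z'}"
  have finY: "finite Y" using Y finite_wreath finite_subset by blast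
  have Wpos: "card (carrier W) \<noteq> 0" using finite_wreath W.one_closed by auto
  have Ypos: "card Y \<noteq> 0" using finY Y(2) by simp
  \<comment> \<open>The averaged sum vanishes iff the proportion of \<open>Y\<close> taking
    \<open>z\<close> to \<open>z'\<close> is that of the whole group, here with denominators
    cleared.\<close>
  have zs: "zsum c z z' = 0 \<longleftrightarrow> card (carrier W) * ?N Y z z' = card Y * ?N (carrier W) z z'" for z z'
  proof -
    have "zsum c z z' = (\<Sum>y | y \<in> carrier W \<and> zact y z = z'. c y)"
      unfolding zsum_def using finite_wreath by (intro sum.mono_neutral_cong_right) auto
    also have "\<dots> = (\<Sum>y | y \<in> carrier W \<and> zact y z = z'. if y \<in> Y then 1 else 0) -
        of_nat (?N (carrier W) z z') * (of_nat (card Y) / of_nat (card (carrier W)))"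
      by (simp add: c_def sum_subtractf)
    also have "(\<Sum>y | y \<in> carrier W \<and> zact y z = z'. if y \<in> Y then 1 else 0) = complex_of_nat (?N Y z z')"
    proof -
      have "{y. y \<in> carrier W \<and> zact y z = z'} \<inter> Y = {y\<in>Y. zact y z = z'}" using Y by blast
      then show ?thesis using finite_wreath by (simp add: sum.If_cases Int_def)
    qed
    finally have "zsum c z z' = 0 \<longleftrightarrow> complex_of_nat (card (carrier W)) * of_nat (?N Y z z') =
        of_nat (card Y) * of_nat (?N (carrier W) z z')"
      using Wpos by (auto simp: field_simps)
    then show ?thesis by (simp only: of_nat_mult[symmetric] of_nat_eq_iff)
  qed
  have total: "(\<Sum>z'\<in>Zall s. ?N X z z') = card X" if "X \<subseteq> carrier W" "z \<in> Zall s" for X z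
    using that zact_Zall finite_wreath finite_subset[OF that(1)] finite_Zall
    by (intro sum_card_fibres) auto
  show ?thesis
    unfolding sigma_transitive_iff[OF Y(1)] zs
  proof
    assume "\<exists>k>0. \<forall>z\<in>Zall s. \<forall>z'\<in>Zall s. ?N Y z z' = k"
    then obtain k where k: "\<And>z z'. z \<in> Zall s \<Longrightarrow> z' \<in> Zall s \<Longrightarrow> ?N Y z z' = k" by blast
    show "\<forall>z\<in>Zall s. \<forall>z'\<in>Zall s. card (carrier W) * ?N Y z z' = card Y * ?N (carrier W) z z'"
    proof (intro ballI)
      fix z z' assume z: "z \<in> Zall s" "z' \<in> Zall s"
      \<comment> \<open>Every element takes \<open>z\<close> to exactly one coset word, so the
        counts over all targets add up to \<open>card Y\<close>; likewise for the whole
        group.\<close>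
      have 1: "card (Zall s) * k = card Y" using total[OF Y(1) z(1)] k[OF z(1)] by simp
      have "?N (carrier W) z x = ?N (carrier W) z z'" if "x \<in> Zall s" for x
        by (rule card_zact_const[OF z(1) that z])
      then have 2: "card (Zall s) * ?N (carrier W) z z' = card (carrier W)"
        using total[OF subset_refl z(1)] by simp
      show "card (carrier W) * ?N Y z z' = card Y * ?N (carrier W) z z'"
        unfolding k[OF z] 1[symmetric] 2[symmetric] by (simp only: mult_ac)
    qed
  next
    assume eq: "\<forall>z\<in>Zall s. \<forall>z'\<in>Zall s. card (carrier W) * ?N Y z z' = card Y * ?N (carrier W) z z'"
    show "\<exists>k>0. \<forall>z\<in>Zall s. \<forall>z'\<in>Zall s. ?N Y z z' = k"
    proof (cases "Zall s = {}")
      case True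
      then show ?thesis by (intro exI[of _ 1]) simp
    next
      case False
      then obtain z0 where z0: "z0 \<in> Zall s" by blast
      let ?k = "?N Y z0 z0"
      have "?N Y z z' = ?k" if z: "z \<in> Zall s" "z' \<in> Zall s" for z z'
      proof -
        have "card (carrier W) * ?N Y z z' = card (carrier W) * ?k"
          using eq z z0 card_zact_const[OF z z0 z0] by simp
        then show ?thesis using Wpos by simp
      qed
      \<comment> \<open>The identity fixes \<open>z0\<close>, so the count for the whole group is
        positive, and hence the one for \<open>Y\<close>.\<close>
      moreover have "?k > 0"
      proof -
        have "finite {y\<in>carrier W. zact y z0 = z0}" using finite_wreath by simp
        moreover have "\<one>\<^bsub>W\<^esub> \<in> {y\<in>carrier W. zact y z0 = z0}" using zact_one[OF z0] by simp
        ultimately have "?N (carrier W) z0 z0 \<noteq> 0" using card_0_eq by blast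
        then have "card (carrier W) * ?k \<noteq> 0" using eq z0 Ypos by simp
        then show ?thesis by simp
      qed
      ultimately show ?thesis by blast
    qed
  qed
qed

text \<open>For each pair of row words the Fourier transform replaces coset words by coloured words.
  All words with the content of such a coloured word arise from it by permuting positions, hence lie
  over some row word in \<open>Rs s\<close>, so the entries of one content together form the matrix
  on a whole weight space. Entries between different contents are 0 for every
  \<open>c\<close>.\<close>

lemma zsum_zero_iff_kills:
  "(\<forall>z\<in>Zall s. \<forall>z'\<in>Zall s. zsum c z z' = 0) \<longleftrightarrow> (\<forall>\<rho>\<in>Rs s. \<forall>w\<in>Xs \<rho>. kills c (wcount I w))"
proof -
  have "(\<forall>z\<in>Zall s. \<forall>z'\<in>Zall s. zsum c z z' = 0) \<longleftrightarrow>
      (\<forall>\<rho>\<in>Rs s. \<forall>\<rho>'\<in>Rs s. \<forall>z\<in>Zs \<rho>. \<forall>z'\<in>Zs \<rho>'. zsum c z z' = 0)"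
    by (auto simp: Zall_def)
  also have "\<dots> \<longleftrightarrow> (\<forall>\<rho>\<in>Rs s. \<forall>\<rho>'\<in>Rs s. \<forall>w'\<in>Xs \<rho>'. \<forall>w\<in>Xs \<rho>. wkernel c w' w = 0)"
  proof -
    have "(\<forall>z\<in>Zs \<rho>. \<forall>z'\<in>Zs \<rho>'. zsum c z z' = 0) \<longleftrightarrow> (\<forall>w'\<in>Xs \<rho>'. \<forall>w\<in>Xs \<rho>. wkernel c w' w = 0)"
      if "\<rho> \<in> Rs s" "\<rho>' \<in> Rs s" for \<rho> \<rho>'
      using Rs_subgroup[OF that(1)] Rs_subgroup[OF that(2)]
      by (intro kernel_zero_iff_zsum_zero[symmetric]) simp_all
    then show ?thesis by (simp cong: ball_cong)
  qed
  also have "\<dots> \<longleftrightarrow> (\<forall>\<rho>\<in>Rs s. \<forall>w\<in>Xs \<rho>. kills c (wcount I w))"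
  proof
    assume K: "\<forall>\<rho>\<in>Rs s. \<forall>\<rho>'\<in>Rs s. \<forall>w'\<in>Xs \<rho>'. \<forall>w\<in>Xs \<rho>. wkernel c w' w = 0"
    show "\<forall>\<rho>\<in>Rs s. \<forall>w\<in>Xs \<rho>. kills c (wcount I w)"
    proof (intro ballI)
      fix \<rho> w assume \<rho>: "\<rho> \<in> Rs s" and w: "w \<in> Xs \<rho>"
      have ww: "w \<in> words I (wcount I w)" using w by (auto simp: words_def Xs_def PiE_def)
      have X: "\<exists>\<rho>1\<in>Rs s. w1 \<in> Xs \<rho>1" if w1: "w1 \<in> words I (wcount I w)" for w1
      proof -
        obtain p where p: "p permutes I" "w1 = w \<circ> p" using words_eq_perm[OF finite_I w1 ww] .
        define y where "y = (\<lambda>i\<in>I. \<one>, p)"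
        have y: "y \<in> carrier W" using p by (simp add: y_def wreath_carrier)
        have "\<rho> \<circ> p \<in> Rs s" using \<rho> words_perm[OF p(1)] unfolding Rs_def by blast
        moreover have "w \<circ> snd y \<in> Xs (\<rho> \<circ> p)"
          using comp_mem_Xs_iff[OF y w, of "\<rho> \<circ> p"] by (simp add: y_def)
        ultimately show ?thesis using p(2) by (auto simp: y_def)
      qed
      show "kills c (wcount I w)"
        unfolding kills_iff_kernel using K X by blast
    qed
  next
    assume k: "\<forall>\<rho>\<in>Rs s. \<forall>w\<in>Xs \<rho>. kills c (wcount I w)"
    show "\<forall>\<rho>\<in>Rs s. \<forall>\<rho>'\<in>Rs s. \<forall>w'\<in>Xs \<rho>'. \<forall>w\<in>Xs \<rho>. wkernel c w' w = 0"
    proof (intro ballI)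
      fix \<rho> \<rho>' w' w assume \<rho>: "\<rho> \<in> Rs s" "\<rho>' \<in> Rs s" and w: "w' \<in> Xs \<rho>'" "w \<in> Xs \<rho>"
      show "wkernel c w' w = 0"
      proof (cases "wcount I w' = wcount I w")
        case True
        have "w' \<in> words I (wcount I w)" "w \<in> words I (wcount I w)"
          using w True by (auto simp: words_def Xs_def PiE_def)
        then show ?thesis using k \<rho>(1) w(2) kills_iff_kernel by blast
      next
        case False
        then show ?thesis by (rule kernel_other_content)
      qed
    qed
  qed
  finally show ?thesis .
qed

end

end

section \<open>Colourings of diagrams\<close>

text \<open>The values of \<open>f\<close> in decreasing order. Only the levels
  \<open>k \<ge> 1\<close> can be compared: infinitely many indices of \<open>p\<close> have the
  value 0.\<close>

lemma sorted_partition_exists: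
  fixes f :: "'s \<Rightarrow> nat"
  assumes "finite S"
  shows "\<exists>p\<in>Par. (\<forall>k\<ge>1. card {i. p i = k} = card {s\<in>S. f s = k}) \<and> psize p = (\<Sum>s\<in>S. f s)"
proof -
  obtain ys where ys: "set ys = S" "distinct ys" using finite_distinct_list[OF assms] by blast
  define xs where "xs = rev (sort_key f ys)"
  have xs: "set xs = S" "distinct xs" using ys by (simp_all add: xs_def)
  have sorted: "sorted (rev (map f xs))" by (simp add: xs_def rev_map)
  define p where "p = (\<lambda>i. if i < length xs then f (xs ! i) else 0)"
  have bij: "bij_betw ((!) xs) {..<length xs} S"
    using bij_betw_nth[OF xs(2) refl refl] xs(1) by simp
  have "p j \<le> p i" if "i \<le> j" for i j
    using sorted_rev_nth_mono[OF sorted that] that by (simp add: p_def)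
  then have par: "p \<in> Par" by (auto simp: Par_def antimono_def p_def)
  moreover have "card {i. p i = k} = card {s\<in>S. f s = k}" if "k \<ge> 1" for k
  proof -
    have "{i. p i = k} = {i\<in>{..<length xs}. f (xs ! i) = k}" using that by (auto simp: p_def)
    then show ?thesis using card_fibre_bij[OF bij, of "\<lambda>s. f s = k"] by simp
  qed
  moreover have "psize p = (\<Sum>s\<in>S. f s)"
  proof -
    have "psize p = (\<Sum>i<length xs. p i)" by (rule psize_eq[OF par]) (simp add: p_def)
    also have "\<dots> = (\<Sum>i\<in>{..<length xs}. f (xs ! i))" by (intro sum.cong) (auto simp: p_def)
    also have "\<dots> = (\<Sum>s\<in>S. f s)" by (rule sum.reindex_bij_betw[OF bij])
    finally show ?thesis .
  qed
  ultimately show ?thesis by blast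
qed

lemma card_level:
  fixes \<sigma> :: "'b \<times> 'c \<Rightarrow> nat"
  shows "card {x\<in>{x. \<sigma> x \<noteq> 0}. (fst x, \<sigma> x) = (g, k)} = (if k = 0 then 0 else card {r. \<sigma> (g, r) = k})"
proof (cases "k = 0")
  case True
  then have "{x\<in>{x. \<sigma> x \<noteq> 0}. (fst x, \<sigma> x) = (g, k)} = {}" by auto
  then show ?thesis using True by (simp only: card.empty simp_thms if_True)
next
  case False
  then have "{x\<in>{x. \<sigma> x \<noteq> 0}. (fst x, \<sigma> x) = (g, k)} = Pair g ` {r. \<sigma> (g, r) = k}" by auto
  then show ?thesis using False by (simp add: card_image inj_on_def)
qed

context wreath_characters
begin

text \<open>Letters with nonzero count are matched by the pair of colour and count, which gives the
  renaming for \<open>kills_transport\<close>.\<close>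

lemma kills_transport_levels:
  assumes fin: "finite {x. \<tau> x \<noteq> 0}" "finite {x. \<tau>' x \<noteq> 0}"
    and lev: "\<And>g k. k \<ge> 1 \<Longrightarrow> card {r. \<tau> (g, r) = k} = card {r. \<tau>' (g, r) = k}"
    and kills: "kills c \<tau>'"
  shows "kills c \<tau>"
proof -
  have "card {x\<in>{x. \<tau> x \<noteq> 0}. (fst x, \<tau> x) = y} = card {x\<in>{x. \<tau>' x \<noteq> 0}. (fst x, \<tau>' x) = y}" for y
    by (cases y) (simp only: card_level, simp add: lev)
  from fibre_bij[OF fin this]
  obtain h where "bij_betw h {x. \<tau> x \<noteq> 0} {x. \<tau>' x \<noteq> 0}"
    "\<And>x. x \<in> {x. \<tau> x \<noteq> 0} \<Longrightarrow> (fst (h x), \<tau>' (h x)) = (fst x, \<tau> x)" by blast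
  then show ?thesis using kills by (intro kills_transport[of h \<tau> \<tau>']) auto
qed

lemma finite_support_wcount: "finite {x. wcount I w x \<noteq> 0}"
proof (rule finite_subset)
  show "{x. wcount I w x \<noteq> 0} \<subseteq> w ` I"
  proof
    fix x assume "x \<in> {x. wcount I w x \<noteq> 0}"
    then have nz: "wcount I w x \<noteq> 0" by simp
    show "x \<in> w ` I"
    proof (rule ccontr)
      assume "x \<notin> w ` I"
      then have "{i\<in>I. w i = x} = {}" by blast
      then show False using nz by (simp only: wcount_def card.empty)
    qed
  qed
qed simp

lemma finite_support_content:
  assumes "l \<in> Lambda G n" shows "finite {x. content l x \<noteq> 0}"
proof -
  obtain w where "w \<in> words I (content l)" using content_word_exists[OF assms] .
  then have "wcount I w = content l" by (simp add: words_def)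
  then show ?thesis using finite_support_wcount[of w] by simp
qed

lemma boxes_row: "{b\<in>boxes G s. brow b = (U, r) \<and> P b} = (\<lambda>j. (U, r, j)) ` {j. (U, r, j) \<in> boxes G s \<and> P (U, r, j)}"
  by (auto simp: brow_def)

lemma card_boxes_row:
  "card {b\<in>boxes G s. brow b = (U, r) \<and> P b} = card {j. (U, r, j) \<in> boxes G s \<and> P (U, r, j)}"
  unfolding boxes_row by (rule card_image) (simp add: inj_on_def)

lemma box_subgroup: "wcount I w (g, (U, r)) = card {j. (U, r, j) \<in> boxes G s \<and> col (U, r, j) = g} \<Longrightarrow>
    wcount I w (g, (U, r)) \<noteq> 0 \<Longrightarrow> subgroup U G"
  by (rule ccontr) (simp add: boxes_def)

context
  fixes s assumes s: "s \<in> Sigma_par G n"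
begin

text \<open>An arbitrary numbering of the boxes by \<open>I\<close> turns a colouring into a word of
  colours and rows. Together with \<open>word_colouring\<close> this identifies the contents of the
  words in \<open>Xs\<close> with the colourings in \<open>arrow\<close>.\<close>

lemma colouring_word:
  assumes col: "\<forall>(U, r, j)\<in>boxes G s. col (U, r, j) \<in> ann U"
  obtains \<rho> w where "\<rho> \<in> Rs s" "w \<in> Xs \<rho>"
    "\<And>g U r. wcount I w (g, (U, r)) = card {j. (U, r, j) \<in> boxes G s \<and> col (U, r, j) = g}"
proof -
  have "card I = card (boxes G s)" by (simp add: card_I card_B[OF s])
  then obtain h where h: "bij_betw h I (boxes G s)"
    using finite_same_card_bij[OF finite_I finite_B[OF s]] by blast
  define \<rho> where "\<rho> = (\<lambda>i\<in>I. brow (h i))"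
  define w where "w = (\<lambda>i\<in>I. (col (h i), brow (h i)))"
  have "wcount I \<rho> x = card {b\<in>boxes G s. brow b = x}" for x
  proof -
    have "{i\<in>I. \<rho> i = x} = {i\<in>I. brow (h i) = x}" by (auto simp: \<rho>_def)
    then show ?thesis unfolding wcount_def using card_fibre_bij[OF h, of "\<lambda>b. brow b = x"] by simp
  qed
  then have "\<rho> \<in> Rs s" by (auto simp: Rs_def words_def \<rho>_def)
  moreover have "w \<in> Xs \<rho>"
    unfolding Xs_def
  proof (rule PiE_I)
    fix i assume i: "i \<in> I"
    obtain U r j where b: "h i = (U, r, j)" by (cases "h i") auto
    then have "(U, r, j) \<in> boxes G s" using bij_betwE[OF h] i by metis
    then have "col (U, r, j) \<in> ann U" using col by blast
    then show "w i \<in> ann (fst (\<rho> i)) \<times> {\<rho> i}" using i b by (simp add: w_def \<rho>_def brow_def)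
  qed (simp add: w_def)
  moreover have "wcount I w (g, (U, r)) = card {j. (U, r, j) \<in> boxes G s \<and> col (U, r, j) = g}" for g U r
  proof -
    have "{i\<in>I. w i = (g, (U, r))} = {i\<in>I. brow (h i) = (U, r) \<and> col (h i) = g}" by (auto simp: w_def)
    then have "wcount I w (g, (U, r)) = card {b\<in>boxes G s. brow b = (U, r) \<and> col b = g}"
      unfolding wcount_def using card_fibre_bij[OF h, of "\<lambda>b. brow b = (U, r) \<and> col b = g"] by simp
    then show ?thesis by (simp only: card_boxes_row)
  qed
  ultimately show ?thesis using that by blast
qed

lemma word_colouring:
  assumes \<rho>: "\<rho> \<in> Rs s" and w: "w \<in> Xs \<rho>"
  obtains col where "\<forall>(U, r, j)\<in>boxes G s. col (U, r, j) \<in> ann U"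
    "\<And>g U r. card {j. (U, r, j) \<in> boxes G s \<and> col (U, r, j) = g} = wcount I w (g, (U, r))"
proof -
  have "card {b\<in>boxes G s. brow b = x} = card {i\<in>I. \<rho> i = x}" for x
  proof -
    have "wcount I \<rho> x = card {b\<in>boxes G s. brow b = x}" using \<rho> by (simp add: Rs_def words_def)
    then show ?thesis by (simp only: wcount_def)
  qed
  from fibre_bij[OF finite_B[OF s] finite_I this]
  obtain h where h: "bij_betw h (boxes G s) I" "\<And>b. b \<in> boxes G s \<Longrightarrow> \<rho> (h b) = brow b" by blast
  have hI: "h b \<in> I" if "b \<in> boxes G s" for b using bij_betwE[OF h(1)] that by blast
  have wi: "fst (w i) \<in> ann (fst (\<rho> i))" "snd (w i) = \<rho> i" if "i \<in> I" for i
    using PiE_mem[OF w[unfolded Xs_def] that] by auto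
  define col where "col = (\<lambda>b. fst (w (h b)))"
  have "col (U, r, j) \<in> ann U" if "(U, r, j) \<in> boxes G s" for U r j
    using wi(1)[OF hI[OF that]] h(2)[OF that] by (simp add: col_def brow_def)
  moreover have "card {j. (U, r, j) \<in> boxes G s \<and> col (U, r, j) = g} = wcount I w (g, (U, r))" for g U r
  proof -
    have "{b\<in>boxes G s. brow b = (U, r) \<and> col b = g} = {b\<in>boxes G s. w (h b) = (g, (U, r))}"
    proof (rule Collect_cong, rule conj_cong[OF refl])
      fix b assume b: "b \<in> boxes G s"
      show "brow b = (U, r) \<and> col b = g \<longleftrightarrow> w (h b) = (g, (U, r))"
        using wi(2)[OF hI[OF b]] h(2)[OF b] by (auto simp: col_def prod_eq_iff)
    qed
    then have "card {b\<in>boxes G s. brow b = (U, r) \<and> col b = g} = wcount I w (g, (U, r))"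
      unfolding wcount_def using card_fibre_bij[OF h(1), of "\<lambda>i. w i = (g, (U, r))"] by simp
    then show ?thesis by (simp only: card_boxes_row)
  qed
  ultimately show ?thesis using that[of col] by blast
qed

text \<open>The colouring in \<open>arrow\<close> gives a word whose weight space is killed. Sorting
  the row counts in each colour passes to \<open>content m\<close>, and the dominance order leads on
  to \<open>content l\<close>.\<close>

lemma killed_of_all_words:
  assumes k: "\<forall>\<rho>\<in>Rs s. \<forall>w\<in>Xs \<rho>. kills c (wcount I w)"
    and l: "l \<in> Lambda G n" and arrow: "arrow G n \<theta> s l"
  shows "kills c (content l)"
proof -
  obtain m col where m: "m \<in> Lambda G n" and dom: "\<forall>g\<in>carrier G. dominated (m g) (l g)"
    and col: "\<forall>(U, r, j)\<in>boxes G s. col (U, r, j) \<in> ann U"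
    and lev: "\<forall>g\<in>carrier G. \<forall>k\<ge>1. card {i. m g i = k} =
      card {(U, r). subgroup U G \<and> card {j. (U, r, j) \<in> boxes G s \<and> col (U, r, j) = g} = k}"
    using arrow unfolding arrow_def by blast
  obtain \<rho> w where \<rho>: "\<rho> \<in> Rs s" "w \<in> Xs \<rho>"
    and wc: "\<And>g U r. wcount I w (g, (U, r)) = card {j. (U, r, j) \<in> boxes G s \<and> col (U, r, j) = g}"
    using colouring_word[OF col] by blast
  have "kills c (content m)"
  proof (rule kills_transport_levels[OF finite_support_content[OF m] finite_support_wcount[of w]])
    show "kills c (wcount I w)" using k \<rho> by blast
    fix g and k :: nat assume k1: "k \<ge> 1"
    show "card {i. content m (g, i) = k} = card {r. wcount I w (g, r) = k}"
    proof (cases "g \<in> carrier G")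
      case True
      have "{r. wcount I w (g, r) = k} =
          {(U, r). subgroup U G \<and> card {j. (U, r, j) \<in> boxes G s \<and> col (U, r, j) = g} = k}"
        using box_subgroup[OF wc] k1 by (auto simp: wc[symmetric] Suc_le_eq)
      then show ?thesis using lev True k1 by (simp add: content_def)
    next
      case False
      have "wcount I w (g, x) = 0" for x
      proof -
        have "fst (w i) \<in> carrier G" if "i \<in> I" for i
          using PiE_mem[OF \<rho>(2)[unfolded Xs_def] that] by (auto simp: annihilator_def)
        then have "{i\<in>I. w i = (g, x)} = {}" using False by force
        then show ?thesis by (simp only: wcount_def card.empty)
      qed
      then show ?thesis using False k1 by (simp add: content_def)
    qed
  qed
  then show ?thesis using dom by (intro kills_dominating[OF l m]) auto
qed

text \<open>A word gives a colouring, sorting its counts in each colour gives \<open>m\<close>, and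
  every \<open>l\<close> dominating \<open>m\<close> then satisfies \<open>arrow\<close>. So the
  hypothesis covers all the highest weight vectors that \<open>kills_from_HW\<close> asks
  for.\<close>

lemma all_words_of_killed:
  assumes hw: "\<And>l v. l \<in> Lambda G n \<Longrightarrow> arrow G n \<theta> s l \<Longrightarrow> v \<in> HW (carrier G) I (content l) \<Longrightarrow> opr c v = 0"
    and \<rho>: "\<rho> \<in> Rs s" and w: "w \<in> Xs \<rho>"
  shows "kills c (wcount I w)"
proof -
  let ?\<tau> = "wcount I w"
  obtain col where col: "\<forall>(U, r, j)\<in>boxes G s. col (U, r, j) \<in> ann U"
    and wc: "\<And>g U r. card {j. (U, r, j) \<in> boxes G s \<and> col (U, r, j) = g} = ?\<tau> (g, (U, r))"
    using word_colouring[OF \<rho> w] by blast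
  have wC: "fst (w i) \<in> carrier G" if "i \<in> I" for i
    using PiE_mem[OF w[unfolded Xs_def] that] by (auto simp: annihilator_def)
  define S where "S = (\<lambda>g. {x. ?\<tau> (g, x) \<noteq> 0})"
  have finS: "finite (S g)" for g
  proof (rule finite_subset)
    show "S g \<subseteq> snd ` {x. ?\<tau> x \<noteq> 0}" unfolding S_def by force
    show "finite (snd ` {x. ?\<tau> x \<noteq> 0})" using finite_support_wcount by (rule finite_imageI)
  qed
  have "\<forall>g. \<exists>p. p \<in> Par \<and> (\<forall>k\<ge>1. card {i. p i = k} = card {x\<in>S g. ?\<tau> (g, x) = k}) \<and>
      psize p = (\<Sum>x\<in>S g. ?\<tau> (g, x))"
    by (rule allI, rule sorted_partition_exists[OF finS, unfolded Bex_def])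
  from choice[OF this] obtain p where "\<forall>g. p g \<in> Par \<and>
      (\<forall>k\<ge>1. card {i. p g i = k} = card {x\<in>S g. ?\<tau> (g, x) = k}) \<and> psize (p g) = (\<Sum>x\<in>S g. ?\<tau> (g, x))" ..
  then have p: "\<And>g. p g \<in> Par" "\<And>g. psize (p g) = (\<Sum>x\<in>S g. ?\<tau> (g, x))"
    and lev0: "\<And>g k. k \<ge> 1 \<Longrightarrow> card {i. p g i = k} = card {x\<in>S g. ?\<tau> (g, x) = k}" by simp_all
  have lev: "card {i. p g i = k} = card {x. ?\<tau> (g, x) = k}" if "k \<ge> 1" for g k
  proof -
    have "{x\<in>S g. ?\<tau> (g, x) = k} = {x. ?\<tau> (g, x) = k}" using that by (auto simp: S_def)
    then show ?thesis using lev0[OF that] by simp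
  qed
  define m where "m = restrict p (carrier G)"
  have psz: "psize (p g) = card {i\<in>I. fst (w i) = g}" for g
  proof -
    have e: "{i\<in>{i\<in>I. fst (w i) = g}. snd (w i) = x} = {i\<in>I. w i = (g, x)}" for x by (auto simp: prod_eq_iff)
    have "psize (p g) = (\<Sum>x\<in>S g. card {i\<in>{i\<in>I. fst (w i) = g}. snd (w i) = x})"
      unfolding p(2) e by (simp only: wcount_def)
    also have "\<dots> = card {i\<in>I. fst (w i) = g}"
    proof (rule sum_card_fibres[OF _ finS])
      show "(\<lambda>i. snd (w i)) ` {i\<in>I. fst (w i) = g} \<subseteq> S g"
      proof (rule image_subsetI)
        fix i assume "i \<in> {i\<in>I. fst (w i) = g}"
        then have "i \<in> I" "w i = (g, snd (w i))" by (auto simp: prod_eq_iff)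
        then show "snd (w i) \<in> S g" using wcount_pos[OF finite_I, of i w] by (simp add: S_def)
      qed
    qed simp
    finally show ?thesis .
  qed
  have "(\<Sum>g\<in>carrier G. psize (m g)) = (\<Sum>g\<in>carrier G. card {i\<in>I. fst (w i) = g})"
    using psz by (simp add: m_def)
  also have "\<dots> = n"
    using sum_card_fibres[OF finite_I finG, of "\<lambda>i. fst (w i)"] wC card_I by auto
  finally have m: "m \<in> Lambda G n" using p(1) by (auto simp: Lambda_def m_def)
  obtain u where u: "u \<in> words I (content m)" using content_word_exists[OF m] .
  have uc: "wcount I u = content m" "u \<in> extensional I" using u by (auto simp: words_def)
  have "kills c (wcount I u)"
  proof (rule kills_from_HW[OF uc(2)])
    show "fst (u i) \<in> carrier G" if "i \<in> I" for i
    proof -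
      have "content m (u i) \<noteq> 0" using words_support[OF finite_I u] that by blast
      then show ?thesis by (cases "u i") (auto simp: content_def split: if_splits)
    qed
    fix l v assume l: "l \<in> Lambda G n" and v: "v \<in> HW (carrier G) I (content l)"
      and dom: "\<And>g. g \<in> carrier G \<Longrightarrow> dominated (\<lambda>i. wcount I u (g, i)) (l g)"
    have "dominated (m g) (l g)" if g: "g \<in> carrier G" for g
      using dom[OF g] g unfolding uc(1) by (simp add: content_def)
    moreover have "card {i. m g i = k} =
        card {(U, r). subgroup U G \<and> card {j. (U, r, j) \<in> boxes G s \<and> col (U, r, j) = g} = k}"
      if "g \<in> carrier G" "k \<ge> 1" for g k
    proof -
      have "{x. ?\<tau> (g, x) = k} =
          {(U, r). subgroup U G \<and> card {j. (U, r, j) \<in> boxes G s \<and> col (U, r, j) = g} = k}"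
        using box_subgroup[OF wc[symmetric]] that(2) by (auto simp: wc Suc_le_eq)
      then show ?thesis using lev[OF that(2)] that(1) by (simp add: m_def)
    qed
    ultimately have "arrow G n \<theta> s l" using m col unfolding arrow_def by blast
    then show "opr c v = 0" using hw[OF l _ v] by blast
  qed
  then have km: "kills c (content m)" by (simp only: uc(1))
  show ?thesis
  proof (rule kills_transport_levels[OF finite_support_wcount finite_support_content[OF m] _ km])
    fix g and k :: nat assume k1: "k \<ge> 1"
    show "card {r. ?\<tau> (g, r) = k} = card {i. content m (g, i) = k}"
    proof (cases "g \<in> carrier G")
      case True
      then show ?thesis using lev[OF k1] by (simp add: content_def m_def)
    next
      case False
      have "?\<tau> (g, x) = 0" for x
      proof -
        have "{i\<in>I. w i = (g, x)} = {}" using False wC by force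
        then show ?thesis by (simp only: wcount_def card.empty)
      qed
      then show ?thesis using False k1 by (simp add: content_def)
    qed
  qed
qed

lemma sigma_transitive_iff_dual_dist:
  assumes P: "\<And>l. l \<in> Lambda G n \<Longrightarrow> blocks_for G n l (P l)"
    and Y: "Y \<subseteq> carrier W" "Y \<noteq> {}"
  shows "sigma_transitive G n s Y \<longleftrightarrow>
    (\<forall>l\<in>Lambda G n. arrow G n \<theta> s l \<and> l \<one> \<noteq> one_part n \<longrightarrow> dual_dist G n \<theta> (P l) Y l = 0)"
proof -
  interpret W: group W by (rule wreath_group)
  let ?a = "of_nat (card Y) / complex_of_nat (card (carrier W))"
  define c where "c = (\<lambda>y. (if y \<in> Y then 1 else 0) - ?a)"
  have Wpos: "card (carrier W) \<noteq> 0" using finite_wreath W.one_closed by auto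
  have sumc: "(\<Sum>y\<in>carrier W. c y) = 0"
  proof -
    have "carrier W \<inter> Y = Y" using Y(1) by blast
    then have "(\<Sum>y\<in>carrier W. if y \<in> Y then 1 else 0) = complex_of_nat (card Y)"
      using finite_wreath by (simp add: sum.If_cases)
    then show ?thesis using Wpos by (simp add: c_def sum_subtractf)
  qed
  \<comment> \<open>The two operators differ by a multiple of the sum over the whole group, which
    annihilates these vectors.\<close>
  have opr_c: "opr c (act w (tensor (P l) l b)) = opr (\<lambda>y. if y \<in> Y then 1 else 0) (act w (tensor (P l) l b))"
    if "l \<in> Lambda G n" "l \<one> \<noteq> one_part n" "b \<in> onbs (P l) l" "w \<in> carrier W" for l b w
  proof
    fix u
    let ?v = "act w (tensor (P l) l b)"
    have "opr c ?v u = opr (\<lambda>y. if y \<in> Y then 1 else 0) ?v u - ?a * opr (\<lambda>_. 1) ?v u"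
      by (simp only: opr_def c_def left_diff_distrib sum_subtractf sum_distrib_left mult_1_left)
    moreover have "opr (\<lambda>_. 1) ?v u = 0"
      using opr_all_tensor[OF that(1) P[OF that(1)] that(2-4)] by simp
    ultimately show "opr c ?v u = opr (\<lambda>y. if y \<in> Y then 1 else 0) ?v u" by simp
  qed
  have "sigma_transitive G n s Y \<longleftrightarrow> (\<forall>\<rho>\<in>Rs s. \<forall>w\<in>Xs \<rho>. kills c (wcount I w))"
    unfolding c_def sigma_transitive_iff_zsum[OF s Y] zsum_zero_iff_kills[OF s] ..
  also have "\<dots> \<longleftrightarrow> (\<forall>l\<in>Lambda G n. arrow G n \<theta> s l \<and> l \<one> \<noteq> one_part n \<longrightarrow> dual_dist G n \<theta> (P l) Y l = 0)"
  proof
    assume k: "\<forall>\<rho>\<in>Rs s. \<forall>w\<in>Xs \<rho>. kills c (wcount I w)"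
    show "\<forall>l\<in>Lambda G n. arrow G n \<theta> s l \<and> l \<one> \<noteq> one_part n \<longrightarrow> dual_dist G n \<theta> (P l) Y l = 0"
    proof (intro ballI impI)
      fix l assume l: "l \<in> Lambda G n" and a: "arrow G n \<theta> s l \<and> l \<one> \<noteq> one_part n"
      have kl: "kills c (content l)" using killed_of_all_words[OF k l] a by blast
      have "opr (\<lambda>y. if y \<in> Y then 1 else 0) (act w (tensor (P l) l b)) = 0"
        if "w \<in> carrier W" "b \<in> onbs (P l) l" for w b
      proof -
        have "act w (tensor (P l) l b) \<in> wt_space I (content l)"
          by (rule act_wt_space[OF that(1) tensor_wt_space[OF l P[OF l] that(2)]])
        then have "opr c (act w (tensor (P l) l b)) = 0" using kl by (simp add: kills_def)
        then show ?thesis using opr_c[OF l _ that(2,1)] a by simp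
      qed
      then show "dual_dist G n \<theta> (P l) Y l = 0"
        unfolding dual_dist_eq_0_iff[OF l P[OF l] Y] by blast
    qed
  next
    assume d: "\<forall>l\<in>Lambda G n. arrow G n \<theta> s l \<and> l \<one> \<noteq> one_part n \<longrightarrow> dual_dist G n \<theta> (P l) Y l = 0"
    have hw: "opr c v = 0"
      if l: "l \<in> Lambda G n" and a: "arrow G n \<theta> s l" and v: "v \<in> HW (carrier G) I (content l)" for l v
    proof (cases "l \<one> = one_part n")
      \<comment> \<open>The exceptional case: the coefficients of \<open>c\<close> sum to 0, so
        \<open>c\<close> acts as 0 on the trivial module.\<close>
      case True
      then show ?thesis using opr_trivial[OF l True _ sumc] v by (simp add: HW_def)
    next
      case False
      then have "dual_dist G n \<theta> (P l) Y l = 0" using d l a by blast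
      then have "opr c (act w (tensor (P l) l b)) = 0" if "w \<in> carrier W" "b \<in> onbs (P l) l" for w b
        using opr_c[OF l False that(2,1)] that unfolding dual_dist_eq_0_iff[OF l P[OF l] Y] by simp
      then show ?thesis by (rule HW_killed[OF l P[OF l] _ v])
    qed
    show "\<forall>\<rho>\<in>Rs s. \<forall>w\<in>Xs \<rho>. kills c (wcount I w)"
    proof (intro ballI)
      fix \<rho> w assume "\<rho> \<in> Rs s" "w \<in> Xs \<rho>"
      then show "kills c (wcount I w)" using hw by (intro all_words_of_killed) auto
    qed
  qed
  finally show ?thesis .
qed

end

end

theorem theorem4p6:
  fixes G :: "('g, 'm) monoid_scheme" (structure)
    and n :: nat
    and \<theta> :: "'g \<Rightarrow> 'g \<Rightarrow> complex"
    and P :: "('g \<Rightarrow> nat \<Rightarrow> nat) \<Rightarrow> 'g \<Rightarrow> nat set"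
    and \<sigma> :: "'g set \<Rightarrow> nat \<Rightarrow> nat"
    and Y :: "((nat \<Rightarrow> 'g) \<times> (nat \<Rightarrow> nat)) set"
  assumes "comm_group G" and "finite (carrier G)" and "n \<ge> 1"
    and "\<theta> \<in> iso G (character_group G)"
    and "\<And>l. l \<in> Lambda G n \<Longrightarrow> blocks_for G n l (P l)"
    and "\<sigma> \<in> Sigma_par G n"
    and "Y \<subseteq> carrier (wreath G n)" and "Y \<noteq> {}"
  shows "sigma_transitive G n \<sigma> Y \<longleftrightarrow>
    (\<forall>l \<in> Lambda G n. arrow G n \<theta> \<sigma> l \<and> l \<one> \<noteq> one_part n \<longrightarrow> dual_dist G n \<theta> (P l) Y l = 0)"
proof -
  interpret wreath_characters G n \<theta>
    using assms(1,2,4) by (simp add: wreath_characters_def wreath_characters_axioms_def)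
  show ?thesis using assms(5-8) by (intro sigma_transitive_iff_dual_dist)
qed

end
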